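(* Let $k\geq 1$ be a real number and for $x>0$ let $P_k(x)=\sum_{n=1}^{\infty} \frac{\mu(n)}{n^k} \exp\left(-\frac{x}{n^2}\right)$, where $\mu$ is the Möbius function. Then the Riemann hypothesis is true if and only if for every $\epsilon>0$, \[ P_k(x) = O_{\epsilon}\left(x^{-\frac{k}{2}+\frac{1}{4}+\epsilon}\right)\quad \text{as } x\to\infty. \] *)

theory Defs
  imports
    "HOL-Complex_Analysis.Complex_Analysis"
    "HOL-Computational_Algebra.Computational_Algebra"
    "HOL-Library.Landau_Symbols"
begin

definition moebius_mu :: "nat \<Rightarrow> real" where
  "moebius_mu n = (if squarefree n then (-1) ^ card (prime_factors n) else 0)"

definition is_zeta_continuation :: "(complex \<Rightarrow> complex) \<Rightarrow> bool" where
  "is_zeta_continuation f \<longleftrightarrow>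
     f holomorphic_on (- {1}) \<and>
     (\<forall>s. Re s > 1 \<longrightarrow> (\<lambda>n. 1 / of_nat (Suc n) powr s) sums f s)"

(* The continuation is unique away from the pole 1, as shown below, so the choice
   affects only the value at 1. *)
definition riemann_zeta :: "complex \<Rightarrow> complex" where
  "riemann_zeta = (SOME f. is_zeta_continuation f)"

lemma is_zeta_continuation_unique:
  assumes f: "is_zeta_continuation f" and g: "is_zeta_continuation g" and "s \<noteq> 1"
  shows "f s = g s"
proof (rule analytic_continuation_open[where s = "{s. Re s > 1}" and s' = "- {1}" and f = f and g = g])
  show "open {s. Re s > 1}" by (rule open_halfspace_Re_gt)
  have "(2 :: complex) \<in> {s. Re s > 1}" by simp
  then show "{s. Re s > 1} \<noteq> {}" by blast
  show "connected (- {1 :: complex})" by (rule connected_punctured_universe) simp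
  show "f holomorphic_on - {1}" "g holomorphic_on - {1}"
    using f g by (simp_all add: is_zeta_continuation_def)
  show "f z = g z" if "z \<in> {s. Re s > 1}" for z
    using that f g sums_unique2 unfolding is_zeta_continuation_def by blast
qed (use \<open>s \<noteq> 1\<close> in auto)

(* The zeros in the open critical strip are the nontrivial zeros. *)
definition riemann_hypothesis :: bool where
  "riemann_hypothesis \<longleftrightarrow>
     (\<forall>s. riemann_zeta s = 0 \<and> 0 < Re s \<and> Re s < 1 \<longrightarrow> Re s = 1 / 2)"

(* The sum over n >= 1 is indexed from 0 through Suc. At k = 1 it converges only
   conditionally, hence the ordered sum suminf rather than infsum. *)
definition P :: "real \<Rightarrow> real \<Rightarrow> real" where
  "P k x = (\<Sum>n. moebius_mu (Suc n) / real (Suc n) powr k * exp (- x / (real (Suc n))\<^sup>2))"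

end

(*
  The Mellin transform of P_k(x) - P_k(0) is Gamma(s) / zeta(k - 2 s) on -1 < Re s < 0. A bound
  P_k(x) = O(x^(-k/2 + 1/4 + e)) continues it to Re s < k/2 - 1/4 - e, so zeta(k - 2 s) cannot vanish
  there; the functional equation, which comes from the theta transformation, reflects zeros with
  Re < 1/2 to zeros with Re > 1/2.

  Conversely, under the Riemann hypothesis the Borel-Caratheodory inequality for log zeta bounds 1/zeta
  polynomially on Re w >= 1/2 + d. This suffices against the decay of Gamma to integrate
  Gamma(s) x^(-s) / zeta(k - 2 s) over Re s = k/2 - 1/4 - e. Pushing that line to minus infinity
  collects the residues (-x)^j / (j! zeta(k + 2 j)), which sum to P_k(x).

  For k = 1 already the convergence of P_1 amounts to that of the series of mu(n)/n, which is as deep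
  as the prime number theorem; it is obtained by Newman's contour argument.
*)
theory Submission
  imports
    Defs
    "HOL-Probability.Probability"
    "HOL-Real_Asymp.Real_Asymp"
begin

section \<open>Fourier series and the theta transformation\<close>

text \<open>Subtracting P_k(0), the value of 1/zeta at k, makes the function O(x) at 0. This opens
  the strip -1 < Re s < 0, and there k - 2 s has real part above 1 even for k = 1, so the Dirichlet
  series of mu converges absolutely. The exponent is an image of the critical line: Re s = k/2 - 1/4
  - \<epsilon> means Re (k - 2 s) = 1/2 + 2 \<epsilon>.

  The converse needs no Mellin inversion: for fixed x and N the residue theorem on a finite
  rectangle bounds the N-th partial sum of the residue series; then the height of the rectangle goes
  to infinity, and after it N.

  The point 1 is delicate. For k = 1 the argument k - 2 s meets the pole at s = 0, and the value of
  the chosen continuation there is arbitrary. The analysis therefore runs on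
  \<open>zeta_entire\<close>, which is (s - 1) zeta(s) with value 1 at 1, and on
  \<open>inv_zeta\<close>, which is 0 at 1. As \<open>riemann_zeta\<close> is selected by
  \<open>SOME\<close>, nothing is known of it until some continuation exists; the theta formula
  supplies one together with the reflection of zeros.\<close>

lemma gaussian_fourier_transform:
  fixes t m :: real
  assumes t: "t > 0"
  shows "has_bochner_integral lborel
     (\<lambda>y. exp (- of_real (pi * t) * of_real y ^ 2) * exp (- (2 * of_real pi * \<i> * of_real m * of_real y)))
     (complex_of_real (exp (- pi * m\<^sup>2 / t) / sqrt t))"
proof -
  \<comment> \<open>The scaling turns the density exponent (c y)^2 / 2 into pi t y^2, and \<tau> is
    the frequency with \<tau> c y = - 2 pi m y. The value then comes from the characteristic
    function of the standard normal law.\<close>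
  define c where "c = sqrt (2 * pi * t)"
  define \<tau> where "\<tau> = - 2 * pi * m / c"
  have c: "c > 0" using t by (simp add: c_def)
  have int: "integrable lborel (\<lambda>x. std_normal_density x *\<^sub>R iexp (\<tau> * x))"
  proof (rule Bochner_Integration.integrable_bound)
    show "integrable lborel std_normal_density" by simp
  qed (auto simp: norm_mult)
  have "char std_normal_distribution \<tau> = (\<integral>x. std_normal_density x *\<^sub>R iexp (\<tau> * x) \<partial>lborel)"
    unfolding char_def by (subst integral_density) (auto simp: complex_eq_iff)
  then have eq: "(\<integral>x. std_normal_density x *\<^sub>R iexp (\<tau> * x) \<partial>lborel) = of_real (exp (- (\<tau>\<^sup>2) / 2))"
    by (simp add: char_std_normal_distribution)
  have "has_bochner_integral lborel (\<lambda>x. std_normal_density x *\<^sub>R iexp (\<tau> * x)) (of_real (exp (- (\<tau>\<^sup>2) / 2)))"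
    using int eq has_bochner_integral_iff by blast
  then have "has_bochner_integral lborel (\<lambda>y. std_normal_density (0 + c * y) *\<^sub>R iexp (\<tau> * (0 + c * y)))
      (of_real (exp (- (\<tau>\<^sup>2) / 2)) /\<^sub>R \<bar>c\<bar>)"
    using lborel_has_bochner_integral_real_affine_iff[of c "\<lambda>x. std_normal_density x *\<^sub>R iexp (\<tau> * x)"
        "of_real (exp (- (\<tau>\<^sup>2) / 2))" 0] c by auto
  then have "has_bochner_integral lborel (\<lambda>y. complex_of_real (sqrt (2 * pi)) * (std_normal_density (0 + c * y) *\<^sub>R iexp (\<tau> * (0 + c * y))))
      (complex_of_real (sqrt (2 * pi)) * (of_real (exp (- (\<tau>\<^sup>2) / 2)) /\<^sub>R \<bar>c\<bar>))"
    by (rule has_bochner_integral_mult_right) 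
  also have "(\<lambda>y. complex_of_real (sqrt (2 * pi)) * (std_normal_density (0 + c * y) *\<^sub>R iexp (\<tau> * (0 + c * y))))
    = (\<lambda>y. exp (- of_real (pi * t) * of_real y ^ 2) * exp (- (2 * of_real pi * \<i> * of_real m * of_real y)))"
  proof
    fix y
    have 1: "\<tau> * (c * y) = - 2 * pi * m * y" using c by (simp add: \<tau>_def)
    have 2: "(c * y)\<^sup>2 / 2 = pi * t * y\<^sup>2" using t by (simp add: c_def power_mult_distrib)
    have "complex_of_real (sqrt (2 * pi)) * (std_normal_density (0 + c * y) *\<^sub>R iexp (\<tau> * (0 + c * y)))
       = complex_of_real (exp (- ((c*y)\<^sup>2 / 2))) * iexp (\<tau> * (c * y))"
      by (simp add: std_normal_density_def scaleR_conv_of_real)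
    also have "\<dots> = complex_of_real (exp (- (pi * t * y\<^sup>2))) * iexp (- 2 * pi * m * y)"
      by (simp only: 1 2)
    also have "\<dots> = exp (- of_real (pi * t) * of_real y ^ 2) * exp (- (2 * of_real pi * \<i> * of_real m * of_real y))"
      by (simp add: exp_of_real[symmetric] mult_ac)
    finally show "complex_of_real (sqrt (2 * pi)) * (std_normal_density (0 + c * y) *\<^sub>R iexp (\<tau> * (0 + c * y))) = \<dots>" .
  qed
  also have "(complex_of_real (sqrt (2 * pi)) * (of_real (exp (- (\<tau>\<^sup>2) / 2)) /\<^sub>R \<bar>c\<bar>)) = complex_of_real (exp (- pi * m\<^sup>2 / t) / sqrt t)"
  proof -
    have "\<tau>\<^sup>2 / 2 = pi * m\<^sup>2 / t" using t by (simp add: \<tau>_def c_def power_mult_distrib power_divide power2_eq_square field_simps)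
    moreover have "sqrt (2*pi) / c = 1 / sqrt t" using t by (simp add: c_def real_sqrt_mult)
    ultimately show ?thesis using c
      by (simp add: scaleR_conv_of_real field_simps flip: of_real_mult of_real_divide)
  qed
  finally show ?thesis .
qed

text \<open>One integration by parts on the unit interval: the boundary terms are at most
  \<open>D\<close>, the integral of the derivative at most \<open>C\<close>, and neither depends on
  m. The boundary terms stay because h need not be periodic.\<close>

lemma fourier_coefficient_bound:
  fixes h h' :: "complex \<Rightarrow> complex"
  assumes h: "\<And>y. y \<in> {-1/2..1/2} \<Longrightarrow> (h has_field_derivative h' (of_real y)) (at (of_real y))"
    and cont: "continuous_on {-1/2..1/2} (\<lambda>y::real. h' (of_real y))"
  shows "\<exists>B. \<forall>m::int. norm (of_int m * integral {-1/2..1/2::real} (\<lambda>y. h (of_real y) * exp (- (2 * of_real pi * \<i> * of_int m * of_real y)))) \<le> B"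
proof -
  have conth: "continuous_on {-1/2..1/2} (\<lambda>y::real. h (of_real y))"
  proof (rule continuous_at_imp_continuous_on, rule ballI)
    fix y :: real assume "y \<in> {-1/2..1/2}"
    then have "isCont h (of_real y)" using h DERIV_isCont by blast
    then show "isCont (\<lambda>y::real. h (of_real y)) y"
      by (rule isCont_o2[rotated]) (auto intro: continuous_intros)
  qed
  obtain C where C: "\<And>y. y \<in> {-1/2..1/2::real} \<Longrightarrow> norm (h' (of_real y)) \<le> C"
    using compact_continuous_image[OF cont compact_Icc] compact_imp_bounded bounded_iff by (metis (mono_tags, lifting) image_eqI)
  define D where "D = norm (h (1/2)) + norm (h (-1/2))"
  have "norm (of_int m * integral {-1/2..1/2::real} (\<lambda>y. h (of_real y) * exp (- (2 * of_real pi * \<i> * of_int m * of_real y)))) \<le> (D + C) / (2*pi)" for m :: int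
  proof -
    define e where "e = (\<lambda>y::real. exp (- (2 * of_real pi * \<i> * of_int m * complex_of_real y)))"
    have ne: "norm (e y) = 1" for y by (simp add: e_def)
    have conte: "continuous_on A e" for A by (auto simp: e_def intro!: continuous_intros)
    have "((\<lambda>y. h' (of_real y) * e y + h (of_real y) * (- (2 * of_real pi * \<i> * of_int m) * e y)) has_integral
        (h (of_real (1/2)) * e (1/2) - h (of_real (-1/2)) * e (-1/2))) {-1/2..1/2::real}"
    proof (rule fundamental_theorem_of_calculus)
      fix y :: real assume y: "y \<in> {-1/2..1/2}"
      have "((\<lambda>y. exp (- (2 * of_real pi * \<i> * of_int m * y))) has_field_derivative
         - (2 * of_real pi * \<i> * of_int m) * e y) (at (of_real y))"
        unfolding e_def by (auto intro!: derivative_eq_intros)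
      from DERIV_mult[OF h[OF y] this]
      show "((\<lambda>y. h (of_real y) * e y) has_vector_derivative (h' (of_real y) * e y + h (of_real y) * (- (2 * of_real pi * \<i> * of_int m) * e y))) (at y within {-1/2..1/2})"
        using has_vector_derivative_real_field[of "\<lambda>z. h z * exp (- (2 * of_real pi * \<i> * of_int m * z))" _ y "{-1/2..1/2}"] 
        by (simp add: e_def add.commute mult_ac)
    qed simp
    moreover have i1: "(\<lambda>y. h' (of_real y) * e y) integrable_on {-1/2..1/2::real}"
      by (intro integrable_continuous_real continuous_on_mult cont conte)
    moreover have i2: "(\<lambda>y. h (of_real y) * e y) integrable_on {-1/2..1/2::real}"
      by (intro integrable_continuous_real continuous_on_mult conth conte)
    ultimately have eq: "(h (1/2) * e (1/2) - h (-1/2) * e (-1/2)) = integral {-1/2..1/2} (\<lambda>y. h' (of_real y) * e y)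
         + (- (2 * of_real pi * \<i> * of_int m)) * integral {-1/2..1/2} (\<lambda>y. h (of_real y) * e y)"
    proof -
      have "((\<lambda>y. h' (of_real y) * e y + (- (2 * of_real pi * \<i> * of_int m)) * (h (of_real y) * e y)) has_integral 
         (integral {-1/2..1/2} (\<lambda>y. h' (of_real y) * e y)
         + (- (2 * of_real pi * \<i> * of_int m)) * integral {-1/2..1/2} (\<lambda>y. h (of_real y) * e y))) {-1/2..1/2::real}"
        by (intro has_integral_add has_integral_mult_right integrable_integral i1 i2)
      with \<open>((\<lambda>y. h' (of_real y) * e y + h (of_real y) * (- (2 * of_real pi * \<i> * of_int m) * e y)) has_integral _) _\<close>
      show ?thesis by (simp add: has_integral_iff mult_ac)
    qed
    have "norm (2 * of_real pi * \<i> * of_int m * integral {-1/2..1/2} (\<lambda>y. h (of_real y) * e y))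
      = norm (integral {-1/2..1/2} (\<lambda>y. h' (of_real y) * e y) - (h (1/2) * e (1/2) - h (-1/2) * e (-1/2)))"
      unfolding eq by simp
    also have "\<dots> \<le> norm (integral {-1/2..1/2} (\<lambda>y. h' (of_real y) * e y)) + D"
    proof -
      have "norm (h (1/2) * e (1/2) - h (-1/2) * e (-1/2)) \<le> norm (h (1/2) * e (1/2)) + norm (h (-1/2) * e (-1/2))"
        by (rule norm_triangle_ineq4)
      also have "\<dots> = D" unfolding D_def norm_mult ne by simp
      finally show ?thesis by (intro order_trans[OF norm_triangle_ineq4 add_left_mono])
    qed
    also have "norm (integral {-1/2..1/2} (\<lambda>y. h' (of_real y) * e y)) \<le> C * (1/2 - (-1/2))"
      by (rule integral_bound[OF _ continuous_on_mult[OF cont conte]]) (auto simp: norm_mult ne intro: C)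
    finally have "2 * pi * norm (of_int m * integral {-1/2..1/2} (\<lambda>y. h (of_real y) * e y)) \<le> D + C"
      by (simp add: norm_mult)
    then show ?thesis unfolding e_def by (simp add: field_simps)
  qed
  then show ?thesis by blast
qed


text \<open>For z in the closed unit disc the real part of (z + \<sigma> n)^2 is at least (n - 1)^2
  - 1. The resulting decay in n is uniform in z, as the Weierstrass test for the periodized Gaussian
  on a complex disc requires.\<close>

lemma norm_gaussian_shift_le:
  fixes t :: real and z :: complex
  assumes t: "t > 0" and z: "norm z \<le> 1" and n: "n \<ge> 1" and \<sigma>: "\<sigma> = 1 \<or> \<sigma> = -1"
  shows "norm (exp (- of_real (pi * t) * (z + \<sigma> * of_nat n) ^ 2)) \<le> exp (- pi * t * (real n - 1)\<^sup>2 + pi * t)"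
proof -
  obtain s :: real where s: "\<sigma> = of_real s" "s = 1 \<or> s = -1" using \<sigma> by (metis of_real_1 of_real_minus)
  have "\<bar>Re z\<bar> \<le> 1" "\<bar>Im z\<bar> \<le> 1" using z abs_Re_le_cmod[of z] abs_Im_le_cmod[of z] by linarith+
  then have i: "(Im z)\<^sup>2 \<le> 1" and r: "real n - 1 \<le> \<bar>Re z + s * n\<bar>" using s n 
    by (auto simp: abs_square_le_1)
  have "(real n - 1)\<^sup>2 \<le> (Re z + s * n)\<^sup>2" using r n by (metis abs_le_square_iff abs_of_nonneg diff_ge_0_iff_ge of_nat_1 of_nat_mono)
  then have "(real n - 1)\<^sup>2 - 1 \<le> Re ((z + \<sigma> * of_nat n)^2)" using i
    by (simp add: power2_eq_square s(1))
  then have "pi * t * ((real n - 1)\<^sup>2 - 1) \<le> pi * t * Re ((z + \<sigma> * of_nat n)^2)" using t by (intro mult_left_mono) auto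
  then show ?thesis by (simp add: norm_exp_eq_Re algebra_simps)
qed

lemma summable_exp_minus_square:
  assumes "c > (0::real)"
  shows "summable (\<lambda>n. exp (- c * (real n)\<^sup>2))"
proof (rule summable_comparison_test')
  show "summable (\<lambda>n. exp (-c) ^ n)" using assms by (intro summable_geometric) auto
  show "norm (exp (- c * (real n)\<^sup>2)) \<le> exp (-c) ^ n" if "n \<ge> 0" for n
  proof -
    have "real n \<le> (real n)\<^sup>2" by (cases n) (auto simp: power2_eq_square)
    then have "c * real n \<le> c * (real n)\<^sup>2" using assms by simp
    then show ?thesis by (simp add: exp_of_nat_mult[symmetric] mult.commute)
  qed
qed

text \<open>Dividing g - g(0) by exp(2 pi i y) - 1 turns the Fourier coefficients into differences of
  those of the quotient, so the partial sums telescope.\<close>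
lemma fourier_series_at_0:
  fixes g :: "complex \<Rightarrow> complex"
  assumes hol: "g holomorphic_on ball 0 1"
  shows "(\<lambda>N. \<Sum>m\<in>{-int N..int N}. integral {-1/2..1/2::real} 
     (\<lambda>y. g (of_real y) * exp (- (2 * of_real pi * \<i> * of_int m * of_real y)))) \<longlonglongrightarrow> g 0"
proof -
  define E where "E = (\<lambda>(m::int) (y::real). exp (- (2 * of_real pi * \<i> * of_int m * complex_of_real y)))"
  define c where "c = (\<lambda>(f :: complex \<Rightarrow> complex) m. integral {-1/2..1/2::real} (\<lambda>y. f (of_real y) * E m y))"
  define e where "e = (\<lambda>z::complex. exp (2 * of_real pi * \<i> * z))"
  \<comment> \<open>\<open>A\<close> and \<open>B\<close> are the difference quotients at 0 of g and
    of exp(2 pi i z), with removable singularities filled in. Their quotient \<open>h\<close> is (g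
    - g(0)) / (exp(2 pi i z) - 1), holomorphic also at 0.\<close>
  define A where "A = (\<lambda>z. if z = 0 then deriv g 0 else (g z - g 0) / (z - 0))"
  define B where "B = (\<lambda>z. if z = 0 then deriv e 0 else (e z - e 0) / (z - 0))"
  define h where "h = (\<lambda>z. A z / B z)"
  have real_in: "complex_of_real y \<in> ball 0 1" if "y \<in> {-1/2..1/2}" for y using that by auto
  have e0: "e 0 = 1" by (simp add: e_def)
  have de: "deriv e 0 = 2 * of_real pi * \<i>"
    unfolding e_def by (rule DERIV_imp_deriv) (auto intro!: derivative_eq_intros)
  \<comment> \<open>A solution is an integer of modulus below 1. Hence 0 is the only zero of the
    denominator in the disc, which contains the whole interval of integration.\<close>
  have e1: "z = 0" if "e z = 1" "z \<in> ball 0 1" for z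
  proof -
    from that(1) obtain n :: int where n: "Re (2 * of_real pi * \<i> * z) = 0" "Im (2 * of_real pi * \<i> * z) = of_int (2 * n) * pi"
      unfolding e_def exp_eq_1 by auto
    from n have "Im z = 0" "Re z = of_int n" by auto
    moreover have "\<bar>Re z\<bar> < 1" using that(2) abs_Re_le_cmod[of z] by simp
    ultimately show "z = 0" by (simp add: complex_eq_iff)
  qed
  have "A holomorphic_on ball 0 1" unfolding A_def by (rule pole_lemma[OF hol]) simp
  moreover have "B holomorphic_on ball 0 1" unfolding B_def
    by (rule pole_lemma) (auto simp: e_def intro!: holomorphic_intros)
  moreover have Bnz: "B z \<noteq> 0" if "z \<in> ball 0 1" for z
    using e1[OF _ that] by (auto simp: B_def de e0)
  ultimately have holh: "h holomorphic_on ball 0 1" unfolding h_def by (intro holomorphic_on_divide) auto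
  have gh: "g z - g 0 = h z * (e z - 1)" if "z \<in> ball 0 1" for z
    using Bnz[OF that] e1[OF _ that] by (auto simp: h_def A_def B_def e0 split: if_splits)
  have cont: "continuous_on {-1/2..1/2} (\<lambda>y::real. f (of_real y))" if "f holomorphic_on ball 0 1" for f :: "complex \<Rightarrow> complex"
    by (rule continuous_on_compose2[OF holomorphic_on_imp_continuous_on[OF that]]) (auto intro!: continuous_intros)
  have contE: "continuous_on S (E m)" for m S unfolding E_def by (intro continuous_intros)
  have int: "(\<lambda>y. f (of_real y) * E m y) integrable_on {-1/2..1/2::real}" if "f holomorphic_on ball 0 1" for f m
    by (intro integrable_continuous_real continuous_on_mult cont that contE)
  have cE: "integral {-1/2..1/2::real} (E m) = (if m = 0 then 1 else 0)" for m
  proof (cases "m = 0")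
    case False
    have "(E m has_integral (E m (1/2) / (- (2 * of_real pi * \<i> * of_int m)) - E m (-1/2) / (- (2 * of_real pi * \<i> * of_int m)))) {-1/2..1/2::real}"
    proof (rule fundamental_theorem_of_calculus)
      fix y :: real
      have "((\<lambda>z. exp (- (2 * of_real pi * \<i> * of_int m * z)) / (- (2 * of_real pi * \<i> * of_int m))) has_field_derivative E m y) (at (of_real y))"
        unfolding E_def using False by (auto intro!: derivative_eq_intros)
      then show "((\<lambda>y. E m y / (- (2 * of_real pi * \<i> * of_int m))) has_vector_derivative E m y) (at y within {-1/2..1/2})"
        using has_vector_derivative_real_field[of "\<lambda>z. exp (- (2 * of_real pi * \<i> * of_int m * z)) / (- (2 * of_real pi * \<i> * of_int m))" "E m y" y "{-1/2..1/2}"]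
        by (simp add: E_def)
    qed simp
    moreover have "E m (1/2) = E m (-1/2)"
    proof -
      have "E m (1/2) / E m (-1/2) = exp (2 * of_int (-m) * of_real pi * \<i>)" by (simp add: E_def exp_diff[symmetric] mult_ac)
      also have "\<dots> = 1" using exp_integer_2pi[of "of_int (-m)"] by (simp add: mult_ac)
      finally show ?thesis by (simp add: E_def)
    qed
    ultimately show ?thesis using False by (simp add: integral_unique)
  qed (simp add: E_def)
  have step: "c g m = (if m = 0 then g 0 else 0) + (c h (m - 1) - c h m)" for m
  proof -
    have "c g m = integral {-1/2..1/2::real} (\<lambda>y. g 0 * E m y + (h (of_real y) * E (m - 1) y - h (of_real y) * E m y))"
      unfolding c_def
    proof (rule integral_cong)
      fix y :: real assume y: "y \<in> {-1/2..1/2}"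
      have 1: "E (m-1) y = E m y * e (of_real y)" by (simp add: E_def e_def algebra_simps flip: exp_add)
      have 2: "g (of_real y) = g 0 + h (of_real y) * (e (of_real y) - 1)" using gh[OF real_in[OF y]] by (simp add: algebra_simps)
      show "g (of_real y) * E m y = g 0 * E m y + (h (of_real y) * E (m - 1) y - h (of_real y) * E m y)"
        by (simp only: 1 2) (simp only: algebra_simps mult_1_left)
    qed
    also have "\<dots> = integral {-1/2..1/2::real} (\<lambda>y. g 0 * E m y) + (c h (m - 1) - c h m)"
    proof -
      have ie: "(\<lambda>y. g 0 * E m y) integrable_on {-1/2..1/2::real}"
        by (intro integrable_continuous_real continuous_on_mult continuous_on_const contE)
      show ?thesis unfolding c_def
        by (simp only: integral_add[OF ie integrable_diff[OF int[OF holh] int[OF holh]]] integral_diff[OF int[OF holh] int[OF holh]])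
    qed
    also have "integral {-1/2..1/2::real} (\<lambda>y. g 0 * E m y) = (if m = 0 then g 0 else 0)"
      unfolding integral_mult_right cE by simp
    finally show ?thesis .
  qed
  have tele: "(\<Sum>m\<in>{-int N..int N}. c g m) = g 0 + (c h (- int N - 1) - c h (int N))" for N
  proof (induction N)
    case (Suc N)
    have "{- int (Suc N)..int (Suc N)} = insert (- int (Suc N)) (insert (int (Suc N)) {- int N..int N})" by auto
    then have "(\<Sum>m\<in>{-int (Suc N)..int (Suc N)}. c g m) = c g (- int (Suc N)) + (c g (int (Suc N)) + (\<Sum>m\<in>{-int N..int N}. c g m))"
      by simp
    also have "c g (- int (Suc N)) = c h (- int (Suc N) - 1) - c h (- int N - 1)" 
      using step[of "- int (Suc N)"] arg_cong[of "- int (Suc N)" "- int N - 1" "c h"] by simp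
    also have "c g (int (Suc N)) = c h (int N) - c h (int (Suc N))" unfolding step[of "int (Suc N)"] by simp
    finally show ?case unfolding Suc.IH by simp
  qed (simp add: step)
  have "\<exists>B. \<forall>m::int. norm (of_int m * integral {-1/2..1/2::real} (\<lambda>y. h (of_real y) * exp (- (2 * of_real pi * \<i> * of_int m * of_real y)))) \<le> B"
  proof (rule fourier_coefficient_bound)
    show "(h has_field_derivative deriv h (of_real y)) (at (of_real y))" if "y \<in> {-1/2..1/2}" for y :: real
      using holomorphic_derivI[OF holh open_ball real_in[OF that]] .
    show "continuous_on {-1/2..1/2} (\<lambda>y::real. deriv h (of_real y))"
      by (intro cont holomorphic_deriv holh open_ball)
  qed
  then obtain B where B: "\<And>m. norm (of_int m * c h m) \<le> B" unfolding c_def E_def by blast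
  have lim1: "(\<lambda>N. c h (int N)) \<longlonglongrightarrow> 0"
  proof (rule Lim_null_comparison)
    show "\<forall>\<^sub>F N in sequentially. norm (c h (int N)) \<le> B / real N"
      using eventually_gt_at_top[of 0] by eventually_elim (use B[of "int _"] in \<open>auto simp: norm_mult field_simps\<close>)
    show "(\<lambda>N. B / real N) \<longlonglongrightarrow> 0" by (rule lim_const_over_n)
  qed
  have lim2: "(\<lambda>N. c h (- int N - 1)) \<longlonglongrightarrow> 0"
  proof (rule Lim_null_comparison)
    show "\<forall>\<^sub>F N in sequentially. norm (c h (- int N - 1)) \<le> B / (real N + 1)"
    proof (rule always_eventually, rule allI)
      fix N
      have "norm (of_int (- int N - 1) * c h (- int N - 1)) \<le> B" by (rule B)
      moreover have "norm (complex_of_int (- int N - 1)) = real N + 1"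
        by (simp only: norm_of_int)
      ultimately show "norm (c h (- int N - 1)) \<le> B / (real N + 1)"
        by (simp only: norm_mult) (simp add: field_simps)
    qed
    show "(\<lambda>N. B / (real N + 1)) \<longlonglongrightarrow> 0" by real_asymp
  qed
  have "(\<lambda>N. g 0 + (c h (- int N - 1) - c h (int N))) \<longlonglongrightarrow> g 0 + (0 - 0)"
    by (intro tendsto_intros lim1 lim2)
  then show ?thesis unfolding tele[symmetric] by (simp add: c_def E_def)
qed

text \<open>Jacobi's theta function, the sum of exp(-pi t n^2) over all integers n, is
  \<open>1 + 2 * theta_tail t\<close>. The tail is singled out because it decays at infinity, so
  that its Mellin integral over the half line from 1 always converges.\<close>

definition theta_tail :: "real \<Rightarrow> real" where
  "theta_tail t = (\<Sum>n. exp (- pi * t * (real (Suc n))\<^sup>2))"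

lemma theta_tail_sums: "t > 0 \<Longrightarrow> (\<lambda>n. exp (- pi * t * (real (Suc n))\<^sup>2)) sums theta_tail t"
  unfolding theta_tail_def
  using summable_exp_minus_square[of "pi * t"] 
  by (intro summable_sums) (simp del: of_nat_Suc add: summable_Suc_iff[of "\<lambda>n. exp (- (pi * t * (real n)\<^sup>2))"])

text \<open>Poisson summation for the Gaussian: \<open>g\<close> is its periodization, the Fourier
  coefficients of \<open>g\<close> on the unit interval are the Fourier transform of the Gaussian at
  the integers, and the Fourier series is evaluated at 0.\<close>

theorem theta_transformation:
  assumes t: "t > 0"
  shows "1 + 2 * theta_tail t = (1 + 2 * theta_tail (1 / t)) / sqrt t"
proof -
  define \<phi> where "\<phi> = (\<lambda>z::complex. exp (- of_real (pi * t) * z ^ 2))"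
  define E where "E = (\<lambda>(m::int) (y::real). exp (- (2 * of_real pi * \<i> * of_int m * complex_of_real y)))"
  \<comment> \<open>The factors 1 and -1 are the two values of \<sigma> in
    \<open>norm_gaussian_shift_le\<close>. Adding opposite shifts in pairs makes the N-th partial
    sum unfold to an interval symmetric about 0.\<close>
  define T where "T = (\<lambda>n z. \<phi> (z + 1 * of_nat (Suc n)) + \<phi> (z + (-1) * of_nat (Suc n)))"
  define G where "G = (\<lambda>N z. \<phi> z + (\<Sum>n<N. T n z))"
  define g where "g = (\<lambda>z. \<phi> z + (\<Sum>n. T n z))"
  define M where "M = (\<lambda>n. 2 * (exp (- (pi * t) * (real n)\<^sup>2) * exp (pi * t)))"
  have "summable M" unfolding M_def
    by (intro summable_mult summable_mult2 summable_exp_minus_square) (use t in auto)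
  moreover have TM: "norm (T n z) \<le> M n" if "z \<in> cball 0 1" for n z
  proof -
    have "norm (\<phi> (z + \<sigma> * of_nat (Suc n))) \<le> exp (- (pi * t) * (real n)\<^sup>2) * exp (pi * t)" if "\<sigma> = 1 \<or> \<sigma> = -1" for \<sigma>
      using norm_gaussian_shift_le[OF t, of z "Suc n", OF _ _ that] \<open>z \<in> cball 0 1\<close>
      by (simp add: \<phi>_def exp_add[symmetric])
    from this[of 1] this[of "-1"] show ?thesis unfolding T_def M_def
      by (intro order_trans[OF norm_triangle_ineq]) auto
  qed
  ultimately have ul: "uniform_limit (cball 0 1) (\<lambda>N z. \<Sum>n<N. T n z) (\<lambda>z. \<Sum>n. T n z) sequentially"
    by (intro Weierstrass_m_test)
  have ulG: "uniform_limit (cball 0 1) G g sequentially"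
    unfolding G_def g_def by (intro uniform_limit_add ul uniform_limit_const)
  have holG: "G N holomorphic_on A" for N A unfolding G_def T_def \<phi>_def by (intro holomorphic_intros)
  have holg: "g holomorphic_on ball 0 1"
  proof (rule holomorphic_uniform_sequence[OF open_ball holG])
    fix x :: complex assume "x \<in> ball 0 1"
    then obtain d where "d > 0" "cball x d \<subseteq> ball 0 1" using open_contains_cball open_ball by blast
    then show "\<exists>d>0. cball x d \<subseteq> ball 0 1 \<and> uniform_limit (cball x d) G g sequentially"
      using uniform_limit_on_subset[OF ulG] by (meson ball_subset_cball order_trans)
  qed
  have contE: "continuous_on S (E m)" for m S unfolding E_def by (intro continuous_intros)
  have nE: "norm (E m y) = 1" for m y by (simp add: E_def)
  have E_per: "E m (y + of_int k) = E m y" for m y k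
  proof -
    have "E m (y + of_int k) = E m y * exp (2 * of_real pi * \<i> * of_int (- m * k))"
      by (simp add: E_def exp_add[symmetric] algebra_simps)
    also have "exp (2 * of_real pi * \<i> * of_int (- m * k)) = 1" using exp_integer_2pi[of "of_int (- m * k)"]
      by (simp add: mult_ac)
    finally show ?thesis by simp
  qed
  define F where "F = (\<lambda>m y. \<phi> (of_real y) * E m y)"
  have contF: "continuous_on S (F m)" for m S unfolding F_def \<phi>_def by (intro continuous_on_mult contE continuous_intros)
  have intF: "F m integrable_on {a..b}" for m a b by (intro integrable_continuous_real contF)
  \<comment> \<open>Unfolding: \<open>E m\<close> has period 1, so each shifted copy of the Gaussian
    contributes the integral of \<open>F m\<close> over a neighbouring unit interval, and the
    intervals fit together.\<close>
  have J: "integral {-1/2..1/2} (\<lambda>y. G N (of_real y) * E m y) = integral {- real N - 1/2..real N + 1/2} (F m)" for m N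
  proof (induction N)
    case (Suc N)
    have sh: "integral {-1/2..1/2} (\<lambda>y. \<phi> (of_real y + of_int k) * E m y) = integral {-1/2 + of_int k..1/2 + of_int k} (F m)" for k
    proof -
      have "integral {-1/2 + of_int k..1/2 + of_int k} (F m) = integral {-1/2..1/2} (F m \<circ> ((+) (of_int k)))"
        by (rule integral_shift_Icc_real[symmetric])
      also have "F m \<circ> ((+) (of_int k)) = (\<lambda>y. \<phi> (of_real y + of_int k) * E m y)"
        using E_per[of m _ k] by (auto simp: F_def fun_eq_iff add.commute)
      finally show ?thesis by simp
    qed
    have c1: "(\<lambda>y. \<phi> (of_real y + of_int k) * E m y) integrable_on {-1/2..1/2}" for k
      unfolding \<phi>_def by (intro integrable_continuous_real continuous_on_mult contE continuous_intros)
    have c2: "(\<lambda>y. G N (of_real y) * E m y) integrable_on {-1/2..1/2}"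
      unfolding G_def T_def \<phi>_def by (intro integrable_continuous_real continuous_on_mult contE continuous_intros)
    have "integral {-1/2..1/2} (\<lambda>y. G (Suc N) (of_real y) * E m y) = 
       integral {-1/2..1/2} (\<lambda>y. G N (of_real y) * E m y + (\<phi> (of_real y + of_int (int (Suc N))) * E m y + \<phi> (of_real y + of_int (- int (Suc N))) * E m y))"
      by (intro integral_cong) (simp add: G_def T_def algebra_simps)
    also have "\<dots> = integral {- real N - 1/2..real N + 1/2} (F m) +
       (integral {-1/2 + of_int (int (Suc N))..1/2 + of_int (int (Suc N))} (F m) + integral {-1/2 + of_int (- int (Suc N))..1/2 + of_int (- int (Suc N))} (F m))"
      by (subst integral_add[OF c2 integrable_add[OF c1 c1]], subst integral_add[OF c1 c1]) (simp only: Suc.IH sh)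
    also have "\<dots> = integral {-1/2 - real (Suc N)..- real N - 1/2} (F m) + integral {- real N - 1/2..real N + 1/2} (F m) + integral {real N + 1/2..1/2 + real (Suc N)} (F m)"
    proof -
      have "-1/2 + of_int (int (Suc N)) = real N + 1/2" "1/2 + real_of_int (int (Suc N)) = 1/2 + real (Suc N)"
        "-1/2 + of_int (- int (Suc N)) = -1/2 - real (Suc N)" "1/2 + of_int (- int (Suc N)) = - real N - 1/2" by simp_all
      then show ?thesis by (simp only: add_ac)
    qed
    also have "\<dots> = integral {-1/2 - real (Suc N)..1/2 + real (Suc N)} (F m)"
      by (subst Henstock_Kurzweil_Integration.integral_combine[OF _ _ intF], simp, simp)+ simp
    finally show ?case by (simp add: algebra_simps)
  qed (simp add: G_def F_def)
  have coef: "integral {-1/2..1/2} (\<lambda>y. g (of_real y) * E m y) = of_real (exp (- pi * (of_int m)\<^sup>2 / t) / sqrt t)" for m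
  proof -
    have hb: "has_bochner_integral lborel (F m) (complex_of_real (exp (- pi * (of_int m)\<^sup>2 / t) / sqrt t))"
      using gaussian_fourier_transform[OF t, of "of_int m"] by (simp add: F_def \<phi>_def E_def)
    have iF: "integrable lborel (F m)" and vF: "integral\<^sup>L lborel (F m) = complex_of_real (exp (- pi * (of_int m)\<^sup>2 / t) / sqrt t)"
      using hb by (simp_all add: has_bochner_integral_iff)
    have lim: "(\<lambda>N. LINT y|lborel. indicator {- real N - 1/2..real N + 1/2} y *\<^sub>R F m y) \<longlonglongrightarrow> integral\<^sup>L lborel (F m)"
    proof (rule integral_dominated_convergence)
      show "integrable lborel (\<lambda>y. norm (F m y))" using iF by simp
      show "AE y in lborel. (\<lambda>N. indicator {- real N - 1/2..real N + 1/2} y *\<^sub>R F m y) \<longlonglongrightarrow> F m y"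
      proof (rule AE_I2, rule tendsto_eventually)
        fix y :: real
        have "eventually (\<lambda>N. real N \<ge> \<bar>y\<bar>) sequentially" by real_asymp
        then show "\<forall>\<^sub>F N in sequentially. indicator {- real N - 1/2..real N + 1/2} y *\<^sub>R F m y = F m y"
          by eventually_elim (auto simp: indicator_def)
      qed
    qed (use iF in \<open>auto simp: indicator_def intro!: borel_measurable_scaleR\<close>)
    have eqn: "(LINT y|lborel. indicator {- real N - 1/2..real N + 1/2} y *\<^sub>R F m y) = integral {- real N - 1/2..real N + 1/2} (F m)" for N
      using set_borel_integral_eq_integral(2)[of "{- real N - 1/2..real N + 1/2}" "F m"] borel_integrable_atLeastAtMost'[OF contF]
      by (simp add: set_lebesgue_integral_def)
    have "(\<lambda>N. integral {-1/2..1/2} (\<lambda>y. G N (of_real y) * E m y)) \<longlonglongrightarrow> integral\<^sup>L lborel (F m)"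
      unfolding J using lim[unfolded eqn] .
    moreover have "(\<lambda>N. integral {-1/2..1/2} (\<lambda>y. G N (of_real y) * E m y)) \<longlonglongrightarrow> integral {-1/2..1/2} (\<lambda>y. g (of_real y) * E m y)"
    proof -
      have ul': "uniform_limit {-1/2..1/2} (\<lambda>N (y::real). G N (of_real y) * E m y) (\<lambda>y. g (of_real y) * E m y) sequentially"
      proof (rule uniform_limitI)
        fix d :: real assume "d > 0"
        then have "\<forall>\<^sub>F N in sequentially. \<forall>z\<in>cball 0 1. dist (G N z) (g z) < d" using ulG by (simp add: uniform_limit_iff)
        then show "\<forall>\<^sub>F N in sequentially. \<forall>y\<in>{-1/2..1/2::real}. dist (G N (of_real y) * E m y) (g (of_real y) * E m y) < d"
        proof eventually_elim
          case (elim N)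
          show ?case
          proof
            fix y :: real assume "y \<in> {-1/2..1/2}"
            then have "complex_of_real y \<in> cball 0 1" by auto
            then have "norm (G N (of_real y) - g (of_real y)) < d" using elim by (simp add: dist_norm)
            then show "dist (G N (of_real y) * E m y) (g (of_real y) * E m y) < d"
              by (simp only: dist_norm left_diff_distrib[symmetric] norm_mult nE mult_1_right)
          qed
        qed
      qed
      have cG: "continuous_on {-1/2..1/2} (\<lambda>y. G N (of_real y) * E m y)" for N
        unfolding G_def T_def \<phi>_def by (intro continuous_on_mult contE continuous_intros)
      obtain I J where I: "\<And>n. ((\<lambda>y. G n (of_real y) * E m y) has_integral I n) {-1/2..1/2}" 
        and J: "((\<lambda>y. g (of_real y) * E m y) has_integral J) {-1/2..1/2}" and IJ: "(I \<longlongrightarrow> J) sequentially"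
        by (rule uniform_limit_integral[OF ul' cG trivial_limit_sequentially]) blast
      show ?thesis using IJ by (simp only: integral_unique[OF I] integral_unique[OF J])
    qed
    ultimately show ?thesis unfolding vF by (rule LIMSEQ_unique[rotated])
  qed
  have sumcoef: "(\<Sum>m\<in>{-int N..int N}. complex_of_real (exp (- pi * (of_int m)\<^sup>2 / t) / sqrt t)) =
      of_real ((1 + 2 * (\<Sum>n<N. exp (- pi * (1 / t) * (real (Suc n))\<^sup>2))) / sqrt t)" for N
  proof (induction N)
    case (Suc N)
    have *: "{- int (Suc N)..int (Suc N)} = insert (- int (Suc N)) (insert (int (Suc N)) {- int N..int N})" by auto
    have sq: "(real_of_int (- int (Suc N)))\<^sup>2 = (real (Suc N))\<^sup>2" "(real_of_int (int (Suc N)))\<^sup>2 = (real (Suc N))\<^sup>2"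
      by (simp_all only: of_int_minus power2_minus of_int_of_nat_eq)
    show ?case unfolding *
      by (subst sum.insert, simp, simp, subst sum.insert, simp, simp, subst Suc.IH, simp only: sq)
         (simp add: add_divide_distrib algebra_simps)
  qed simp
  have "(\<lambda>N. complex_of_real ((1 + 2 * (\<Sum>n<N. exp (- pi * (1 / t) * (real (Suc n))\<^sup>2))) / sqrt t)) \<longlonglongrightarrow> g 0"
    using fourier_series_at_0[OF holg] coef unfolding E_def by (simp only: sumcoef)
  moreover have "(\<lambda>N. complex_of_real ((1 + 2 * (\<Sum>n<N. exp (- pi * (1 / t) * (real (Suc n))\<^sup>2))) / sqrt t)) \<longlonglongrightarrow> 
      complex_of_real ((1 + 2 * theta_tail (1/t)) / sqrt t)"
    using theta_tail_sums[of "1/t"] t unfolding sums_def by (intro tendsto_intros) auto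
  ultimately have "g 0 = complex_of_real ((1 + 2 * theta_tail (1/t)) / sqrt t)" by (rule LIMSEQ_unique)
  moreover have "g 0 = of_real (1 + 2 * theta_tail t)"
  proof -
    have "(\<lambda>n. T n 0) sums (complex_of_real (2 * theta_tail t))"
    proof -
      have "T n 0 = complex_of_real (2 * exp (- pi * t * (real (Suc n))\<^sup>2))" for n
      proof -
        have "(complex_of_real (real (Suc n)))\<^sup>2 = of_real ((real (Suc n))\<^sup>2)" by simp
        then have "\<phi> (complex_of_real (real (Suc n))) = complex_of_real (exp (- pi * t * (real (Suc n))\<^sup>2))"
          unfolding \<phi>_def by (simp only: exp_of_real[symmetric]) simp
        moreover have "\<phi> (- z) = \<phi> z" for z by (simp add: \<phi>_def)
        ultimately show ?thesis unfolding T_def by (simp del: of_nat_Suc)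
      qed
      then show ?thesis using sums_of_real[OF sums_mult[OF theta_tail_sums[OF t], of 2], where ?'a = complex] by (simp only:)
    qed
    then show ?thesis unfolding g_def by (simp add: sums_unique[symmetric] \<phi>_def)
  qed
  ultimately show ?thesis by (simp only: of_real_eq_iff)
qed

section \<open>Mellin transforms\<close>

lemma of_real_powr_eq_exp: "x > 0 \<Longrightarrow> complex_of_real x powr s = exp (s * of_real (ln x))"
  by (simp add: powr_def Ln_of_real)

lemma norm_of_real_powr: "x > 0 \<Longrightarrow> norm (complex_of_real x powr s) = x powr Re s"
  by (simp add: norm_powr_real_powr)

lemma continuous_on_of_real_powr:
  assumes "A \<subseteq> {0<..}"
  shows "continuous_on A (\<lambda>x. complex_of_real x powr s)"
proof -
  have "continuous_on A (\<lambda>x. exp (s * of_real (ln x)))"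
    by (intro continuous_intros) (use assms in auto)
  then show ?thesis using assms by (subst continuous_on_cong[OF refl of_real_powr_eq_exp]) auto
qed

lemma absolutely_integrable_Mellin_at_top:
  fixes f :: "real \<Rightarrow> complex"
  assumes cont: "continuous_on {1..} f" and bd: "\<And>x. x \<ge> 1 \<Longrightarrow> norm (f x) \<le> C * x powr (-b)"
    and s: "Re s < b"
  shows "(\<lambda>x. f x * of_real x powr (s - 1)) absolutely_integrable_on {1..}"
proof (rule measurable_bounded_by_integrable_imp_absolutely_integrable)
  show "(\<lambda>x. f x * of_real x powr (s - 1)) \<in> borel_measurable (lebesgue_on {1..})"
    by (intro continuous_imp_measurable_on_sets_lebesgue continuous_on_mult cont continuous_on_of_real_powr) auto
  have "(\<lambda>x. x powr (Re s - 1 - b)) integrable_on {1::real..}"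
    using has_integral_powr_to_inf[of "Re s - 1 - b" 1] s unfolding integrable_on_def by fastforce
  then show "(\<lambda>x. C * x powr (Re s - 1 - b)) integrable_on {1::real..}" by (rule integrable_on_mult_right)
  fix x :: real assume "x \<in> {1..}"
  then have x: "x \<ge> 1" by simp
  have "norm (f x * of_real x powr (s - 1)) = norm (f x) * x powr (Re s - 1)" using x by (simp add: norm_mult norm_of_real_powr)
  also have "\<dots> \<le> (C * x powr (-b)) * x powr (Re s - 1)" by (intro mult_right_mono bd x) simp
  also have "\<dots> = C * x powr (Re s - 1 - b)" by (simp add: powr_add[symmetric] mult.assoc algebra_simps)
  finally show "norm (f x * of_real x powr (s - 1)) \<le> C * x powr (Re s - 1 - b)" .
qed auto

text \<open>The integrals over [1, n + 1] are entire in s by differentiation under the integral.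
  They converge uniformly on closed discs in the half plane because the tails are dominated by a
  convergent power integral.\<close>

lemma holomorphic_Mellin_at_top:
  fixes f :: "real \<Rightarrow> complex"
  assumes cont: "continuous_on {1..} f" and bd: "\<And>x. x \<ge> 1 \<Longrightarrow> norm (f x) \<le> C * x powr (-b)"
  shows "(\<lambda>s. integral {1..} (\<lambda>x. f x * of_real x powr (s - 1))) holomorphic_on {s. Re s < b}"
proof (rule holomorphic_uniform_sequence)
  define g where "g = (\<lambda>s x. f x * of_real x powr (s - 1))"
  define F where "F = (\<lambda>n s. integral {1..real n + 1} (g s))"
  have C: "C \<ge> 0" using bd[of 1] by (simp add: order_trans[OF norm_ge_zero])
  have int: "g s absolutely_integrable_on {1..}" if "Re s < b" for s
    unfolding g_def by (rule absolutely_integrable_Mellin_at_top[OF cont bd that])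
  show "open {s. Re s < b}" by (rule open_halfspace_Re_lt)
  show "F n holomorphic_on {s. Re s < b}" for n
  proof -
    have cont': "continuous_on {1..real n + 1} f" by (rule continuous_on_subset[OF cont]) auto
    have "(\<lambda>s. integral (cbox 1 (real n + 1)) (\<lambda>x. f x * exp ((s - 1) * of_real (ln x)))) holomorphic_on UNIV"
    proof (rule leibniz_rule_holomorphic[where fx = "\<lambda>s x. f x * (exp ((s - 1) * of_real (ln x)) * of_real (ln x))"])
      show "((\<lambda>s. f x * exp ((s - 1) * of_real (ln x))) has_field_derivative f x * (exp ((s - 1) * of_real (ln x)) * of_real (ln x))) (at s within UNIV)" for s x
        by (auto intro!: derivative_eq_intros)
      show "(\<lambda>x. f x * exp ((s - 1) * of_real (ln x))) integrable_on cbox 1 (real n + 1)" for s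
        by (intro integrable_continuous continuous_intros) (auto simp: cont')
      show "continuous_on (UNIV \<times> cbox 1 (real n + 1)) (\<lambda>(s, x). f x * (exp ((s - 1) * of_real (ln x)) * of_real (ln x)))"
        unfolding case_prod_unfold
        by (intro continuous_intros continuous_on_compose2[OF cont']) auto
    qed auto
    also have "(\<lambda>s. integral (cbox 1 (real n + 1)) (\<lambda>x. f x * exp ((s - 1) * of_real (ln x)))) = F n"
      unfolding F_def g_def by (intro ext) (auto intro!: integral_cong simp: of_real_powr_eq_exp)
    finally show ?thesis by (rule holomorphic_on_subset) auto
  qed
  fix s assume "s \<in> {s. Re s < b}"
  then have s: "Re s < b" by simp
  \<comment> \<open>Half the distance to the boundary line: \<beta>, the largest real part on the
    closed disc, is still below b, and one tail bound with exponent \<beta> - b serves the whole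
    disc.\<close>
  define d where "d = (b - Re s) / 2"
  define \<beta> where "\<beta> = Re s + d"
  have d: "d > 0" "\<beta> < b" using s by (auto simp: d_def \<beta>_def field_simps)
  have Re_le: "Re z \<le> \<beta>" if "z \<in> cball s d" for z
    using that abs_Re_le_cmod[of "s - z"] by (auto simp: \<beta>_def dist_norm)
  have "uniform_limit (cball s d) F (\<lambda>s. integral {1..} (g s)) sequentially"
  proof (rule uniform_limitI)
    fix e :: real assume e: "e > 0"
    have "(\<lambda>n. C * ((real n + 1) powr (\<beta> - b) / (b - \<beta>))) \<longlonglongrightarrow> C * (0 / (b - \<beta>))"
    proof (intro tendsto_intros)
      show "(\<lambda>n. (real n + 1) powr (\<beta> - b)) \<longlonglongrightarrow> 0" using d by real_asymp
    qed (use d in auto)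
    then have "\<forall>\<^sub>F n in sequentially. C * ((real n + 1) powr (\<beta> - b) / (b - \<beta>)) < e"
      using e by (intro order_tendstoD(2)) auto
    then show "\<forall>\<^sub>F n in sequentially. \<forall>z\<in>cball s d. dist (F n z) (integral {1..} (g z)) < e"
    proof eventually_elim
      case (elim n)
      show ?case
      proof
        fix z assume z: "z \<in> cball s d"
        have zb: "Re z < b" using Re_le[OF z] d by simp
        have *: "(\<lambda>x. x powr (\<beta> - b - 1)) integrable_on {real n + 1..}"
          "integral {real n + 1..} (\<lambda>x. x powr (\<beta> - b - 1)) = (real n + 1) powr (\<beta> - b) / (b - \<beta>)"
          using has_integral_powr_to_inf[of "\<beta> - b - 1" "real n + 1"] d
          by (auto simp: has_integral_iff field_simps)
        have sub: "g z absolutely_integrable_on A" if "A \<subseteq> {1..}" "A \<in> sets lebesgue" for A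
          by (rule set_integrable_subset[OF int[OF zb] that(2,1)])
        have i1: "g z integrable_on {1..real n + 1}" and i2: "g z integrable_on {real n + 1..}"
          using set_lebesgue_integral_eq_integral(1)[OF sub] by auto
        have "{1::real..} = {1..real n + 1} \<union> {real n + 1..}" by auto
        then have "integral {1..} (g z) = F n z + integral {real n + 1..} (g z)"
          unfolding F_def by (simp only:, intro integral_Un i1 i2) (auto simp: negligible_finite intro!: negligible_subset[of "{real n + 1}"])
        then have "dist (F n z) (integral {1..} (g z)) = norm (integral {real n + 1..} (g z))"
          by (simp add: dist_norm)
        also have "\<dots> \<le> integral {real n + 1..} (\<lambda>x. C * x powr (\<beta> - b - 1))"
        proof (rule integral_norm_bound_integral[OF i2 integrable_on_mult_right[OF *(1)]])
          fix x assume "x \<in> {real n + 1..}"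
          then have x: "x \<ge> 1" by simp
          have "norm (g z x) = norm (f x) * x powr (Re z - 1)" using x by (simp add: g_def norm_mult norm_of_real_powr)
          also have "\<dots> \<le> (C * x powr (-b)) * x powr (\<beta> - 1)"
            using x C Re_le[OF z] by (intro mult_mono bd powr_mono) auto
          also have "\<dots> = C * x powr (\<beta> - b - 1)" by (simp add: powr_add[symmetric] mult.assoc algebra_simps)
          finally show "norm (g z x) \<le> C * x powr (\<beta> - b - 1)" .
        qed
        also have "\<dots> = C * ((real n + 1) powr (\<beta> - b) / (b - \<beta>))" by (simp add: *(2))
        also have "\<dots> < e" by (rule elim)
        finally show "dist (F n z) (integral {1..} (g z)) < e" .
      qed
    qed
  qed
  moreover have "cball s d \<subseteq> {s. Re s < b}" using Re_le d by fastforce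
  ultimately show "\<exists>d>0. cball s d \<subseteq> {s. Re s < b} \<and> uniform_limit (cball s d) F (\<lambda>s. integral {1..} (\<lambda>x. f x * of_real x powr (s - 1))) sequentially"
    using d unfolding g_def by blast
qed

text \<open>The substitution x to 1/x carries behaviour at 0 to behaviour at infinity, so that the
  estimates on the half line from 1 serve for both ends.\<close>

lemma Mellin_inversion_of_variable:
  fixes f :: "real \<Rightarrow> complex"
  assumes "(\<lambda>x. f (1 / x) * of_real x powr (- s - 1)) absolutely_integrable_on {1..}"
  shows "(\<lambda>x. f x * of_real x powr (s - 1)) absolutely_integrable_on {0<..1}"
    "integral {0<..1} (\<lambda>x. f x * of_real x powr (s - 1)) = integral {1..} (\<lambda>x. f (1 / x) * of_real x powr (- s - 1))"
proof -
  have img: "(\<lambda>x::real. 1 / x) ` {1..} = {0<..1}"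
  proof (intro equalityI subsetI)
    fix x :: real assume "x \<in> {0<..1}"
    then have "x = 1 / (1/x)" "1 / x \<in> {1..}" by auto
    then show "x \<in> (\<lambda>x. 1 / x) ` {1..}" by blast
  qed auto
  have eq: "\<bar>- (1 / x\<^sup>2)\<bar> *\<^sub>R (f (1/x) * of_real (1/x) powr (s - 1)) = f (1 / x) * of_real x powr (- s - 1)" if "x \<in> {1..}" for x :: real
  proof -
    have x: "x > 0" using that by simp
    define L where "L = complex_of_real (ln x)"
    have 1: "complex_of_real (1 / x) powr (s - 1) = exp ((s - 1) * (- L))"
      using x by (simp add: of_real_powr_eq_exp ln_div L_def del: of_real_divide)
    have 2: "\<bar>- (1 / x\<^sup>2)\<bar> *\<^sub>R z = exp (- 2 * L) * z" for z :: complex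
    proof -
      have "complex_of_real (1 / x\<^sup>2) = exp (- 2 * L)"
        using x by (simp add: L_def exp_minus exp_double exp_of_real field_simps power2_eq_square)
      then show ?thesis by (simp add: scaleR_conv_of_real)
    qed
    have 3: "complex_of_real x powr (- s - 1) = exp ((- s - 1) * L)"
      using x by (simp add: of_real_powr_eq_exp L_def)
    have "(- s - 1) * L = - 2 * L + (s - 1) * (- L)" by (simp add: algebra_simps)
    then have "exp ((- s - 1) * L) = exp (- 2 * L) * exp ((s - 1) * (- L))" by (simp only: exp_add)
    then show ?thesis unfolding 1 2 3 by (simp only: mult_ac)
  qed
  have "(\<lambda>x. \<bar>- (1 / x\<^sup>2)\<bar> *\<^sub>R (f (1/x) * of_real (1/x) powr (s - 1))) absolutely_integrable_on {1..} \<and>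
    integral {1..} (\<lambda>x. \<bar>- (1 / x\<^sup>2)\<bar> *\<^sub>R (f (1/x) * of_real (1/x) powr (s - 1))) = integral {1..} (\<lambda>x. f (1 / x) * of_real x powr (- s - 1))
   \<longleftrightarrow> (\<lambda>x. f x * of_real x powr (s - 1)) absolutely_integrable_on (\<lambda>x. 1/x) ` {1..} \<and>
    integral ((\<lambda>x. 1/x) ` {1..}) (\<lambda>x. f x * of_real x powr (s - 1)) = integral {1..} (\<lambda>x. f (1 / x) * of_real x powr (- s - 1))"
    by (rule has_absolute_integral_change_of_variables_real)
       (auto intro!: derivative_eq_intros simp: inj_on_def power2_eq_square)
  moreover have "(\<lambda>x. \<bar>- (1 / x\<^sup>2)\<bar> *\<^sub>R (f (1/x) * of_real (1/x) powr (s - 1))) absolutely_integrable_on {1..}"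
    by (rule set_integrable_cong[THEN iffD1, OF refl refl _ assms]) (simp only: eq)
  moreover have "integral {1..} (\<lambda>x. \<bar>- (1 / x\<^sup>2)\<bar> *\<^sub>R (f (1/x) * of_real (1/x) powr (s - 1))) = integral {1..} (\<lambda>x. f (1 / x) * of_real x powr (- s - 1))"
    by (rule integral_cong) (rule eq)
  ultimately show "(\<lambda>x. f x * of_real x powr (s - 1)) absolutely_integrable_on {0<..1}"
    "integral {0<..1} (\<lambda>x. f x * of_real x powr (s - 1)) = integral {1..} (\<lambda>x. f (1 / x) * of_real x powr (- s - 1))"
    unfolding img by auto
qed

text \<open>Substitution x to a x. The version with norms is what \<open>Mellin_series\<close> sums
  when it checks the condition for exchanging sum and integral.\<close>

lemma Mellin_scale:
  fixes K :: "real \<Rightarrow> complex"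
  assumes a: "a > 0" and int: "(\<lambda>x. K x * of_real x powr (s - 1)) absolutely_integrable_on {0<..}"
  shows "(\<lambda>x. K (a * x) * of_real x powr (s - 1)) absolutely_integrable_on {0<..}"
    "integral {0<..} (\<lambda>x. K (a * x) * of_real x powr (s - 1)) = of_real a powr (-s) * integral {0<..} (\<lambda>x. K x * of_real x powr (s - 1))"
    "integral {0<..} (\<lambda>x. norm (K (a * x) * of_real x powr (s - 1))) = a powr (- Re s) * integral {0<..} (\<lambda>x. norm (K x * of_real x powr (s - 1)))"
proof -
  have img: "(\<lambda>x. a * x) ` {0<..} = {0<..}"
  proof (intro equalityI subsetI)
    fix x :: real assume "x \<in> {0<..}"
    then have "x = a * (x / a)" "x / a \<in> {0<..}" using a by auto
    then show "x \<in> (\<lambda>x. a * x) ` {0<..}" by blast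
  qed (use a in auto)
  have eq: "of_real a powr (-s) * (\<bar>a\<bar> *\<^sub>R (K (a * x) * of_real (a * x) powr (s - 1))) = K (a * x) * of_real x powr (s - 1)" if "x \<in> {0<..}" for x
  proof -
    have x: "x > 0" using that by simp
    have 1: "of_real a powr (-s) = exp (- s * of_real (ln a))" using a by (rule of_real_powr_eq_exp)
    have 2: "\<bar>a\<bar> *\<^sub>R z = exp (of_real (ln a)) * z" for z :: complex
      using a by (simp add: exp_of_real scaleR_conv_of_real)
    have 3: "of_real (a * x) powr (s - 1) = exp ((s - 1) * of_real (ln (a * x)))" using a x by (intro of_real_powr_eq_exp) auto
    have 4: "of_real x powr (s - 1) = exp ((s - 1) * of_real (ln x))" using x by (rule of_real_powr_eq_exp)
    have "(s - 1) * of_real (ln x) = - s * of_real (ln a) + (of_real (ln a) + (s - 1) * complex_of_real (ln (a * x)))"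
      using a x by (simp add: ln_mult algebra_simps)
    then have "exp ((s - 1) * of_real (ln x)) = exp (- s * of_real (ln a)) * (exp (of_real (ln a)) * exp ((s - 1) * complex_of_real (ln (a * x))))"
      by (simp only: exp_add)
    then show ?thesis unfolding 1 2 3 4 by (simp only: mult_ac)
  qed
  have A: "(\<lambda>x. \<bar>a\<bar> *\<^sub>R (K (a * x) * of_real (a * x) powr (s - 1))) absolutely_integrable_on {0<..} \<and>
    integral {0<..} (\<lambda>x. \<bar>a\<bar> *\<^sub>R (K (a * x) * of_real (a * x) powr (s - 1))) = integral {0<..} (\<lambda>x. K x * of_real x powr (s - 1))
   \<longleftrightarrow> (\<lambda>x. K x * of_real x powr (s - 1)) absolutely_integrable_on (\<lambda>x. a * x) ` {0<..} \<and>
    integral ((\<lambda>x. a * x) ` {0<..}) (\<lambda>x. K x * of_real x powr (s - 1)) = integral {0<..} (\<lambda>x. K x * of_real x powr (s - 1))"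
    by (rule has_absolute_integral_change_of_variables_real)
       (use a in \<open>auto intro!: derivative_eq_intros simp: inj_on_def\<close>)
  then have B: "(\<lambda>x. \<bar>a\<bar> *\<^sub>R (K (a * x) * of_real (a * x) powr (s - 1))) absolutely_integrable_on {0<..}"
    "integral {0<..} (\<lambda>x. \<bar>a\<bar> *\<^sub>R (K (a * x) * of_real (a * x) powr (s - 1))) = integral {0<..} (\<lambda>x. K x * of_real x powr (s - 1))"
    using int unfolding img by auto
  have A': "(\<lambda>x. \<bar>a\<bar> *\<^sub>R norm (K (a * x) * of_real (a * x) powr (s - 1))) absolutely_integrable_on {0<..} \<and>
    integral {0<..} (\<lambda>x. \<bar>a\<bar> *\<^sub>R norm (K (a * x) * of_real (a * x) powr (s - 1))) = integral {0<..} (\<lambda>x. norm (K x * of_real x powr (s - 1)))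
   \<longleftrightarrow> (\<lambda>x. norm (K x * of_real x powr (s - 1))) absolutely_integrable_on (\<lambda>x. a * x) ` {0<..} \<and>
    integral ((\<lambda>x. a * x) ` {0<..}) (\<lambda>x. norm (K x * of_real x powr (s - 1))) = integral {0<..} (\<lambda>x. norm (K x * of_real x powr (s - 1)))"
    by (rule has_absolute_integral_change_of_variables_real)
       (use a in \<open>auto intro!: derivative_eq_intros simp: inj_on_def\<close>)
  have B': "integral {0<..} (\<lambda>x. \<bar>a\<bar> *\<^sub>R norm (K (a * x) * of_real (a * x) powr (s - 1))) = integral {0<..} (\<lambda>x. norm (K x * of_real x powr (s - 1)))"
    using A' absolutely_integrable_norm[OF int] unfolding img o_def by auto
  show "(\<lambda>x. K (a * x) * of_real x powr (s - 1)) absolutely_integrable_on {0<..}"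
    by (rule set_integrable_cong[THEN iffD1, OF refl refl _ set_integrable_mult_right[OF B(1), of "of_real a powr (-s)"]])
       (simp only: eq)
  show "integral {0<..} (\<lambda>x. K (a * x) * of_real x powr (s - 1)) = of_real a powr (-s) * integral {0<..} (\<lambda>x. K x * of_real x powr (s - 1))"
    unfolding B(2)[symmetric] integral_mult_right[symmetric] by (rule integral_cong) (simp only: eq)
  have "norm (K (a * x) * of_real x powr (s - 1)) = a powr (- Re s) * (\<bar>a\<bar> *\<^sub>R norm (K (a * x) * of_real (a * x) powr (s - 1)))" if "x \<in> {0<..}" for x
    unfolding eq[OF that, symmetric] using a by (simp add: norm_mult norm_of_real_powr)
  then show "integral {0<..} (\<lambda>x. norm (K (a * x) * of_real x powr (s - 1))) = a powr (- Re s) * integral {0<..} (\<lambda>x. norm (K x * of_real x powr (s - 1)))"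
    unfolding B'[symmetric] integral_mult_right[symmetric] by (intro integral_cong)
qed

text \<open>The L1 norms of the terms are |c_n| a_n^(- Re s) times one fixed integral, so
  \<open>sum\<close> is exactly the condition for integrating termwise. It is used twice: with the
  kernel exp(-x) and a_n = pi n^2 for zeta, and with exp(-x) - 1 and a_n = 1/n^2 for P.\<close>

lemma Mellin_series:
  fixes K :: "real \<Rightarrow> complex" and c :: "nat \<Rightarrow> complex"
  assumes a: "\<And>n. a n > 0" and int: "(\<lambda>x. K x * of_real x powr (s - 1)) absolutely_integrable_on {0<..}"
    and sum: "summable (\<lambda>n. norm (c n) * a n powr (- Re s))"
    and pw: "\<And>x. x > 0 \<Longrightarrow> summable (\<lambda>n. norm (c n * K (a n * x)))"
  shows "(\<lambda>x. (\<Sum>n. c n * K (a n * x)) * of_real x powr (s - 1)) absolutely_integrable_on {0<..}"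
    "(\<lambda>n. c n * of_real (a n) powr (-s) * integral {0<..} (\<lambda>x. K x * of_real x powr (s - 1))) sums
      integral {0<..} (\<lambda>x. (\<Sum>n. c n * K (a n * x)) * of_real x powr (s - 1))"
proof -
  define f where "f = (\<lambda>n x. indicator {0<..} x *\<^sub>R (c n * (K (a n * x) * of_real x powr (s - 1))))"
  note sc = Mellin_scale[OF a int]
  have i1: "(\<lambda>x. c n * (K (a n * x) * of_real x powr (s - 1))) absolutely_integrable_on {0<..}" for n
    by (intro set_integrable_mult_right sc(1))
  have i: "integrable lebesgue (f n)" for n using i1[of n] unfolding f_def set_integrable_def .
  have v: "integral\<^sup>L lebesgue (f n) = c n * of_real (a n) powr (-s) * integral {0<..} (\<lambda>x. K x * of_real x powr (s - 1))" for n
  proof -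
    have "integral\<^sup>L lebesgue (f n) = (LINT x:{0<..}|lebesgue. c n * (K (a n * x) * of_real x powr (s - 1)))"
      by (simp only: f_def set_lebesgue_integral_def)
    then show ?thesis
      by (simp only: set_lebesgue_integral_eq_integral(2)[OF i1[of n]] integral_mult_right sc(2) mult.assoc)
  qed
  have w: "(\<integral>x. norm (f n x) \<partial>lebesgue) = norm (c n) * a n powr (- Re s) * integral {0<..} (\<lambda>x. norm (K x * of_real x powr (s - 1)))" for n
  proof -
    have "(\<integral>x. norm (f n x) \<partial>lebesgue) = (LINT x:{0<..}|lebesgue. norm (c n * (K (a n * x) * of_real x powr (s - 1))))"
      by (simp add: f_def set_lebesgue_integral_def norm_scaleR)
    also have "\<dots> = integral {0<..} (\<lambda>x. norm (c n * (K (a n * x) * of_real x powr (s - 1))))"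
      using set_lebesgue_integral_eq_integral(2)[OF absolutely_integrable_norm[OF i1[of n]]] by (simp add: o_def)
    also have "\<dots> = norm (c n) * integral {0<..} (\<lambda>x. norm (K (a n * x) * of_real x powr (s - 1)))"
      by (simp only: norm_mult[of "c n"] integral_mult_right)
    finally show ?thesis by (simp only: sc(3) mult.assoc)
  qed
  have pw': "summable (\<lambda>n. norm (f n x))" for x
  proof (cases "x > 0")
    case True
    from summable_mult2[OF pw[OF True], of "norm (of_real x powr (s - 1))"] show ?thesis
      using True by (simp add: f_def norm_mult mult_ac)
  qed (simp add: f_def)
  have sum': "summable (\<lambda>n. \<integral>x. norm (f n x) \<partial>lebesgue)" unfolding w by (intro summable_mult2 sum)
  have eq: "(\<Sum>n. f n x) = indicator {0<..} x *\<^sub>R ((\<Sum>n. c n * K (a n * x)) * of_real x powr (s - 1))" for x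
  proof (cases "x > 0")
    case True
    have "(\<Sum>n. c n * K (a n * x) * of_real x powr (s - 1)) = (\<Sum>n. c n * K (a n * x)) * of_real x powr (s - 1)"
      by (rule suminf_mult2[symmetric], rule summable_norm_cancel, rule pw[OF True])
    then show ?thesis using True by (simp add: f_def mult.assoc)
  qed (simp add: f_def)
  note facts = integrable_suminf[OF i AE_I2[OF pw'] sum'] sums_integral[OF i AE_I2[OF pw'] sum']
  show "(\<lambda>x. (\<Sum>n. c n * K (a n * x)) * of_real x powr (s - 1)) absolutely_integrable_on {0<..}"
    using facts(1) unfolding eq set_integrable_def .
  from set_lebesgue_integral_eq_integral(2)[OF this] 
  show "(\<lambda>n. c n * of_real (a n) powr (-s) * integral {0<..} (\<lambda>x. K x * of_real x powr (s - 1))) sums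
      integral {0<..} (\<lambda>x. (\<Sum>n. c n * K (a n * x)) * of_real x powr (s - 1))"
    using facts(2) unfolding v eq set_lebesgue_integral_def by simp
qed

section \<open>Analytic continuation and functional equation of zeta\<close>

text \<open>The right side is the maximum over x, attained at x = b; the inequality is ln y <= y - 1
  at y = x/b.\<close>

lemma powr_mult_exp_minus_le:
  assumes "b > 0" "x > (0::real)"
  shows "x powr b * exp (- x) \<le> exp (b * ln b - b)"
proof -
  have "ln (x / b) \<le> x / b - 1" by (rule ln_le_minus_one) (use assms in auto)
  then have "b * (ln x - ln b) \<le> b * (x / b - 1)" using assms by (intro mult_left_mono) (auto simp: ln_div)
  then have "b * ln x - x \<le> b * ln b - b" using assms by (simp add: algebra_simps)
  then show ?thesis using assms by (simp add: powr_def exp_add[symmetric])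
qed

text \<open>Separates t from n, so that the sum over n leaves a factor exp(-t). With q = n^2 it
  follows from (t - 1)(q - 1) >= 0 and pi >= 2, since t + q <= 2 t q.\<close>

lemma theta_term_le:
  assumes "t \<ge> 1"
  shows "exp (- pi * t * (real (Suc n))\<^sup>2) \<le> exp (- t) * exp (- (real (Suc n))\<^sup>2)"
proof -
  define q where "q = (real (Suc n))\<^sup>2"
  have q: "q \<ge> 1" unfolding q_def by (rule one_le_power) simp
  have "0 \<le> (t - 1) * (q - 1)" using assms q by auto
  then have "t + q - 1 \<le> t * q" by (simp add: algebra_simps)
  then have "t + q \<le> 2 * (t * q)" using assms q mult_mono[of 1 t 1 q] by linarith
  also have "\<dots> \<le> pi * (t * q)" using assms q pi_ge_two by (intro mult_right_mono) auto
  finally show ?thesis unfolding q_def[symmetric] by (simp add: exp_add[symmetric] mult.assoc)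
qed

lemma summable_exp_minus_Suc_square: "summable (\<lambda>n. exp (- (real (Suc n))\<^sup>2))"
  using summable_exp_minus_square[of 1] by (subst summable_Suc_iff[of "\<lambda>n. exp (- (real n)\<^sup>2)"]) simp

lemma continuous_on_theta_tail: "continuous_on {1..} theta_tail"
proof (rule uniform_limit_theorem)
  show "uniform_limit {1..} (\<lambda>N t. \<Sum>n<N. exp (- pi * t * (real (Suc n))\<^sup>2)) theta_tail sequentially"
    unfolding theta_tail_def
  proof (rule Weierstrass_m_test[OF _ summable_exp_minus_Suc_square])
    fix n t assume "t \<in> {1::real..}"
    then have t: "t \<ge> 1" by simp
    have "exp (- pi * t * (real (Suc n))\<^sup>2) \<le> exp (- t) * exp (- (real (Suc n))\<^sup>2)" by (rule theta_term_le[OF t])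
    also have "\<dots> \<le> 1 * exp (- (real (Suc n))\<^sup>2)" using t by (intro mult_right_mono) auto
    finally show "norm (exp (- pi * t * (real (Suc n))\<^sup>2)) \<le> exp (- (real (Suc n))\<^sup>2)" by simp
  qed
qed (auto intro!: always_eventually continuous_intros)

lemma theta_tail_nonneg: "t > 0 \<Longrightarrow> theta_tail t \<ge> 0"
  by (rule sums_le[OF _ sums_zero theta_tail_sums]) auto

lemma theta_tail_decay:
  assumes "b > 0"
  shows "\<exists>C. \<forall>t\<ge>1. theta_tail t \<le> C * t powr (-b)"
proof -
  define S where "S = (\<Sum>n. exp (- (real (Suc n))\<^sup>2))"
  have S: "S \<ge> 0" unfolding S_def by (intro suminf_nonneg summable_exp_minus_Suc_square) auto
  have "theta_tail t \<le> (exp (b * ln b - b) * S) * t powr (-b)" if t: "t \<ge> 1" for t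
  proof -
    have "theta_tail t \<le> exp (- t) * S"
      using theta_tail_sums[of t] summable_sums[OF summable_exp_minus_Suc_square] t unfolding S_def
      by (intro sums_le[OF theta_term_le[OF t] _ sums_mult]) auto
    also have "exp (- t) \<le> exp (b * ln b - b) * t powr (-b)"
      using powr_mult_exp_minus_le[OF assms, of t] t by (simp add: powr_minus field_simps)
    finally show ?thesis using S by (simp add: mult_ac mult_right_mono)
  qed
  then show ?thesis by blast
qed

text \<open>Only the half line from 1 on: there the decay of \<open>theta_tail\<close> makes the
  integral entire in s, and the part over (0, 1] is recovered from it through the theta
  transformation.\<close>

definition Mellin_theta :: "complex \<Rightarrow> complex" where
  "Mellin_theta s = integral {1..} (\<lambda>x. of_real (theta_tail x) * of_real x powr (s - 1))"

text \<open>The exponent |b| + 1 is positive and exceeds b, so these bounds cover half planes Re s <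
  |b| + 1 that exhaust the complex plane.\<close>

lemma theta_tail_complex: 
  "continuous_on {1..} (\<lambda>x. complex_of_real (theta_tail x))"
  "\<exists>C. \<forall>x\<ge>1. norm (complex_of_real (theta_tail x)) \<le> C * x powr (- (\<bar>b\<bar> + 1))"
proof -
  show "continuous_on {1..} (\<lambda>x. complex_of_real (theta_tail x))"
    by (intro continuous_intros continuous_on_theta_tail)
  show "\<exists>C. \<forall>x\<ge>1. norm (complex_of_real (theta_tail x)) \<le> C * x powr (- (\<bar>b\<bar> + 1))"
    using theta_tail_decay[of "\<bar>b\<bar> + 1"] theta_tail_nonneg by auto
qed

lemma absolutely_integrable_Mellin_theta:
  "(\<lambda>x. complex_of_real (theta_tail x) * of_real x powr (s - 1)) absolutely_integrable_on {1..}"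
proof -
  obtain C where "\<And>x. x \<ge> 1 \<Longrightarrow> norm (complex_of_real (theta_tail x)) \<le> C * x powr (- (\<bar>Re s\<bar> + 1))"
    using theta_tail_complex(2) by blast
  from absolutely_integrable_Mellin_at_top[OF theta_tail_complex(1) this, of s] show ?thesis by simp
qed

lemma holomorphic_Mellin_theta: "Mellin_theta holomorphic_on UNIV"
proof -
  have "Mellin_theta field_differentiable at s" for s
  proof -
    obtain C where "\<And>x. x \<ge> 1 \<Longrightarrow> norm (complex_of_real (theta_tail x)) \<le> C * x powr (- (\<bar>Re s\<bar> + 1))"
      using theta_tail_complex(2) by blast
    from holomorphic_Mellin_at_top[OF theta_tail_complex(1) this]
    have "Mellin_theta holomorphic_on {z. Re z < \<bar>Re s\<bar> + 1}" unfolding Mellin_theta_def .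
    then show ?thesis by (rule holomorphic_on_imp_differentiable_at) (auto simp: open_halfspace_Re_lt)
  qed
  then show ?thesis by (auto simp: holomorphic_on_def field_differentiable_at_within)
qed

lemma integral_powr_at_top:
  assumes "Re z < 0"
  shows "(\<lambda>x. complex_of_real x powr (z - 1)) absolutely_integrable_on {1..}"
    "integral {1..} (\<lambda>x. complex_of_real x powr (z - 1)) = - 1 / z"
proof -
  define g where "g = (\<lambda>x. complex_of_real x powr (z - 1))"
  have z: "z \<noteq> 0" using assms by auto
  have "(\<lambda>x. (\<lambda>_. 1) x * complex_of_real x powr (z - 1)) absolutely_integrable_on {1..}"
    by (rule absolutely_integrable_Mellin_at_top[where C = 1 and b = 0]) (use assms in auto)
  then show int: "(\<lambda>x. complex_of_real x powr (z - 1)) absolutely_integrable_on {1..}" by simp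
  then have I: "integrable lebesgue (\<lambda>x. indicator {1..} x *\<^sub>R g x)" unfolding g_def set_integrable_def .
  then have "(\<lambda>N. \<integral>x. indicator {..real N + 1} x *\<^sub>R (indicator {1..} x *\<^sub>R g x) \<partial>lebesgue) \<longlonglongrightarrow> (LINT x:{1..}|lebesgue. g x)"
    unfolding set_lebesgue_integral_def
  proof (intro integral_dominated_convergence[where w = "\<lambda>x. norm (indicator {1..} x *\<^sub>R g x)"] AE_I2)
    fix x :: real
    have "eventually (\<lambda>N. real N + 1 \<ge> x) sequentially" by real_asymp
    then show "(\<lambda>N. indicator {..real N + 1} x *\<^sub>R (indicator {1..} x *\<^sub>R g x)) \<longlonglongrightarrow> indicator {1..} x *\<^sub>R g x"
      by (intro tendsto_eventually, elim eventually_mono) (simp add: indicator_def)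
  next
    show "integrable lebesgue (\<lambda>x. norm (indicator {1..} x *\<^sub>R g x))" by (rule integrable_norm[OF I])
    show "(\<lambda>x. indicator {1..} x *\<^sub>R g x) \<in> borel_measurable lebesgue" by (rule borel_measurable_integrable[OF I])
    show "(\<lambda>x. indicator {..real N + 1} x *\<^sub>R (indicator {1..} x *\<^sub>R g x)) \<in> borel_measurable lebesgue" for N
      by (rule borel_measurable_scaleR[OF borel_measurable_indicator borel_measurable_integrable[OF I]]) auto
  qed (auto simp: indicator_def)
  moreover have "(LINT x:{1..}|lebesgue. g x) = integral {1..} g"
    using set_lebesgue_integral_eq_integral(2)[OF int] unfolding g_def .
  moreover have "(\<integral>x. indicator {..y} x *\<^sub>R (indicator {1..} x *\<^sub>R g x) \<partial>lebesgue) = (of_real y powr z - 1) / z" if y: "y \<ge> 1" for y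
  proof -
    have "(\<integral>x. indicator {..y} x *\<^sub>R (indicator {1..} x *\<^sub>R g x) \<partial>lebesgue) = (LINT x:{1..y}|lebesgue. g x)"
      unfolding set_lebesgue_integral_def by (intro Bochner_Integration.integral_cong) (auto simp: indicator_def)
    also have "\<dots> = integral {1..y} g"
      unfolding g_def by (intro set_lebesgue_integral_eq_integral(2) set_integrable_subset[OF int]) auto
    also have "(g has_integral (of_real y powr z / z - of_real 1 powr z / z)) {1..y}"
    proof (rule fundamental_theorem_of_calculus[OF y])
      fix x assume "x \<in> {1..y}"
      then have x: "x > 0" by simp
      have "((\<lambda>w. w powr z / z) has_field_derivative g x) (at (of_real x))"
        unfolding g_def using x z by (auto intro!: derivative_eq_intros simp: powr_diff complex_nonpos_Reals_iff)
      then show "((\<lambda>x. of_real x powr z / z) has_vector_derivative g x) (at x within {1..y})"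
        by (rule has_vector_derivative_real_field)
    qed
    then have "integral {1..y} g = (of_real y powr z - 1) / z" by (simp add: integral_unique diff_divide_distrib)
    finally show ?thesis .
  qed
  then have "(\<lambda>N. \<integral>x. indicator {..real N + 1} x *\<^sub>R (indicator {1..} x *\<^sub>R g x) \<partial>lebesgue) = (\<lambda>N. (of_real (real N + 1) powr z - 1) / z)"
    by (intro ext) auto
  moreover have "(\<lambda>N. (complex_of_real (real N + 1) powr z - 1) / z) \<longlonglongrightarrow> (0 - 1) / z"
  proof (intro tendsto_intros)
    show "(\<lambda>N. complex_of_real (real N + 1) powr z) \<longlonglongrightarrow> 0"
    proof (rule Lim_null_comparison)
      show "\<forall>\<^sub>F N in sequentially. norm (complex_of_real (real N + 1) powr z) \<le> (real N + 1) powr Re z"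
        by (intro always_eventually allI, subst norm_of_real_powr) auto
      show "(\<lambda>N. (real N + 1) powr Re z) \<longlonglongrightarrow> 0" using assms by real_asymp
    qed
  qed (use z in auto)
  ultimately have "integral {1..} g = (0 - 1) / z"
    by (simp only:) (rule LIMSEQ_unique)
  then show "integral {1..} (\<lambda>x. complex_of_real x powr (z - 1)) = - 1 / z" by (simp add: g_def)
qed

text \<open>Riemann's splitting at 1. On (0, 1] the inversion and
  \<open>theta_transformation\<close> give theta_tail(1/x) = sqrt x theta_tail(x) + (sqrt x - 1)/2;
  the last part integrates to the rational terms with poles at s = 1/2 and s = 0 and needs Re s >
  1/2 to converge.\<close>

lemma Mellin_theta_total:
  assumes s: "Re s > 1/2"
  shows "(\<lambda>x. complex_of_real (theta_tail x) * of_real x powr (s - 1)) absolutely_integrable_on {0<..}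
     \<Longrightarrow> integral {0<..} (\<lambda>x. complex_of_real (theta_tail x) * of_real x powr (s - 1))
      = Mellin_theta s + Mellin_theta (1/2 - s) + 1 / (2 * s - 1) - 1 / (2 * s)"
proof -
  assume abs: "(\<lambda>x. complex_of_real (theta_tail x) * of_real x powr (s - 1)) absolutely_integrable_on {0<..}"
  have inv: "complex_of_real (theta_tail (1 / x)) * of_real x powr (- s - 1) =
     of_real (theta_tail x) * of_real x powr ((1/2 - s) - 1) + (of_real x powr ((1/2 - s) - 1) / 2 - of_real x powr (- s - 1) / 2)"
    if x: "x \<ge> 1" for x
  proof -
    have th: "theta_tail (1/x) = sqrt x * theta_tail x + (sqrt x - 1) / 2"
      using theta_transformation[of x] x by (simp add: field_simps)
    have "complex_of_real (sqrt x) = of_real x powr (1/2)" using x by (simp add: powr_half_sqrt[symmetric] powr_of_real[symmetric])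
    then have p: "complex_of_real (sqrt x) * of_real x powr (- s - 1) = of_real x powr ((1/2 - s) - 1)"
      using x by (simp add: powr_add[symmetric] algebra_simps)
    have main: "complex_of_real (sqrt x * \<theta> + (sqrt x - 1) / 2) * u = of_real \<theta> * (complex_of_real (sqrt x) * u) + ((complex_of_real (sqrt x) * u) / 2 - u / 2)" for \<theta> u
      by (simp add: diff_divide_distrib algebra_simps)
    show ?thesis using main[of "theta_tail x" "of_real x powr (- s - 1)"] by (simp only: th p)
  qed
  have i1: "(\<lambda>x. of_real x powr ((1/2 - s) - 1) / 2 - of_real x powr (- s - 1) / 2) absolutely_integrable_on {1..}"
    by (intro set_integral_diff(1) set_integrable_divide integral_powr_at_top(1)) (use s in auto)
  have i0: "(\<lambda>x. of_real (theta_tail x) * of_real x powr ((1/2 - s) - 1) + (of_real x powr ((1/2 - s) - 1) / 2 - of_real x powr (- s - 1) / 2)) absolutely_integrable_on {1..}"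
    by (intro set_integral_add(1) i1 absolutely_integrable_Mellin_theta)
  have i2: "(\<lambda>x. complex_of_real (theta_tail (1 / x)) * of_real x powr (- s - 1)) absolutely_integrable_on {1..}"
    by (rule set_integrable_cong[THEN iffD1, OF refl refl _ i0]) (use inv in auto)
  note io = set_lebesgue_integral_eq_integral(1)
  have "integral {0<..1} (\<lambda>x. complex_of_real (theta_tail x) * of_real x powr (s - 1)) 
     = integral {1..} (\<lambda>x. complex_of_real (theta_tail (1 / x)) * of_real x powr (- s - 1))"
    by (rule Mellin_inversion_of_variable(2)[OF i2])
  also have "\<dots> = integral {1..} (\<lambda>x. of_real (theta_tail x) * of_real x powr ((1/2 - s) - 1) + (of_real x powr ((1/2 - s) - 1) / 2 - of_real x powr (- s - 1) / 2))"
    by (rule integral_cong) (use inv in auto)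
  also have "\<dots> = Mellin_theta (1/2 - s) + integral {1..} (\<lambda>x. of_real x powr ((1/2 - s) - 1) / 2 - of_real x powr (- s - 1) / 2)"
    unfolding Mellin_theta_def by (intro integral_add io absolutely_integrable_Mellin_theta i1)
  finally have lo: "integral {0<..1} (\<lambda>x. complex_of_real (theta_tail x) * of_real x powr (s - 1)) = 
    Mellin_theta (1/2 - s) + integral {1..} (\<lambda>x. of_real x powr ((1/2 - s) - 1) / 2 - of_real x powr (- s - 1) / 2)" .
  have "integral {1..} (\<lambda>x. complex_of_real x powr ((1/2 - s) - 1) / 2 - of_real x powr (- s - 1) / 2) 
     = integral {1..} (\<lambda>x. complex_of_real x powr ((1/2 - s) - 1) / 2) - integral {1..} (\<lambda>x. of_real x powr (- s - 1) / 2)"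
    by (intro integral_diff io set_integrable_divide integral_powr_at_top(1)) (use s in auto)
  also have "\<dots> = 1 / (2 * s - 1) - 1 / (2 * s)"
  proof -
    have "1 / (2 * s - 1) = - (1 / (1 - 2 * s))" using divide_minus_right[of 1 "1 - 2 * s"] by (simp only: minus_diff_eq)
    also have "\<dots> = - 1 / (1/2 - s) / 2" by (simp add: mult.commute)
    finally have 1: "1 / (2 * s - 1) = - 1 / (1/2 - s) / 2" .
    have 2: "1 / (2 * s) = - 1 / (-s) / 2" by simp
    have s': "Re (1/2 - s) < 0" "Re (- s) < 0" using s by auto
    show ?thesis by (simp only: integral_divide integral_powr_at_top(2)[OF s'(1)] integral_powr_at_top(2)[OF s'(2)] 1 2)
  qed
  finally have lo': "integral {1..} (\<lambda>x. complex_of_real x powr ((1/2 - s) - 1) / 2 - of_real x powr (- s - 1) / 2) = 1 / (2 * s - 1) - 1 / (2 * s)" .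
  have "integral ({0<..1} \<union> {1..}) (\<lambda>x. complex_of_real (theta_tail x) * of_real x powr (s - 1)) =
     integral {0<..1} (\<lambda>x. complex_of_real (theta_tail x) * of_real x powr (s - 1)) + 
     integral {1..} (\<lambda>x. complex_of_real (theta_tail x) * of_real x powr (s - 1))"
    by (rule integral_Un[OF io[OF Mellin_inversion_of_variable(1)[OF i2]] io[OF absolutely_integrable_Mellin_theta]])
       (rule negligible_subset[of "{1}"], auto)
  moreover have "{0<..1} \<union> {1..} = {0::real<..}" by auto
  moreover have "(b + (c - d)) + a = a + b + c - d" for a b c d :: complex by simp
  ultimately show ?thesis unfolding lo lo' Mellin_theta_def by (simp only:)
qed

text \<open>What is left of the completed zeta function pi^(- w/2) Gamma(w/2) zeta(w) once its polar
  part 1/(w - 1) - 1/w is taken away. It is entire and invariant under w to 1 - w by its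
  form.\<close>

definition completed_zeta_sym :: "complex \<Rightarrow> complex" where
  "completed_zeta_sym w = Mellin_theta (w / 2) + Mellin_theta ((1 - w) / 2)"

text \<open>The polar term -1/w of the completed function, multiplied by 1/Gamma(w/2), is written as
  -1/(2 Gamma(w/2 + 1)). The formula is thus holomorphic at 0, and the only singularity left is the
  one at 1.\<close>

definition zeta_by_theta :: "complex \<Rightarrow> complex" where
  "zeta_by_theta w = of_real pi powr (w / 2) *
     (rGamma (w / 2) * (completed_zeta_sym w + 1 / (w - 1)) - rGamma (w / 2 + 1) / 2)"

text \<open>With s = w/2, the Mellin transform of exp(-pi n^2 x) is pi^(-s) Gamma(s) n^(-w). Summing
  over n gives the transform of \<open>theta_tail\<close>, which \<open>Mellin_theta_total\<close>
  evaluates.\<close>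

lemma completed_zeta_sums:
  assumes w: "Re w > 1"
  shows "(\<lambda>n. of_real pi powr (- (w / 2)) * Gamma (w / 2) * (1 / of_nat (Suc n) powr w)) sums
     (completed_zeta_sym w + 1 / (w - 1) - 1 / w)"
proof -
  define s where "s = w / 2"
  define K where "K = (\<lambda>x::real. complex_of_real (exp (- x)))"
  define a where "a = (\<lambda>n. pi * (real (Suc n))\<^sup>2)"
  have s: "Re s > 1/2" using w by (simp add: s_def)
  have K: "K x * of_real x powr (s - 1) = of_real x powr (s - 1) / of_real (exp x)" for x
    by (simp add: K_def exp_minus field_simps exp_of_real)
  have int: "(\<lambda>x. K x * of_real x powr (s - 1)) absolutely_integrable_on {0<..}"
    unfolding K using s by (intro absolutely_integrable_Gamma_integral') auto
  have val: "integral {0<..} (\<lambda>x. K x * of_real x powr (s - 1)) = Gamma s"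
    unfolding K using Gamma_integral_complex'[of s] s by (simp add: has_integral_iff)
  have a: "a n > 0" for n by (simp add: a_def)
  have apow: "a n powr (- Re s) = pi powr (- Re s) * real (Suc n) powr (- Re w)" for n
  proof -
    have "a n powr (- Re s) = pi powr (- Re s) * (real (Suc n) powr 2) powr (- Re s)"
      unfolding a_def by (subst powr_mult) auto
    also have "(real (Suc n) powr 2) powr (- Re s) = real (Suc n) powr (2 * (- Re s))" by (rule powr_powr)
    also have "2 * (- Re s) = - Re w" by (simp add: s_def)
    finally show ?thesis .
  qed
  have sum: "summable (\<lambda>n. norm (1::complex) * a n powr (- Re s))"
  proof -
    have "summable (\<lambda>n. real (Suc n) powr (- Re w))"
      using w by (subst summable_Suc_iff[of "\<lambda>n. real n powr (- Re w)"]) (simp add: summable_real_powr_iff)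
    then show ?thesis unfolding apow by (simp add: summable_mult)
  qed
  have K_eq: "1 * K (a n * x) = of_real (exp (- pi * x * (real (Suc n))\<^sup>2))" for n x
    by (simp add: K_def a_def mult_ac)
  have pw: "summable (\<lambda>n. norm (1 * K (a n * x)))" if "x > 0" for x
    unfolding K_eq norm_of_real abs_exp_cancel using theta_tail_sums[OF that] by (rule sums_summable)
  have suminf: "(\<Sum>n. 1 * K (a n * x)) = of_real (theta_tail x)" if "x > 0" for x
    unfolding K_eq theta_tail_def by (rule suminf_of_real[OF sums_summable[OF theta_tail_sums[OF that]], symmetric])
  note M = Mellin_series[OF a int sum pw]
  have abs: "(\<lambda>x. complex_of_real (theta_tail x) * of_real x powr (s - 1)) absolutely_integrable_on {0<..}"
    by (rule set_integrable_cong[THEN iffD1, OF refl refl _ M(1)]) (simp only: suminf greaterThan_iff)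
  have eq: "integral {0<..} (\<lambda>x. (\<Sum>n. 1 * K (a n * x)) * of_real x powr (s - 1)) = 
     Mellin_theta s + Mellin_theta (1/2 - s) + 1 / (2 * s - 1) - 1 / (2 * s)"
    unfolding Mellin_theta_total[OF s abs, symmetric] by (rule integral_cong) (simp only: suminf greaterThan_iff)
  have "1 * of_real (a n) powr (- s) * Gamma s = of_real pi powr (- s) * Gamma s * (1 / of_nat (Suc n) powr w)" for n
  proof -
    have "of_real (a n) powr (- s) = complex_of_real pi powr (- s) * of_real ((real (Suc n))\<^sup>2) powr (- s)"
      unfolding a_def of_real_mult by (rule powr_times_real) auto
    also have "complex_of_real ((real (Suc n))\<^sup>2) powr (- s) = exp (- s * of_real (ln ((real (Suc n))\<^sup>2)))"
      by (rule of_real_powr_eq_exp) simp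
    also have "\<dots> = exp (- w * of_real (ln (real (Suc n))))"
      by (simp add: s_def ln_realpow)
    also have "\<dots> = 1 / complex_of_real (real (Suc n)) powr w"
      by (subst of_real_powr_eq_exp) (auto simp: exp_minus field_simps)
    finally show ?thesis by simp
  qed
  with M(2) have "(\<lambda>n. of_real pi powr (- s) * Gamma s * (1 / of_nat (Suc n) powr w)) sums
     (Mellin_theta s + Mellin_theta (1/2 - s) + 1 / (2 * s - 1) - 1 / (2 * s))" unfolding eq val by (simp only:)
  moreover have "1/2 - s = (1 - w) / 2" "2 * s = w" by (simp_all add: s_def field_simps)
  ultimately show ?thesis by (simp only: s_def completed_zeta_sym_def)
qed

lemma zeta_by_theta_eq:
  assumes "w \<noteq> 0"
  shows "zeta_by_theta w = of_real pi powr (w / 2) * rGamma (w / 2) * (completed_zeta_sym w + 1 / (w - 1) - 1 / w)"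
proof -
  have "rGamma (w / 2 + 1) / 2 = rGamma (w / 2) * (1 / w)"
    using rGamma_plus1[of "w / 2"] assms by (simp add: field_simps)
  then show ?thesis unfolding zeta_by_theta_def by (simp only:) (simp add: algebra_simps)
qed

lemma is_zeta_continuation_zeta_by_theta: "is_zeta_continuation zeta_by_theta"
  unfolding is_zeta_continuation_def
proof (intro conjI allI impI)
  have "completed_zeta_sym holomorphic_on A" for A
    unfolding completed_zeta_sym_def
    by (intro holomorphic_intros holomorphic_on_compose_gen[OF _ holomorphic_Mellin_theta, unfolded o_def]) auto
  then show "zeta_by_theta holomorphic_on - {1}" unfolding zeta_by_theta_def
    by (intro holomorphic_intros) auto
  fix w :: complex assume w: "Re w > 1"
  then have w0: "w \<noteq> 0" by auto
  have "Gamma (w / 2) \<noteq> 0" using w by (auto simp: Gamma_eq_zero_iff elim!: nonpos_Ints_cases)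
  then have nz: "rGamma (w / 2) * Gamma (w / 2) = 1" by (simp add: rGamma_inverse_Gamma)
  have nz': "of_real pi powr (w / 2) * of_real pi powr (- (w / 2)) = (1::complex)"
    by (simp add: powr_def exp_minus)
  from sums_mult[OF completed_zeta_sums[OF w], of "of_real pi powr (w / 2) * rGamma (w / 2)"]
  have "(\<lambda>n. of_real pi powr (w / 2) * rGamma (w / 2) * (of_real pi powr (- (w / 2)) * Gamma (w / 2) * (1 / of_nat (Suc n) powr w))) sums zeta_by_theta w"
    unfolding zeta_by_theta_eq[OF w0] .
  moreover have "of_real pi powr (w / 2) * rGamma (w / 2) * (of_real pi powr (- (w / 2)) * Gamma (w / 2) * x) = x" for x
  proof -
    have "of_real pi powr (w / 2) * rGamma (w / 2) * (of_real pi powr (- (w / 2)) * Gamma (w / 2) * x) =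
      (of_real pi powr (w / 2) * of_real pi powr (- (w / 2))) * (rGamma (w / 2) * Gamma (w / 2)) * x" by (simp only: mult_ac)
    then show ?thesis by (simp only: nz nz' mult_1)
  qed
  ultimately show "(\<lambda>n. 1 / of_nat (Suc n) powr w) sums zeta_by_theta w" by (simp only:)
qed

lemma is_zeta_continuation_riemann_zeta: "is_zeta_continuation riemann_zeta"
  unfolding riemann_zeta_def by (rule someI[of is_zeta_continuation, OF is_zeta_continuation_zeta_by_theta])

lemma holomorphic_riemann_zeta: "riemann_zeta holomorphic_on - {1}"
  and riemann_zeta_sums: "Re s > 1 \<Longrightarrow> (\<lambda>n. 1 / of_nat (Suc n) powr s) sums riemann_zeta s"
  using is_zeta_continuation_riemann_zeta unfolding is_zeta_continuation_def by blast+

text \<open>In the strip 1/Gamma(w/2) does not vanish, so a zero of zeta is a zero of the completed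
  function, and that function is unchanged by w to 1 - w.\<close>

lemma riemann_zeta_zero_reflect:
  assumes "0 < Re w" "Re w < 1" "riemann_zeta w = 0"
  shows "riemann_zeta (1 - w) = 0"
proof -
  have ne: "w \<noteq> 0" "w \<noteq> 1" "1 - w \<noteq> 0" using assms by auto
  have eq: "riemann_zeta z = zeta_by_theta z" if "z \<noteq> 1" for z
    by (rule is_zeta_continuation_unique[OF is_zeta_continuation_riemann_zeta is_zeta_continuation_zeta_by_theta that])
  have r: "rGamma (w / 2) \<noteq> 0" using assms(1) by (auto simp: rGamma_eq_zero_iff elim!: nonpos_Ints_cases)
  have "of_real pi powr (w / 2) \<noteq> (0::complex)" by simp
  moreover have "of_real pi powr (w / 2) * rGamma (w / 2) * (completed_zeta_sym w + 1 / (w - 1) - 1 / w) = 0"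
    using assms(3) unfolding eq[OF ne(2)] zeta_by_theta_eq[OF ne(1)] .
  ultimately have 0: "completed_zeta_sym w + 1 / (w - 1) - 1 / w = 0"
    using r unfolding mult_eq_0_iff by blast
  have 1: "completed_zeta_sym (1 - w) + 1 / ((1 - w) - 1) - 1 / (1 - w) = completed_zeta_sym w + 1 / (w - 1) - 1 / w"
  proof -
    have a: "completed_zeta_sym (1 - w) = completed_zeta_sym w" by (simp add: completed_zeta_sym_def add.commute)
    have b: "1 / ((1 - w) - 1) = - (1 / w)" by simp
    have c: "1 / (1 - w) = - (1 / (w - 1))" using divide_minus_right[of 1 "w - 1"] by (simp only: minus_diff_eq)
    show ?thesis unfolding a b c by simp
  qed
  have "zeta_by_theta (1 - w) = 0" unfolding zeta_by_theta_eq[OF ne(3)] 1 0 by (rule mult_zero_right)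
  moreover have "1 - w \<noteq> 1" using ne(1) by simp
  ultimately show ?thesis using eq by metis
qed

section \<open>The Euler product and the Moebius function\<close>

text \<open>At n = 0 the power is 0 and the quotient by it again 0. The term is therefore
  multiplicative on all natural numbers, and an index set may contain 0.\<close>

definition zeta_term :: "complex \<Rightarrow> nat \<Rightarrow> complex" where
  "zeta_term s n = 1 / of_nat n powr s"

lemma zeta_term_0 [simp]: "zeta_term s 0 = 0"
  by (simp add: zeta_term_def)

lemma zeta_term_1 [simp]: "zeta_term s (Suc 0) = 1"
  by (simp add: zeta_term_def)

lemma zeta_term_mult: "zeta_term s (m * n) = zeta_term s m * zeta_term s n"
  using powr_times_real[of "of_nat m" "of_nat n" s] by (simp add: zeta_term_def)

lemma norm_zeta_term: "norm (zeta_term s n) = real n powr (- Re s)"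
proof (cases "n = 0")
  case False
  then show ?thesis using norm_of_real_powr[of "real n" s]
    by (simp add: zeta_term_def norm_divide powr_minus field_simps)
qed simp

lemma abs_summable_zeta_term:
  assumes "Re s > 1"
  shows "(\<lambda>n. real n powr (- Re s)) summable_on A"
  using assms by (intro summable_on_subset_banach[of _ UNIV A]) (auto simp: summable_on_UNIV_nonneg_real_iff summable_real_powr_iff)

lemma summable_on_bounded_mult_zeta_term:
  fixes a :: "nat \<Rightarrow> complex"
  assumes "Re s > 1" "\<And>n. norm (a n) \<le> 1"
  shows "(\<lambda>n. a n * zeta_term s n) summable_on A"
proof (rule abs_summable_summable, rule summable_on_comparison_test[OF abs_summable_zeta_term[OF assms(1)]])
  show "norm (a n * zeta_term s n) \<le> real n powr (- Re s)" for n
    using mult_right_mono[OF assms(2), of "norm (zeta_term s n)" n] by (simp add: norm_mult norm_zeta_term)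
qed auto

lemma summable_on_zeta_term: "Re s > 1 \<Longrightarrow> zeta_term s summable_on A"
  using summable_on_bounded_mult_zeta_term[of s "\<lambda>_. 1"] by simp

lemma infsum_zeta_term:
  assumes "Re s > 1"
  shows "infsum (zeta_term s) {0<..} = riemann_zeta s"
proof -
  have "(\<lambda>n. zeta_term s (Suc n)) sums riemann_zeta s"
    using riemann_zeta_sums[OF assms] by (simp add: zeta_term_def)
  moreover have "bij_betw Suc UNIV {0::nat<..}"
    by (rule bij_betwI[where g = "\<lambda>n. n - 1"]) auto
  then have "infsum (zeta_term s) {0<..} = infsum (\<lambda>n. zeta_term s (Suc n)) UNIV"
    "(\<lambda>n. zeta_term s (Suc n)) summable_on UNIV"
    using infsum_reindex_bij_betw[of Suc UNIV "{0<..}" "zeta_term s"] 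
      summable_on_reindex_bij_betw[of Suc UNIV "{0<..}" "zeta_term s"] summable_on_zeta_term[OF assms] by auto
  ultimately show ?thesis
    using has_sum_imp_sums[OF has_sum_infsum] sums_unique2 by metis
qed

lemma infsum_tail_tendsto_0:
  assumes "Re s > 1"
  shows "(\<lambda>N. \<Sum>\<^sub>\<infinity>n\<in>{N<..}. real n powr (- Re s)) \<longlonglongrightarrow> 0"
proof -
  define g where "g = (\<lambda>n. real n powr (- Re s))"
  have S: "g summable_on A" for A unfolding g_def by (rule abs_summable_zeta_term[OF assms])
  have eq: "infsum g {N<..} = infsum g UNIV - sum g {..N}" for N
  proof -
    have "infsum g ({..N} \<union> {N<..}) = infsum g {..N} + infsum g {N<..}"
      by (rule infsum_Un_disjoint) (auto intro: S)
    moreover have "{..N} \<union> {N<..} = UNIV" by auto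
    ultimately show ?thesis by simp
  qed
  have "g sums infsum g UNIV" by (intro has_sum_imp_sums has_sum_infsum S)
  then have "(\<lambda>N. sum g {..N}) \<longlonglongrightarrow> infsum g UNIV" unfolding sums_def_le .
  then have "(\<lambda>N. infsum g UNIV - sum g {..N}) \<longlonglongrightarrow> infsum g UNIV - infsum g UNIV" by (intro tendsto_intros)
  then show ?thesis unfolding g_def[symmetric] eq by simp
qed

lemma norm_infsum_bounded_mult_zeta_term_le:
  fixes a :: "nat \<Rightarrow> complex"
  assumes "Re s > 1" "\<And>n. norm (a n) \<le> 1" "A \<subseteq> {N<..}"
  shows "norm (\<Sum>\<^sub>\<infinity>n\<in>A. a n * zeta_term s n) \<le> (\<Sum>\<^sub>\<infinity>n\<in>{N<..}. real n powr (- Re s))"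
proof -
  have "norm (\<Sum>\<^sub>\<infinity>n\<in>A. a n * zeta_term s n) \<le> (\<Sum>\<^sub>\<infinity>n\<in>A. norm (a n * zeta_term s n))"
    by (rule norm_infsum_bound)
       (rule summable_on_comparison_test[OF abs_summable_zeta_term[OF assms(1)]],
        auto simp: norm_mult norm_zeta_term mult_left_le_one_le assms(2))
  also have "\<dots> \<le> (\<Sum>\<^sub>\<infinity>n\<in>{N<..}. real n powr (- Re s))"
    by (rule infsum_mono_neutral)
       (use assms(3) in \<open>auto intro!: abs_summable_zeta_term assms(1) summable_on_comparison_test[OF abs_summable_zeta_term[OF assms(1)]]
          simp: norm_mult norm_zeta_term mult_left_le_one_le assms(2)\<close>)
  finally show ?thesis .
qed

text \<open>The sieve has two sides. Multiplying zeta by the first Euler factors leaves the series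
  over rough numbers, while the series of mu over smooth numbers equals the product of those
  factors. Letting N grow in both identifies the series of mu as 1/zeta.\<close>

definition rough_numbers :: "nat \<Rightarrow> nat set" where
  "rough_numbers N = {n. n > 0 \<and> (\<forall>p. prime p \<longrightarrow> p dvd n \<longrightarrow> p > N)}"

definition smooth_numbers :: "nat \<Rightarrow> nat set" where
  "smooth_numbers N = {n. n > 0 \<and> (\<forall>p. prime p \<longrightarrow> p dvd n \<longrightarrow> p \<le> N)}"

text \<open>The partial product for 1/zeta, not for zeta: finite products of 1 - p^(-s) multiply out
  without any inversion.\<close>

definition euler_product :: "nat \<Rightarrow> complex \<Rightarrow> complex" where
  "euler_product N s = (\<Prod>p | prime p \<and> p \<le> N. 1 - zeta_term s p)"

lemma rough_numbers_Suc:
  assumes "prime (Suc N)"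
  shows "rough_numbers N = rough_numbers (Suc N) \<union> (*) (Suc N) ` rough_numbers N"
    "rough_numbers (Suc N) \<inter> (*) (Suc N) ` rough_numbers N = {}"
proof -
  show "rough_numbers N = rough_numbers (Suc N) \<union> (*) (Suc N) ` rough_numbers N"
  proof (intro equalityI subsetI)
    fix n assume n: "n \<in> rough_numbers N"
    show "n \<in> rough_numbers (Suc N) \<union> (*) (Suc N) ` rough_numbers N"
    proof (cases "Suc N dvd n")
      case True
      then obtain m where "n = Suc N * m" by blast
      moreover from this n have "m \<in> rough_numbers N" by (auto simp: rough_numbers_def)
      ultimately show ?thesis by blast
    next
      case False
      then have "n \<in> rough_numbers (Suc N)" using n unfolding rough_numbers_def
        by (auto intro!: Suc_lessI)
      then show ?thesis by blast
    qed
  next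
    fix n assume "n \<in> rough_numbers (Suc N) \<union> (*) (Suc N) ` rough_numbers N"
    then show "n \<in> rough_numbers N"
    proof
      assume "n \<in> rough_numbers (Suc N)"
      then show ?thesis unfolding rough_numbers_def using Suc_lessD by blast
    next
      assume "n \<in> (*) (Suc N) ` rough_numbers N"
      then obtain m where m: "n = Suc N * m" "m \<in> rough_numbers N" by blast
      have "p > N" if "prime p" "p dvd n" for p
      proof -
        from that m have "p dvd Suc N \<or> p dvd m" by (simp only: prime_dvd_mult_iff)
        then show ?thesis using that(1) assms m(2) primes_dvd_imp_eq[of p "Suc N"] by (auto simp: rough_numbers_def)
      qed
      then show ?thesis using m by (auto simp: rough_numbers_def)
    qed
  qed
  have "Suc N * m \<notin> rough_numbers (Suc N)" for m
    using assms unfolding rough_numbers_def by (metis (no_types, lifting) dvd_triv_left less_irrefl mem_Collect_eq)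
  then show "rough_numbers (Suc N) \<inter> (*) (Suc N) ` rough_numbers N = {}" by blast
qed

lemma euler_product_Suc: 
  "euler_product (Suc N) s = (if prime (Suc N) then 1 - zeta_term s (Suc N) else 1) * euler_product N s"
proof -
  have "{p. prime p \<and> p \<le> Suc N} = (if prime (Suc N) then {Suc N} else {}) \<union> {p. prime p \<and> p \<le> N}"
    by (auto simp: le_Suc_eq)
  then show ?thesis unfolding euler_product_def by (simp add: prod.insert)
qed

lemma rough_smooth_Suc_nonprime:
  assumes "\<not> prime (Suc N)"
  shows "rough_numbers (Suc N) = rough_numbers N" "smooth_numbers (Suc N) = smooth_numbers N"
  using assms unfolding rough_numbers_def smooth_numbers_def by (metis Suc_lessI Suc_lessD, metis le_Suc_eq)

lemma infsum_mult_image: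
  fixes a :: "nat \<Rightarrow> complex"
  assumes "k > 0"
  shows "infsum a ((*) k ` A) = infsum (\<lambda>m. a (k * m)) A"
  by (subst infsum_reindex) (use assms in \<open>auto simp: inj_on_def o_def\<close>)

text \<open>One step of the sieve of Eratosthenes for each prime p: among the numbers still left,
  the multiples of p contribute p^(-s) times the whole sum, so removing them multiplies the sum by 1
  - p^(-s).\<close>

lemma infsum_rough:
  assumes s: "Re s > 1"
  shows "infsum (zeta_term s) (rough_numbers N) = euler_product N s * riemann_zeta s"
proof (induction N)
  case 0
  have "rough_numbers 0 = {0<..}" by (auto simp: rough_numbers_def prime_gt_0_nat)
  then show ?case using infsum_zeta_term[OF s] by (simp add: euler_product_def)
next
  case (Suc N)
  show ?case
  proof (cases "prime (Suc N)")
    case True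
    have "infsum (zeta_term s) (rough_numbers N) = infsum (zeta_term s) (rough_numbers (Suc N)) + infsum (zeta_term s) ((*) (Suc N) ` rough_numbers N)"
      by (subst rough_numbers_Suc(1)[OF True]) (intro infsum_Un_disjoint summable_on_zeta_term s rough_numbers_Suc(2) True)
    also have "infsum (zeta_term s) ((*) (Suc N) ` rough_numbers N) = zeta_term s (Suc N) * infsum (zeta_term s) (rough_numbers N)"
      by (simp only: infsum_mult_image zero_less_Suc zeta_term_mult infsum_cmult_right')
    finally have *: "infsum (zeta_term s) (rough_numbers N) = infsum (zeta_term s) (rough_numbers (Suc N)) + zeta_term s (Suc N) * infsum (zeta_term s) (rough_numbers N)" .
    have "infsum (zeta_term s) (rough_numbers (Suc N)) = (1 - zeta_term s (Suc N)) * infsum (zeta_term s) (rough_numbers N)"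
      by (simp only: left_diff_distrib mult_1_left eq_diff_eq *[symmetric])
    then show ?thesis using True Suc.IH by (simp add: euler_product_Suc mult.assoc)
  qed (simp add: rough_smooth_Suc_nonprime euler_product_Suc Suc.IH)
qed

section \<open>The series of the Moebius function over smooth numbers\<close>

lemma abs_moebius_mu_le: "\<bar>moebius_mu n\<bar> \<le> 1"
  by (simp add: moebius_mu_def power_abs)

lemma moebius_mu_1 [simp]: "moebius_mu (Suc 0) = 1"
  by (simp add: moebius_mu_def)

lemma moebius_mu_prime_mult:
  assumes p: "prime p"
  shows "moebius_mu (p * m) = (if p dvd m then 0 else - moebius_mu m)"
proof (cases "p dvd m")
  case True
  then obtain q where "m = p * q" by blast
  then have "p\<^sup>2 dvd p * m" by (simp add: power2_eq_square)
  then have "\<not> squarefree (p * m)" using p unfolding squarefree_def by auto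
  then show ?thesis using True by (simp add: moebius_mu_def)
next
  case False
  then have cop: "coprime p m" using p by (simp add: prime_imp_coprime)
  have m: "m \<noteq> 0" using False by (cases m) auto
  have "squarefree (p * m) \<longleftrightarrow> squarefree m"
    using squarefree_mult_coprime[OF cop squarefree_prime[OF p]] squarefree_multD(2) by blast
  moreover have "prime_factors (p * m) = insert p (prime_factors m)"
    using p m prime_prime_factors[OF p] by (subst prime_factors_product) (auto simp: prime_gt_0_nat)
  moreover have "p \<notin> prime_factors m" using False by auto
  ultimately show ?thesis using False by (simp add: moebius_mu_def)
qed

text \<open>The two sets are the numbers that contain the new prime to the power 0 and 1. Whatever
  else is smooth for the new bound is divisible by the square of that prime, where mu
  vanishes.\<close>

lemma smooth_numbers_Suc:
  assumes "prime (Suc N)"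
  shows "smooth_numbers N \<union> (*) (Suc N) ` smooth_numbers N \<subseteq> smooth_numbers (Suc N)"
    "smooth_numbers N \<inter> (*) (Suc N) ` smooth_numbers N = {}"
    "n \<in> smooth_numbers (Suc N) - (smooth_numbers N \<union> (*) (Suc N) ` smooth_numbers N) \<Longrightarrow> moebius_mu n = 0"
proof -
  have sub: "m \<in> smooth_numbers N \<Longrightarrow> m \<in> smooth_numbers (Suc N)" for m
    unfolding smooth_numbers_def using le_SucI by blast
  have mul: "Suc N * m \<in> smooth_numbers (Suc N)" if m: "m \<in> smooth_numbers (Suc N)" for m
  proof -
    have "p \<le> Suc N" if "prime p" "p dvd Suc N * m" for p
    proof -
      from that have "p dvd Suc N \<or> p dvd m" by (simp only: prime_dvd_mult_iff)
      then show ?thesis using that(1) assms m dvd_imp_le by (auto simp: smooth_numbers_def)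
    qed
    then show ?thesis using m by (auto simp: smooth_numbers_def)
  qed
  show "smooth_numbers N \<union> (*) (Suc N) ` smooth_numbers N \<subseteq> smooth_numbers (Suc N)" using sub mul by blast
  have "Suc N * m \<notin> smooth_numbers N" for m
    using assms unfolding smooth_numbers_def by (metis (no_types, lifting) dvd_triv_left mem_Collect_eq not_less_eq_eq order_refl)
  then show "smooth_numbers N \<inter> (*) (Suc N) ` smooth_numbers N = {}" by blast
  assume n: "n \<in> smooth_numbers (Suc N) - (smooth_numbers N \<union> (*) (Suc N) ` smooth_numbers N)"
  then obtain p where p: "prime p" "p dvd n" "p > N" "p \<le> Suc N" "n > 0" by (auto simp: smooth_numbers_def not_le)
  then have "p = Suc N" by simp
  then obtain m where m: "n = Suc N * m" using p by blast
  have "m \<in> smooth_numbers (Suc N)" using n m by (auto simp: smooth_numbers_def)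
  moreover have "m \<notin> smooth_numbers N" using n m by blast
  ultimately obtain q where q: "prime q" "q dvd m" "q > N" "q \<le> Suc N" by (auto simp: smooth_numbers_def not_le)
  then have "q = Suc N" by simp
  then have "Suc N dvd m" using q(2) by (simp only:)
  then show "moebius_mu n = 0" unfolding m moebius_mu_prime_mult[OF assms] by simp
qed

definition moebius_term :: "complex \<Rightarrow> nat \<Rightarrow> complex" where
  "moebius_term s n = of_real (moebius_mu n) * zeta_term s n"

lemma summable_on_moebius_term: "Re s > 1 \<Longrightarrow> moebius_term s summable_on A"
  unfolding moebius_term_def by (rule summable_on_bounded_mult_zeta_term) (auto simp: abs_moebius_mu_le)

lemma infsum_smooth:
  assumes s: "Re s > 1"
  shows "infsum (moebius_term s) (smooth_numbers N) = euler_product N s"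
proof (induction N)
  case 0
  have "smooth_numbers 0 = {1}"
  proof (intro equalityI subsetI)
    fix n assume n: "n \<in> smooth_numbers 0"
    show "n \<in> {1}"
    proof (rule ccontr)
      assume "n \<notin> {1}"
      then obtain p where "prime p" "p dvd n" using prime_factor_nat[of n] by auto
      then show False using n prime_gt_0_nat[of p] by (auto simp: smooth_numbers_def)
    qed
  qed (auto simp: smooth_numbers_def)
  then show ?case by (simp add: euler_product_def moebius_term_def)
next
  case (Suc N)
  show ?case
  proof (cases "prime (Suc N)")
    case True
    note sm = smooth_numbers_Suc[OF True]
    have "infsum (moebius_term s) (smooth_numbers (Suc N)) = infsum (moebius_term s) (smooth_numbers N \<union> (*) (Suc N) ` smooth_numbers N)"
      by (rule infsum_cong_neutral) (use sm(1,3) in \<open>auto simp: moebius_term_def\<close>)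
    also have "\<dots> = infsum (moebius_term s) (smooth_numbers N) + infsum (moebius_term s) ((*) (Suc N) ` smooth_numbers N)"
      by (intro infsum_Un_disjoint summable_on_moebius_term s sm(2))
    also have "infsum (moebius_term s) ((*) (Suc N) ` smooth_numbers N) = infsum (\<lambda>m. - zeta_term s (Suc N) * moebius_term s m) (smooth_numbers N)"
      unfolding infsum_mult_image[OF zero_less_Suc]
    proof (rule infsum_cong)
      fix m assume "m \<in> smooth_numbers N"
      then have "\<not> Suc N dvd m" using True by (auto simp: smooth_numbers_def)
      then show "moebius_term s (Suc N * m) = - zeta_term s (Suc N) * moebius_term s m"
        unfolding moebius_term_def zeta_term_mult moebius_mu_prime_mult[OF True] by simp
    qed
    also have "\<dots> = - zeta_term s (Suc N) * infsum (moebius_term s) (smooth_numbers N)"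
      by (rule infsum_cmult_right')
    finally show ?thesis using True Suc.IH by (simp add: euler_product_Suc algebra_simps)
  qed (simp add: rough_smooth_Suc_nonprime euler_product_Suc Suc.IH)
qed

text \<open>Apart from 1, every rough number has a prime factor above N and so exceeds N itself. The
  series over rough numbers is thus 1 plus part of a convergent tail.\<close>

lemma euler_product_mult_zeta_tendsto:
  assumes s: "Re s > 1"
  shows "(\<lambda>N. euler_product N s * riemann_zeta s) \<longlonglongrightarrow> 1"
proof -
  have "norm (infsum (zeta_term s) (rough_numbers N) - 1) \<le> (\<Sum>\<^sub>\<infinity>n\<in>{N<..}. real n powr (- Re s))" for N
  proof -
    have eq: "rough_numbers N = insert 1 (rough_numbers N - {1})" by (auto simp: rough_numbers_def)
    have sub: "rough_numbers N - {1} \<subseteq> {N<..}"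
    proof
      fix n assume n: "n \<in> rough_numbers N - {1}"
      then obtain p where p: "prime p" "p dvd n" using prime_factor_nat[of n] by auto
      have "n > 0" "p > N" using n p by (auto simp: rough_numbers_def)
      then show "n \<in> {N<..}" using dvd_imp_le[OF p(2)] by simp
    qed
    have "infsum (zeta_term s) (rough_numbers N) = zeta_term s 1 + infsum (zeta_term s) (rough_numbers N - {1})"
      by (subst eq, rule infsum_insert) (auto intro: summable_on_zeta_term s)
    then show ?thesis using norm_infsum_bounded_mult_zeta_term_le[OF s _ sub, of "\<lambda>_. 1"] by simp
  qed
  then have "(\<lambda>N. infsum (zeta_term s) (rough_numbers N) - 1) \<longlonglongrightarrow> 0"
    by (intro Lim_null_comparison[OF always_eventually infsum_tail_tendsto_0[OF s]]) auto
  then show ?thesis unfolding infsum_rough[OF s] by (simp add: LIM_zero_iff)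
qed

text \<open>All positive numbers up to N are smooth, so the series over the smooth numbers differs
  from the full one by at most a convergent tail.\<close>

lemma euler_product_tendsto_moebius:
  assumes s: "Re s > 1"
  shows "(\<lambda>N. euler_product N s) \<longlonglongrightarrow> infsum (moebius_term s) {0<..}"
proof -
  have "norm (infsum (moebius_term s) (smooth_numbers N) - infsum (moebius_term s) {0<..}) \<le> (\<Sum>\<^sub>\<infinity>n\<in>{N<..}. real n powr (- Re s))" for N
  proof -
    have eq: "{0<..} = smooth_numbers N \<union> ({0<..} - smooth_numbers N)" by (auto simp: smooth_numbers_def)
    have sub: "{0<..} - smooth_numbers N \<subseteq> {N<..}"
    proof
      fix n assume n: "n \<in> {0<..} - smooth_numbers N"
      then obtain p where p: "prime p" "p dvd n" "p > N" "n > 0" by (auto simp: smooth_numbers_def not_le)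
      then show "n \<in> {N<..}" using dvd_imp_le[OF p(2,4)] by simp
    qed
    have "infsum (moebius_term s) {0<..} = infsum (moebius_term s) (smooth_numbers N) + infsum (moebius_term s) ({0<..} - smooth_numbers N)"
      by (subst eq, rule infsum_Un_disjoint) (auto intro: summable_on_moebius_term s)
    then show ?thesis using norm_infsum_bounded_mult_zeta_term_le[OF s _ sub, of "\<lambda>n. of_real (moebius_mu n)"] 
      by (simp add: abs_moebius_mu_le moebius_term_def[symmetric] norm_minus_commute)
  qed
  then have "(\<lambda>N. infsum (moebius_term s) (smooth_numbers N) - infsum (moebius_term s) {0<..}) \<longlonglongrightarrow> 0"
    by (intro Lim_null_comparison[OF always_eventually infsum_tail_tendsto_0[OF s]]) auto
  then show ?thesis unfolding infsum_smooth[OF s] by (simp add: LIM_zero_iff)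
qed

lemma riemann_zeta_moebius:
  assumes s: "Re s > 1"
  shows "riemann_zeta s \<noteq> 0" "infsum (moebius_term s) {0<..} = 1 / riemann_zeta s"
    "(\<lambda>N. euler_product N s) \<longlonglongrightarrow> 1 / riemann_zeta s"
proof -
  have "(\<lambda>N. euler_product N s * riemann_zeta s) \<longlonglongrightarrow> infsum (moebius_term s) {0<..} * riemann_zeta s"
    by (intro tendsto_intros euler_product_tendsto_moebius s)
  then have eq: "infsum (moebius_term s) {0<..} * riemann_zeta s = 1"
    using euler_product_mult_zeta_tendsto[OF s] LIMSEQ_unique by blast
  then show "riemann_zeta s \<noteq> 0" by auto
  with eq show "infsum (moebius_term s) {0<..} = 1 / riemann_zeta s" by (simp add: field_simps)
  then show "(\<lambda>N. euler_product N s) \<longlonglongrightarrow> 1 / riemann_zeta s" using euler_product_tendsto_moebius[OF s] by simp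
qed

lemma moebius_sums:
  assumes s: "Re s > 1"
  shows "(\<lambda>n. moebius_term s (Suc n)) sums (1 / riemann_zeta s)"
proof -
  have bij: "bij_betw Suc UNIV {0::nat<..}"
    by (rule bij_betwI[where g = "\<lambda>n. n - 1"]) auto
  have "((\<lambda>n. moebius_term s (Suc n)) has_sum (1 / riemann_zeta s)) UNIV"
    unfolding has_sum_reindex_bij_betw[OF bij] riemann_zeta_moebius(2)[OF s, symmetric]
    by (intro has_sum_infsum summable_on_moebius_term s)
  then show ?thesis by (rule has_sum_imp_sums)
qed

section \<open>Non-vanishing on the line Re s = 1\<close>

text \<open>Mertens' inequality for one Euler factor. Taking logarithms and expanding, the n-th
  coefficient is -(r^n / n) times 3 + 4 Re v + Re v^2 with v = u^n on the unit circle, and this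
  equals 2 (1 + Re v)^2 >= 0.\<close>

lemma norm_product_341_le_1:
  fixes u :: complex and r :: real
  assumes r: "0 \<le> r" "r < 1" and u: "norm u = 1"
  shows "norm (1 - of_real r :: complex) ^ 3 * norm (1 - of_real r * u) ^ 4 * norm (1 - of_real r * u\<^sup>2) \<le> 1"
proof -
  \<comment> \<open>The term n = 0 is a quotient by 0, hence 0, so the logarithmic series can be
    indexed from 0.\<close>
  have ser: "(\<lambda>n. Re (- (z ^ n / of_nat n))) sums ln (norm (1 - z))" and pos: "norm (1 - z) > 0" if z: "norm z < 1" for z :: complex
  proof -
    have "(\<lambda>n. (- 1) ^ Suc n / of_nat n * (- z) ^ n) sums ln (1 + (- z))"
      by (rule Ln_series) (use z in simp)
    moreover have "(- 1) ^ Suc n / of_nat n * (- z) ^ n = - (z ^ n / of_nat n)" for n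
    proof -
      have "(- 1) ^ Suc n / of_nat n * ((- 1) ^ n * z ^ n) = - ((- 1) ^ n * (- 1) ^ n) * (z ^ n / of_nat n)" by simp
      also have "(- 1) ^ n * (- 1) ^ n = (1::complex)" by (simp flip: power_mult_distrib)
      finally show ?thesis unfolding power_minus[of z] by simp
    qed
    ultimately have "(\<lambda>n. - (z ^ n / of_nat n)) sums ln (1 + (- z))" by (simp only:)
    then have "(\<lambda>n. - (z ^ n / of_nat n)) sums ln (1 - z)" by simp
    then have "(\<lambda>n. Re (- (z ^ n / of_nat n))) sums Re (ln (1 - z))" by (rule sums_Re)
    moreover have nz: "1 - z \<noteq> 0" using z by auto
    ultimately show "(\<lambda>n. Re (- (z ^ n / of_nat n))) sums ln (norm (1 - z))" by (simp add: Re_Ln)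
    show "norm (1 - z) > 0" using nz by simp
  qed
  define z0 z1 z2 where "z0 = complex_of_real r" and "z1 = of_real r * u" and "z2 = of_real r * u\<^sup>2"
  have lt: "norm z0 < 1" "norm z1 < 1" "norm z2 < 1" using r u by (auto simp: z0_def z1_def z2_def norm_mult norm_power)
  have S: "(\<lambda>n. 3 * Re (- (z0 ^ n / of_nat n)) + 4 * Re (- (z1 ^ n / of_nat n)) + Re (- (z2 ^ n / of_nat n))) sums
     (3 * ln (norm (1 - z0)) + 4 * ln (norm (1 - z1)) + ln (norm (1 - z2)))"
    by (intro sums_add sums_mult ser lt)
  have T: "3 * Re (- (z0 ^ n / of_nat n)) + 4 * Re (- (z1 ^ n / of_nat n)) + Re (- (z2 ^ n / of_nat n)) \<le> 0" for n
  proof -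
    define v where "v = u ^ n"
    have v: "(Re v)\<^sup>2 + (Im v)\<^sup>2 = 1" using u by (simp add: v_def norm_power cmod_power2[symmetric])
    have "z0 ^ n = of_real (r ^ n)" "z1 ^ n = of_real (r ^ n) * v" "z2 ^ n = of_real (r ^ n) * v\<^sup>2"
      by (simp_all add: z0_def z1_def z2_def v_def power_mult_distrib power_mult[symmetric] mult.commute)
    moreover have "Re (- (of_real a * w / of_nat n)) = - (a / real n) * Re w" for a w by simp
    moreover have "Re (v\<^sup>2) = (Re v)\<^sup>2 - (Im v)\<^sup>2" by (simp add: power2_eq_square)
    moreover have "Re (- (of_real (r ^ n) / of_nat n)) = - (r ^ n / real n)" by (simp flip: of_real_power)
    ultimately have "3 * Re (- (z0 ^ n / of_nat n)) + 4 * Re (- (z1 ^ n / of_nat n)) + Re (- (z2 ^ n / of_nat n))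
      = 3 * (- (r ^ n / real n)) + 4 * (- (r ^ n / real n) * Re v) + - (r ^ n / real n) * ((Re v)\<^sup>2 - (Im v)\<^sup>2)"
      by (simp only:)
    also have "\<dots> = - (r ^ n / real n) * (3 + 4 * Re v + ((Re v)\<^sup>2 - (Im v)\<^sup>2))"
    proof -
      have "3 * a + 4 * (a * c) + a * d = a * (3 + 4 * c + d)" for a c d :: real by (simp add: algebra_simps)
      then show ?thesis .
    qed
    also have "3 + 4 * Re v + ((Re v)\<^sup>2 - (Im v)\<^sup>2) = 2 * (1 + Re v)\<^sup>2"
      using v by (simp add: power2_eq_square algebra_simps)
    also have "- (r ^ n / real n) * (2 * (1 + Re v)\<^sup>2) \<le> 0" using r by (intro mult_nonpos_nonneg) auto
    finally show ?thesis .
  qed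
  have "3 * ln (norm (1 - z0)) + 4 * ln (norm (1 - z1)) + ln (norm (1 - z2)) \<le> 0"
    by (rule sums_le[OF T S sums_zero])
  moreover have "a ^ 3 * b ^ 4 * c \<le> 1" if "3 * ln a + 4 * ln b + ln c \<le> 0" "a > 0" "b > 0" "c > 0" for a b c :: real
  proof -
    have "ln (a ^ 3 * b ^ 4 * c) = 3 * ln a + 4 * ln b + ln c" using that by (simp add: ln_mult ln_realpow)
    then show ?thesis using that by (subst ln_le_zero_iff[symmetric]) (auto intro!: mult_pos_pos)
  qed
  ultimately show ?thesis using pos[OF lt(1)] pos[OF lt(2)] pos[OF lt(3)] unfolding z0_def z1_def z2_def by blast
qed

lemma zeta_term_add: "n > 0 \<Longrightarrow> zeta_term (s + t) n = zeta_term s n * zeta_term t n"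
  by (simp add: zeta_term_def powr_add)

text \<open>Each prime contributes a factor at most 1, with r = p^(-\<sigma>) and u = p^(-i t).
  Hence the partial products for 1/zeta obey the bound, the limit keeps it, and taking reciprocals
  reverses it.\<close>

lemma riemann_zeta_341:
  fixes \<sigma> t :: real
  assumes \<sigma>: "\<sigma> > 1"
  shows "1 \<le> norm (riemann_zeta \<sigma>) ^ 3 * norm (riemann_zeta (\<sigma> + \<i> * t)) ^ 4 * norm (riemann_zeta (\<sigma> + 2 * (\<i> * t)))"
proof -
  let ?E = "\<lambda>N s. norm (euler_product N s)"
  have fac: "norm (1 - zeta_term \<sigma> p) ^ 3 * norm (1 - zeta_term (\<sigma> + \<i> * t) p) ^ 4 * norm (1 - zeta_term (\<sigma> + 2 * (\<i> * t)) p) \<le> 1"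
    if p: "prime p" for p
  proof -
    have p0: "p > 1" using p by (rule prime_gt_1_nat)
    define u where "u = zeta_term (\<i> * t) p"
    define r where "r = real p powr (- \<sigma>)"
    have r: "0 \<le> r" "r < 1" using p0 \<sigma> by (auto simp: r_def powr_less_one)
    have "of_nat p powr complex_of_real \<sigma> = of_real (real p powr \<sigma>)" using powr_of_real[of "real p" \<sigma>] by simp
    then have "zeta_term \<sigma> p = of_real r" by (simp add: zeta_term_def r_def powr_minus divide_inverse)
    moreover have "zeta_term (\<sigma> + \<i> * t) p = zeta_term \<sigma> p * u" "zeta_term (\<sigma> + 2 * (\<i> * t)) p = zeta_term \<sigma> p * u\<^sup>2"
    proof -
      have p1: "p > 0" using p0 by simp
      have "zeta_term (2 * (\<i> * t)) p = u\<^sup>2"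
        unfolding u_def mult_2 power2_eq_square by (rule zeta_term_add[OF p1])
      then show "zeta_term (\<sigma> + 2 * (\<i> * t)) p = zeta_term \<sigma> p * u\<^sup>2" unfolding zeta_term_add[OF p1] by (simp only:)
      show "zeta_term (\<sigma> + \<i> * t) p = zeta_term \<sigma> p * u" unfolding u_def by (rule zeta_term_add[OF p1])
    qed
    moreover have "norm u = 1" using p0 by (simp add: u_def norm_zeta_term)
    ultimately show ?thesis using norm_product_341_le_1[OF r, of u] by simp
  qed
  have le1: "?E N \<sigma> ^ 3 * ?E N (\<sigma> + \<i> * t) ^ 4 * ?E N (\<sigma> + 2 * (\<i> * t)) \<le> 1" for N
    unfolding euler_product_def prod_norm[symmetric] prod_power_distrib prod.distrib[symmetric]
    by (rule prod_le_1) (use fac in auto)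
  have lim: "(\<lambda>N. ?E N \<sigma> ^ 3 * ?E N (\<sigma> + \<i> * t) ^ 4 * ?E N (\<sigma> + 2 * (\<i> * t))) \<longlonglongrightarrow>
    norm (1 / riemann_zeta \<sigma>) ^ 3 * norm (1 / riemann_zeta (\<sigma> + \<i> * t)) ^ 4 * norm (1 / riemann_zeta (\<sigma> + 2 * (\<i> * t)))"
    by (intro tendsto_intros riemann_zeta_moebius(3)) (use \<sigma> in auto)
  have "norm (1 / riemann_zeta \<sigma>) ^ 3 * norm (1 / riemann_zeta (\<sigma> + \<i> * t)) ^ 4 * norm (1 / riemann_zeta (\<sigma> + 2 * (\<i> * t))) \<le> 1"
    by (rule LIMSEQ_le_const2[OF lim]) (use le1 in blast)
  moreover have "norm (riemann_zeta \<sigma>) > 0" "norm (riemann_zeta (\<sigma> + \<i> * t)) > 0" "norm (riemann_zeta (\<sigma> + 2 * (\<i> * t))) > 0"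
    unfolding zero_less_norm_iff using \<sigma> by (intro riemann_zeta_moebius(1); simp)+
  moreover have "1 \<le> a ^ 3 * b ^ 4 * c" if "(1 / a) ^ 3 * (1 / b) ^ 4 * (1 / c) \<le> 1" "a > 0" "b > 0" "c > 0" for a b c :: real
  proof -
    have "a ^ 3 * b ^ 4 * c > 0" using that by simp
    moreover have "(1 / a) ^ 3 * (1 / b) ^ 4 * (1 / c) = 1 / (a ^ 3 * b ^ 4 * c)" by (simp add: power_divide)
    ultimately show ?thesis using that(1) by (simp add: pos_divide_le_eq)
  qed
  ultimately show ?thesis unfolding norm_divide norm_one by blast
qed

text \<open>The function (s - 1) zeta(s), with the factor s - 1 already multiplied into the theta
  formula. Being an explicit entire expression, it has its proper value at 1 without a
  limit.\<close>

definition zeta_entire :: "complex \<Rightarrow> complex" where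
  "zeta_entire s = of_real pi powr (s / 2) *
     (rGamma (s / 2) * ((s - 1) * completed_zeta_sym s + 1) - (s - 1) * (rGamma (s / 2 + 1) / 2))"

lemma holomorphic_zeta_entire: "zeta_entire holomorphic_on A"
proof -
  have "completed_zeta_sym holomorphic_on A"
    unfolding completed_zeta_sym_def
    by (intro holomorphic_intros holomorphic_on_compose_gen[OF _ holomorphic_Mellin_theta, unfolded o_def]) auto
  then show ?thesis unfolding zeta_entire_def by (intro holomorphic_intros) auto
qed

lemma zeta_entire_eq:
  assumes "s \<noteq> 1"
  shows "zeta_entire s = (s - 1) * riemann_zeta s"
proof -
  have 1: "riemann_zeta s = zeta_by_theta s"
    by (rule is_zeta_continuation_unique[OF is_zeta_continuation_riemann_zeta is_zeta_continuation_zeta_by_theta assms])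
  have 2: "(s - 1) * (1 / (s - 1)) = 1" using assms by simp
  have 3: "(s - 1) * (p * (r * (c + e) - q)) = p * (r * ((s - 1) * c + (s - 1) * e) - (s - 1) * q)" for p r c q e
    by (simp add: algebra_simps)
  show ?thesis unfolding 1 zeta_by_theta_def zeta_entire_def 3 2 by (rule refl)
qed

text \<open>The residue of zeta at 1: pi^(1/2) cancels against 1/Gamma(1/2).\<close>

lemma zeta_entire_1: "zeta_entire 1 = 1"
proof -
  have 1: "complex_of_real pi powr (1 / 2) = of_real (sqrt pi)"
    by (simp add: powr_half_sqrt[symmetric] powr_of_real[symmetric])
  have 2: "rGamma (1 / 2) = inverse (complex_of_real (sqrt pi))"
    unfolding rGamma_inverse_Gamma Gamma_one_half_complex by (rule refl)
  have "x * (inverse x * ((1 - 1) * c + 1) - (1 - 1) * q) = 1" if "x \<noteq> 0" for x c q :: complex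
    using that by simp
  moreover have "complex_of_real (sqrt pi) \<noteq> 0" by simp
  ultimately show ?thesis unfolding zeta_entire_def 1 2 by blast
qed

lemma zeta_entire_nonzero_iff: "zeta_entire s \<noteq> 0 \<longleftrightarrow> s = 1 \<or> riemann_zeta s \<noteq> 0"
  using zeta_entire_1 zeta_entire_eq[of s] by (cases "s = 1") auto

text \<open>At distance x to the right of the line the pole costs x^(-3) in the 3-4-1 product, while
  a zero at 1 + i t would gain x^4. The product would be of order x, against the lower bound
  1.\<close>

lemma riemann_zeta_nonzero_Re_1:
  assumes t: "t \<noteq> (0::real)"
  shows "riemann_zeta (1 + \<i> * t) \<noteq> 0"
proof
  assume zero: "riemann_zeta (1 + \<i> * t) = 0"
  define x where "x = (\<lambda>n::nat. 1 / real (Suc n))"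
  have x: "x n > 0" for n by (simp add: x_def)
  have x0: "x \<longlonglongrightarrow> 0" unfolding x_def by (rule LIMSEQ_Suc[OF lim_1_over_n])
  have cx: "(\<lambda>n. complex_of_real (1 + x n)) \<longlonglongrightarrow> 1" using tendsto_add[OF tendsto_const[of 1] x0] tendsto_of_real[of "\<lambda>n. 1 + x n" 1] by fastforce
  have hol: "isCont riemann_zeta z" if "z \<noteq> 1" for z
    using holomorphic_riemann_zeta that
    by (metis Compl_iff continuous_on_eq_continuous_at holomorphic_on_imp_continuous_on open_Compl closed_singleton singletonD)
  have "\<exists>D. (riemann_zeta has_field_derivative D) (at (1 + \<i> * t))"
    using holomorphic_derivI[OF holomorphic_riemann_zeta, of "1 + \<i> * t"] t by (auto simp: open_Compl)
  then obtain D where "(riemann_zeta has_field_derivative D) (at (1 + \<i> * t))" by blast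
  then have D: "((\<lambda>y. (riemann_zeta y - riemann_zeta (1 + \<i> * t)) / (y - (1 + \<i> * t))) \<longlongrightarrow> D) (at (1 + \<i> * t))"
    by (simp add: has_field_derivative_iff)
  have "filterlim (\<lambda>n. complex_of_real (1 + x n) + \<i> * t) (at (1 + \<i> * t)) sequentially"
    unfolding filterlim_at using x
    by (intro conjI always_eventually tendsto_add cx tendsto_const) (auto simp: less_imp_neq[symmetric])
  from filterlim_compose[OF D this]
  have lim1: "(\<lambda>n. riemann_zeta (complex_of_real (1 + x n) + \<i> * t) / x n) \<longlonglongrightarrow> D"
    by (simp add: zero)
  have lim2: "(\<lambda>n. zeta_entire (complex_of_real (1 + x n))) \<longlonglongrightarrow> 1"
    using isCont_tendsto_compose[OF _ cx, of zeta_entire] holomorphic_zeta_entire[of UNIV] zeta_entire_1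
    by (metis continuous_on_eq_continuous_at holomorphic_on_imp_continuous_on open_UNIV UNIV_I)
  have lim3: "(\<lambda>n. riemann_zeta (complex_of_real (1 + x n) + 2 * (\<i> * t))) \<longlonglongrightarrow> riemann_zeta (1 + 2 * (\<i> * t))"
    by (rule isCont_tendsto_compose[OF hol tendsto_add[OF cx tendsto_const]]) (use t in auto)
  have "(\<lambda>n. norm (zeta_entire (complex_of_real (1 + x n))) ^ 3 * norm (riemann_zeta (complex_of_real (1 + x n) + \<i> * t) / x n) ^ 4
      * norm (riemann_zeta (complex_of_real (1 + x n) + 2 * (\<i> * t))) * x n) \<longlonglongrightarrow> norm (1::complex) ^ 3 * norm D ^ 4 * norm (riemann_zeta (1 + 2 * (\<i> * t))) * 0"
    by (intro tendsto_intros lim1 lim2 lim3 x0)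
  moreover have "norm (zeta_entire (complex_of_real (1 + x n))) ^ 3 * norm (riemann_zeta (complex_of_real (1 + x n) + \<i> * t) / x n) ^ 4
      * norm (riemann_zeta (complex_of_real (1 + x n) + 2 * (\<i> * t))) * x n \<ge> 1" for n
  proof -
    have "zeta_entire (complex_of_real (1 + x n)) = x n * riemann_zeta (complex_of_real (1 + x n))"
      using x[of n] by (subst zeta_entire_eq) auto
    then have "norm (zeta_entire (complex_of_real (1 + x n))) = x n * norm (riemann_zeta (complex_of_real (1 + x n)))"
      using x[of n] by (simp only: norm_mult norm_of_real abs_of_pos)
    then have Q: "norm (zeta_entire (complex_of_real (1 + x n))) ^ 3 * norm (riemann_zeta (complex_of_real (1 + x n) + \<i> * t) / x n) ^ 4
      * norm (riemann_zeta (complex_of_real (1 + x n) + 2 * (\<i> * t))) * x n = 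
      norm (riemann_zeta (complex_of_real (1 + x n))) ^ 3 * norm (riemann_zeta (complex_of_real (1 + x n) + \<i> * t)) ^ 4 * norm (riemann_zeta (complex_of_real (1 + x n) + 2 * (\<i> * t)))"
      using x[of n] by (simp add: norm_divide power_divide power_mult_distrib eval_nat_numeral)
    show ?thesis unfolding Q by (rule riemann_zeta_341) (use x[of n] in simp)
  qed
  ultimately have "(1::real) \<le> norm (1::complex) ^ 3 * norm D ^ 4 * norm (riemann_zeta (1 + 2 * (\<i> * t))) * 0"
    by (intro LIMSEQ_le_const) auto
  then show False by simp
qed

lemma zeta_entire_nonzero:
  assumes "Re s \<ge> 1"
  shows "zeta_entire s \<noteq> 0"
proof (cases "Re s > 1 \<or> s = 1")
  case True
  then show ?thesis using riemann_zeta_moebius(1) zeta_entire_nonzero_iff by blast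
next
  case False
  then have "s = 1 + \<i> * of_real (Im s)" "Im s \<noteq> 0" using assms by (auto simp: complex_eq_iff)
  then show ?thesis using riemann_zeta_nonzero_Re_1[of "Im s"] zeta_entire_nonzero_iff by metis
qed

section \<open>Polynomial growth of zeta\<close>

text \<open>With m = n + 1, this is m^(-s) minus the integral of u^(-s) from m to m + 1, in closed
  form. Such differences are smaller by a power of m than the terms themselves, so their series
  converges as far as Re s > 0.\<close>

definition zeta_diff_term :: "complex \<Rightarrow> nat \<Rightarrow> complex" where
  "zeta_diff_term s n = of_nat (Suc n) powr (- s) -
     (of_nat (Suc (Suc n)) powr (1 - s) - of_nat (Suc n) powr (1 - s)) / (1 - s)"

text \<open>Two mean value estimates on the real segment from m to m + 1: first for w^(-s), whose
  derivative brings the factor \<open>norm s\<close>, then for the primitive \<open>F\<close> of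
  m^(-s) - w^(-s). That factor is the source of the linear growth bound for zeta.\<close>

lemma norm_zeta_diff_term_le:
  assumes s: "Re s > 0" "s \<noteq> 1"
  shows "norm (zeta_diff_term s n) \<le> norm s * real (Suc n) powr (- Re s - 1)"
proof -
  define m where "m = real (Suc n)"
  have m: "m > 0" by (simp add: m_def)
  define S where "S = complex_of_real ` {m..m + 1}"
  have convS: "convex S" unfolding S_def
    by (rule convex_linear_image) (auto simp: linear_iff scaleR_conv_of_real)
  have SD: "\<exists>x. z = of_real x \<and> m \<le> x \<and> x \<le> m + 1" if "z \<in> S" for z using that by (auto simp: S_def)
  have Sm: "of_real m \<in> S" "of_real (m + 1) \<in> S" by (auto simp: S_def simp del: of_real_add)
  have inner: "norm (z powr (- s) - of_real m powr (- s)) \<le> norm s * m powr (- Re s - 1)" if z: "z \<in> S" for z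
  proof -
    have "norm (z powr (- s) - of_real m powr (- s)) \<le> (norm s * m powr (- Re s - 1)) * norm (z - of_real m)"
    proof (rule field_differentiable_bound[OF convS _ _ z Sm(1)])
      fix w assume "w \<in> S"
      then obtain x where x: "w = of_real x" "m \<le> x" using SD by blast
      then show "((\<lambda>w. w powr (- s)) has_field_derivative (- s * w powr (- s - 1))) (at w within S)"
        using m by (auto intro!: derivative_eq_intros simp: complex_nonpos_Reals_iff)
      have "norm (- s * w powr (- s - 1)) = norm s * x powr (- Re s - 1)"
        using x m by (simp add: norm_mult norm_of_real_powr)
      also have "\<dots> \<le> norm s * m powr (- Re s - 1)"
        using x m s by (intro mult_left_mono powr_mono2') auto
      finally show "norm (- s * w powr (- s - 1)) \<le> norm s * m powr (- Re s - 1)" .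
    qed
    also have "norm (z - of_real m) \<le> 1"
    proof -
      obtain x where x: "z = of_real x" "m \<le> x" "x \<le> m + 1" using SD z by blast
      then show ?thesis by (simp flip: of_real_diff)
    qed
    finally show ?thesis by (simp add: mult_left_mono)
  qed
  define F where "F = (\<lambda>z. z * of_real m powr (- s) - z powr (1 - s) / (1 - s))"
  have "norm (F (of_real (m + 1)) - F (of_real m)) \<le> (norm s * m powr (- Re s - 1)) * norm (complex_of_real (m + 1) - of_real m)"
  proof (rule field_differentiable_bound[OF convS _ _ Sm(2) Sm(1)])
    fix w assume w: "w \<in> S"
    then obtain x where x: "w = of_real x" "m \<le> x" using SD by blast
    have "((\<lambda>w. w powr (1 - s) / (1 - s)) has_field_derivative w powr (- s)) (at w within S)"
      using m s x by (auto intro!: derivative_eq_intros simp: complex_nonpos_Reals_iff)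
    moreover have "((\<lambda>w. w * of_real m powr (- s)) has_field_derivative of_real m powr (- s)) (at w within S)"
      by (auto intro!: derivative_eq_intros)
    ultimately show "(F has_field_derivative (of_real m powr (- s) - w powr (- s))) (at w within S)"
      unfolding F_def by (intro DERIV_diff)
    show "norm (of_real m powr (- s) - w powr (- s)) \<le> norm s * m powr (- Re s - 1)"
      using inner[OF w] by (simp add: norm_minus_commute)
  qed
  also have "F (of_real (m + 1)) - F (of_real m) = zeta_diff_term s n"
    by (simp add: F_def zeta_diff_term_def m_def algebra_simps diff_divide_distrib)
  finally show ?thesis by (simp add: m_def)
qed

lemma summable_Suc_powr: "c > 0 \<Longrightarrow> summable (\<lambda>n. real (Suc n) powr (- c - 1))"
  by (subst summable_Suc_iff[of "\<lambda>n. real n powr (- c - 1)"]) (simp add: summable_real_powr_iff)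

text \<open>For Re s > 1 the subtracted integrals telescope to 1/(s - 1). Both sides are holomorphic
  on the right half plane without 1, which is connected, so the identity extends.\<close>

lemma riemann_zeta_eq_zeta_diff:
  assumes s: "Re s > 0" "s \<noteq> 1"
  shows "riemann_zeta s = 1 / (s - 1) + (\<Sum>n. zeta_diff_term s n)"
proof -
  define U where "U = {s. Re s > 0} - {1::complex}"
  have openU: "open U" unfolding U_def by (intro open_delete open_halfspace_Re_gt)
  have holD: "(\<lambda>s. \<Sum>n. zeta_diff_term s n) holomorphic_on U"
  proof (rule holomorphic_uniform_sequence[OF openU])
    show "(\<lambda>s. \<Sum>n<N. zeta_diff_term s n) holomorphic_on U" for N
      unfolding zeta_diff_term_def U_def
      by (intro holomorphic_intros) (auto simp: complex_nonpos_Reals_iff)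
    fix s assume "s \<in> U"
    then obtain d where d: "d > 0" "cball s d \<subseteq> U" using openU open_contains_cball by blast
    \<comment> \<open>The smallest real part on the closed disc. It is positive because the leftmost
      point s - d still lies in \<open>U\<close>.\<close>
    define \<rho> where "\<rho> = Re s - d"
    have "s - of_real d \<in> cball s d" using d by (simp add: dist_norm)
    then have "s - of_real d \<in> U" using d(2) by blast
    then have \<rho>: "\<rho> > 0" by (simp add: U_def \<rho>_def)
    have "uniform_limit (cball s d) (\<lambda>N s. \<Sum>n<N. zeta_diff_term s n) (\<lambda>s. \<Sum>n. zeta_diff_term s n) sequentially"
    proof (rule Weierstrass_m_test[where M = "\<lambda>n. (norm s + d) * real (Suc n) powr (- \<rho> - 1)"])
      fix n z assume z: "z \<in> cball s d"
      then have zU: "Re z > 0" "z \<noteq> 1" using d by (auto simp: U_def)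
      have "norm (z - s) \<le> d" using z by (simp add: dist_norm norm_minus_commute)
      then have "norm z \<le> norm s + d" "\<rho> \<le> Re z"
        using norm_triangle_sub[of z s] abs_Re_le_cmod[of "z - s"] by (auto simp: \<rho>_def)
      then have "norm z * real (Suc n) powr (- Re z - 1) \<le> (norm s + d) * real (Suc n) powr (- \<rho> - 1)"
        using d(1) by (intro mult_mono powr_mono) (auto intro: add_nonneg_nonneg)
      then show "norm (zeta_diff_term z n) \<le> (norm s + d) * real (Suc n) powr (- \<rho> - 1)"
        using norm_zeta_diff_term_le[OF zU, of n] by linarith
    qed (intro summable_mult summable_Suc_powr \<rho>)
    then show "\<exists>d>0. cball s d \<subseteq> U \<and> uniform_limit (cball s d) (\<lambda>N s. \<Sum>n<N. zeta_diff_term s n) (\<lambda>s. \<Sum>n. zeta_diff_term s n) sequentially"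
      using d by blast
  qed
  show ?thesis
  proof (rule analytic_continuation_open[where s = "{s. Re s > 1}" and s' = U and f = riemann_zeta and g = "\<lambda>s. 1 / (s - 1) + (\<Sum>n. zeta_diff_term s n)"])
    show "open {s. Re s > 1}" by (rule open_halfspace_Re_gt)
    show "open U" by (rule openU)
    have "(2 :: complex) \<in> {s. Re s > 1}" by simp
    then show "{s. Re s > 1} \<noteq> {}" by blast
    show "connected U" unfolding U_def
      by (intro connected_open_delete open_halfspace_Re_gt convex_connected convex_halfspace_Re_gt) simp
    show "riemann_zeta holomorphic_on U" by (rule holomorphic_on_subset[OF holomorphic_riemann_zeta]) (auto simp: U_def)
    show "(\<lambda>s. 1 / (s - 1) + (\<Sum>n. zeta_diff_term s n)) holomorphic_on U"
      by (intro holomorphic_intros holD) (auto simp: U_def)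
    show "{s. Re s > 1} \<subseteq> U" by (auto simp: U_def)
    show "s \<in> U" using s by (auto simp: U_def)
    fix s assume "s \<in> {s. Re s > 1}"
    then have s: "Re s > 1" by simp
    then have s1: "s \<noteq> 1" by auto
    have "(\<lambda>n. complex_of_nat (Suc n) powr (1 - s)) \<longlonglongrightarrow> 0"
    proof (rule Lim_null_comparison)
      show "\<forall>\<^sub>F n in sequentially. norm (complex_of_nat (Suc n) powr (1 - s)) \<le> real (Suc n) powr (1 - Re s)"
        using norm_of_real_powr[of "real (Suc _)" "1 - s"] by (intro always_eventually) (simp del: of_nat_Suc)
      show "(\<lambda>n. real (Suc n) powr (1 - Re s)) \<longlonglongrightarrow> 0" using s by real_asymp
    qed
    then have "(\<lambda>n. complex_of_nat (Suc (Suc n)) powr (1 - s) - complex_of_nat (Suc n) powr (1 - s)) sums (0 - complex_of_nat (Suc 0) powr (1 - s))"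
      by (rule telescope_sums)
    then have "(\<lambda>n. (complex_of_nat (Suc (Suc n)) powr (1 - s) - complex_of_nat (Suc n) powr (1 - s)) / (1 - s)) sums ((0 - complex_of_nat (Suc 0) powr (1 - s)) / (1 - s))"
      by (rule sums_divide)
    from sums_diff[OF riemann_zeta_sums[OF s] this]
    have "(\<lambda>n. zeta_diff_term s n) sums (riemann_zeta s - (0 - complex_of_nat (Suc 0) powr (1 - s)) / (1 - s))"
      unfolding zeta_diff_term_def powr_minus[of _ s] inverse_eq_divide .
    then have "(\<Sum>n. zeta_diff_term s n) = riemann_zeta s - (0 - complex_of_nat (Suc 0) powr (1 - s)) / (1 - s)"
      by (rule sums_unique[symmetric])
    also have "(0 - complex_of_nat (Suc 0) powr (1 - s)) / (1 - s) = 1 / (s - 1)"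
    proof -
      have "1 / (s - 1) = - (1 / (1 - s))" using divide_minus_right[of 1 "1 - s"] by (simp only: minus_diff_eq)
      moreover have "(0 - complex_of_nat (Suc 0) powr (1 - s)) / (1 - s) = - (1 / (1 - s))" by simp
      ultimately show ?thesis by (simp only:)
    qed
    finally show "riemann_zeta s = 1 / (s - 1) + (\<Sum>n. zeta_diff_term s n)" by simp
  qed
qed

text \<open>The abscissa 1/4 lies to the left of all discs on which the growth is used later, which
  stay in Re z > 1/2. Heights of modulus at least 1 keep the polar term 1/(s - 1) below 1.\<close>

lemma riemann_zeta_growth:
  "\<exists>C>0. \<forall>s. Re s \<ge> 1/4 \<longrightarrow> \<bar>Im s\<bar> \<ge> 1 \<longrightarrow> norm (riemann_zeta s) \<le> C * norm s"
proof -
  define A where "A = (\<Sum>n. real (Suc n) powr (- (1/4) - 1))"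
  have sumA: "summable (\<lambda>n. real (Suc n) powr (- (1/4) - 1))" by (rule summable_Suc_powr) simp
  have A: "A \<ge> 0" unfolding A_def by (intro suminf_nonneg sumA) auto
  have "norm (riemann_zeta s) \<le> (1 + A) * norm s" if s: "Re s \<ge> 1/4" "\<bar>Im s\<bar> \<ge> 1" for s
  proof -
    have s': "Re s > 0" "s \<noteq> 1" using s by auto
    have n1: "norm s \<ge> 1" "norm (s - 1) \<ge> 1" using s abs_Im_le_cmod[of s] abs_Im_le_cmod[of "s - 1"] by auto
    have trm: "norm (zeta_diff_term s n) \<le> norm s * real (Suc n) powr (- (1/4) - 1)" for n
      using norm_zeta_diff_term_le[OF s', of n] mult_left_mono[OF powr_mono[of "- Re s - 1" "- (1/4) - 1" "real (Suc n)"], of "norm s"] s(1)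
      by simp
    have "norm (\<Sum>n. zeta_diff_term s n) \<le> (\<Sum>n. norm s * real (Suc n) powr (- (1/4) - 1))"
      by (rule norm_suminf_le[OF trm]) (intro summable_mult sumA)
    also have "\<dots> = norm s * A" unfolding A_def by (rule suminf_mult[OF sumA])
    finally have "norm (riemann_zeta s) \<le> norm (1 / (s - 1)) + norm s * A"
      unfolding riemann_zeta_eq_zeta_diff[OF s'] using norm_triangle_ineq[of "1 / (s - 1)" "\<Sum>n. zeta_diff_term s n"] by linarith
    also have "norm (1 / (s - 1)) \<le> norm s" 
    proof -
      have "norm (1 / (s - 1)) \<le> 1" unfolding norm_divide norm_one using n1(2) by (subst divide_le_eq_1_pos) linarith+
      then show ?thesis using n1(1) by linarith
    qed
    finally show ?thesis by (simp add: algebra_simps)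
  qed
  then show ?thesis using A by (intro exI[of _ "1 + A"]) auto
qed

section \<open>Convergence of the series of the Moebius function over n\<close>

text \<open>Recentred at s = 1, so that Newman's contour is a circle about z = 0 and the sum of
  mu(n)/n for n up to N is the value at 0.\<close>

definition moebius_partial :: "nat \<Rightarrow> complex \<Rightarrow> complex" where
  "moebius_partial N z = (\<Sum>n<N. moebius_term (1 + z) (Suc n))"

lemma moebius_term_shift: "moebius_term (1 + z) (Suc n) = of_real (moebius_mu (Suc n)) * of_nat (Suc n) powr (- 1 - z)"
proof -
  have "1 / of_nat (Suc n) powr (1 + z) = of_nat (Suc n) powr (- (1 + z))" by (simp only: powr_minus inverse_eq_divide)
  then show ?thesis by (simp add: moebius_term_def zeta_term_def)
qed

lemma norm_moebius_term_le: "norm (moebius_term (1 + z) n) \<le> real n powr (- 1 - Re z)"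
  using mult_right_mono[OF abs_moebius_mu_le, of "real n powr (- 1 - Re z)" n] 
  by (simp add: moebius_term_def norm_mult norm_zeta_term)

section \<open>Comparison of sums of powers with integrals\<close>

lemma powr_mean_value:
  assumes "0 < a" "a < (b::real)"
  shows "\<exists>c. a < c \<and> c < b \<and> b powr e - a powr e = (b - a) * (e * c powr (e - 1))"
  by (rule MVT2[OF assms(2)]) (use assms in \<open>auto intro!: derivative_eq_intros\<close>)

lemma suminf_powr_tail_le:
  assumes x: "x > 0" and N: "N \<ge> 1"
  shows "summable (\<lambda>n. real (Suc (n + N)) powr (- 1 - x))" "(\<Sum>n. real (Suc (n + N)) powr (- 1 - x)) \<le> real N powr (- x) / x"
proof -
  show sm: "summable (\<lambda>n. real (Suc (n + N)) powr (- 1 - x))"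
    using x summable_iff_shift[of "\<lambda>n. real n powr (- 1 - x)" "Suc N"] by (simp add: summable_real_powr_iff)
  have le: "real (Suc (n + N)) powr (- 1 - x) \<le> (real (n + N) powr (- x) - real (Suc n + N) powr (- x)) / x" for n
  proof -
    obtain c where c: "real (n + N) < c" "c < real (n + N) + 1" "(real (n + N) + 1) powr (- x) - real (n + N) powr (- x) = (- x) * c powr (- x - 1)"
      using powr_mean_value[of "real (n + N)" "real (n + N) + 1" "- x"] N by auto
    have "real (Suc (n + N)) powr (- 1 - x) \<le> c powr (- 1 - x)" using c N x by (intro powr_mono2') auto
    also have "\<dots> = (real (n + N) powr (- x) - real (Suc n + N) powr (- x)) / x"
    proof -
      have "- x - 1 = - 1 - x" by simp
      with c(3) have "(real (n + N) + 1) powr (- x) - real (n + N) powr (- x) = (- x) * c powr (- 1 - x)" by (simp only:)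
      then show ?thesis using x by (simp add: field_simps)
    qed
    finally show ?thesis .
  qed
  have "(\<lambda>n. real (n + N) powr (- x)) \<longlonglongrightarrow> 0" using x by real_asymp
  from sums_divide[OF telescope_sums'[OF this], of x]
  have "(\<lambda>n. (real (n + N) powr (- x) - real (Suc n + N) powr (- x)) / x) sums ((real (0 + N) powr (- x) - 0) / x)" .
  from sums_le[OF le summable_sums[OF sm] this]
  show "(\<Sum>n. real (Suc (n + N)) powr (- 1 - x)) \<le> real N powr (- x) / x" by simp
qed

text \<open>For y <= 1 the summand decreases and each term is at most the integral over the unit
  interval before it. For y > 1 it increases and is compared with the interval after it, which
  leaves the last term, the additional N^(y - 1), on its own.\<close>

lemma sum_powr_le:
  assumes y: "y > 0" and N: "N \<ge> 1"
  shows "(\<Sum>n<N. real (Suc n) powr (y - 1)) \<le> real N powr y / y + real N powr (y - 1)"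
proof (cases "y \<le> 1")
  case True
  have le: "real (Suc n) powr (y - 1) \<le> (real (Suc n) powr y - real n powr y) / y" for n
  proof (cases "n = 0")
    case False
    then obtain c where c: "real n < c" "c < real n + 1" "(real n + 1) powr y - real n powr y = y * c powr (y - 1)"
      using powr_mean_value[of "real n" "real n + 1" y] by auto
    have "real (Suc n) powr (y - 1) \<le> c powr (y - 1)" using c False True by (intro powr_mono2') auto
    also have "\<dots> = (real (Suc n) powr y - real n powr y) / y" using c(3) y by (simp add: field_simps)
    finally show ?thesis .
  qed (use True y in \<open>simp add: field_simps\<close>)
  have "(\<Sum>n<N. real (Suc n) powr (y - 1)) \<le> (\<Sum>n<N. (real (Suc n) powr y - real n powr y) / y)"
    by (rule sum_mono) (rule le)
  also have "\<dots> = (\<Sum>n<N. real (Suc n) powr y - real n powr y) / y" by (rule sum_divide_distrib[symmetric])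
  also have "(\<Sum>n<N. real (Suc n) powr y - real n powr y) = real N powr y" using y by (subst sum_lessThan_telescope) simp
  finally show ?thesis by (simp add: add_increasing2)
next
  case False
  have le: "real (Suc n) powr (y - 1) \<le> (real (Suc (Suc n)) powr y - real (Suc n) powr y) / y" for n
  proof -
    obtain c where c: "real (Suc n) < c" "c < real (Suc n) + 1" "(real (Suc n) + 1) powr y - real (Suc n) powr y = y * c powr (y - 1)"
      using powr_mean_value[of "real (Suc n)" "real (Suc n) + 1" y] by auto
    have "real (Suc n) powr (y - 1) \<le> c powr (y - 1)" using c False by (intro powr_mono2) auto
    also have "\<dots> = (real (Suc (Suc n)) powr y - real (Suc n) powr y) / y" using c(3) y by (simp add: field_simps)
    finally show ?thesis .
  qed
  obtain M where M: "N = Suc M" using N by (cases N) auto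
  have "(\<Sum>n<M. real (Suc n) powr (y - 1)) \<le> (\<Sum>n<M. (real (Suc (Suc n)) powr y - real (Suc n) powr y) / y)"
    by (rule sum_mono) (rule le)
  also have "\<dots> = (\<Sum>n<M. real (Suc (Suc n)) powr y - real (Suc n) powr y) / y" by (rule sum_divide_distrib[symmetric])
  also have "(\<Sum>n<M. real (Suc (Suc n)) powr y - real (Suc n) powr y) = real N powr y - 1"
    unfolding M by (subst sum_lessThan_telescope[of "\<lambda>n. real (Suc n) powr y"]) simp
  also have "(real N powr y - 1) / y \<le> real N powr y / y" using y by (simp add: divide_right_mono)
  finally show ?thesis by (simp add: M)
qed

text \<open>On the circle 1/z is the conjugate of z over R^2, so the kernel is real and proportional
  to Re z. This zero on the imaginary axis offsets the factor 1/|Re z| in the estimates of both the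
  tail and the partial sum.\<close>

lemma newman_kernel_eq:
  assumes "norm z = R" "R > 0"
  shows "(1 + z\<^sup>2 / of_real (R\<^sup>2)) / z = of_real (2 * Re z / R\<^sup>2)"
proof -
  have z: "z \<noteq> 0" using assms by auto
  have 1: "z * cnj z = of_real (R\<^sup>2)" using complex_norm_square[of z] assms by simp
  have R: "complex_of_real (R\<^sup>2) \<noteq> 0" using assms by simp
  have "(1 + z\<^sup>2 / of_real (R\<^sup>2)) / z = 1 / z + z / of_real (R\<^sup>2)" using z by (simp add: add_divide_distrib power2_eq_square)
  also have "1 / z = cnj z / of_real (R\<^sup>2)" using 1 z R by (metis nonzero_eq_divide_eq nonzero_divide_eq_eq mult.commute times_divide_eq_right mult_1)
  also have "cnj z / of_real (R\<^sup>2) + z / of_real (R\<^sup>2) = of_real (2 * Re z) / of_real (R\<^sup>2)"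
    using complex_add_cnj[of z] by (simp only: add_divide_distrib[symmetric] add.commute)
  finally show ?thesis by simp
qed

lemma norm_of_nat_powr: "N \<ge> 1 \<Longrightarrow> norm (complex_of_nat N powr z) = real N powr Re z"
  using norm_of_real_powr[of "real N" z] by simp

text \<open>With x = Re z the tail of the series is at most N^(-x)/x, the power of N contributes
  N^x, and the kernel 2 x/R^2; the product is independent of N and x. The limit function 1/zeta(1 +
  z) appears as z / \<open>zeta_entire (1 + z)\<close>.\<close>

lemma newman_right_bound:
  assumes z: "norm z = R" "Re z > 0" and N: "N \<ge> 1" and R: "R > 0"
  shows "norm ((moebius_partial N z - z / zeta_entire (1 + z)) * of_nat N powr z * ((1 + z\<^sup>2 / of_real (R\<^sup>2)) / z)) \<le> 2 / R\<^sup>2"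
proof -
  define x where "x = Re z"
  have x: "x > 0" using z by (simp add: x_def)
  have z0: "z \<noteq> 0" using z by auto
  have "(\<lambda>n. moebius_term (1 + z) (Suc n)) sums (1 / riemann_zeta (1 + z))" by (rule moebius_sums) (use z in simp)
  moreover have "1 / riemann_zeta (1 + z) = z / zeta_entire (1 + z)" using zeta_entire_eq[of "1 + z"] z0 by simp
  ultimately have sums: "(\<lambda>n. moebius_term (1 + z) (Suc n)) sums (z / zeta_entire (1 + z))" by simp
  have "(\<lambda>n. moebius_term (1 + z) (Suc (n + N))) sums (z / zeta_entire (1 + z) - moebius_partial N z)"
    unfolding moebius_partial_def using sums_split_initial_segment[OF sums, of N] by simp
  then have eq: "z / zeta_entire (1 + z) - moebius_partial N z = (\<Sum>n. moebius_term (1 + z) (Suc (n + N)))" by (rule sums_unique)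
  have "norm (z / zeta_entire (1 + z) - moebius_partial N z) \<le> (\<Sum>n. real (Suc (n + N)) powr (- 1 - x))"
    unfolding eq x_def by (rule norm_suminf_le[OF norm_moebius_term_le suminf_powr_tail_le(1)]) (use z N in auto)
  also have "\<dots> \<le> real N powr (- x) / x" by (rule suminf_powr_tail_le(2)[OF x N])
  finally have 1: "norm (moebius_partial N z - z / zeta_entire (1 + z)) \<le> real N powr (- x) / x" by (simp add: norm_minus_commute)
  have "norm ((moebius_partial N z - z / zeta_entire (1 + z)) * of_nat N powr z * ((1 + z\<^sup>2 / of_real (R\<^sup>2)) / z)) = 
     norm (moebius_partial N z - z / zeta_entire (1 + z)) * real N powr x * (2 * x / R\<^sup>2)"
  proof -
    have "\<bar>2 * Re z / R\<^sup>2\<bar> = 2 * x / R\<^sup>2" using x by (simp add: x_def)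
    then show ?thesis unfolding newman_kernel_eq[OF z(1) R]
      by (simp only: norm_mult norm_of_nat_powr[OF N] norm_of_real x_def)
  qed
  also have "\<dots> \<le> (real N powr (- x) / x) * real N powr x * (2 * x / R\<^sup>2)"
    using x by (intro mult_right_mono 1) auto
  also have "\<dots> = 2 / R\<^sup>2" using x N by (simp add: powr_minus field_simps)
  finally show ?thesis .
qed

text \<open>The mirror image for the partial sum itself, with y = - Re z. The second summand comes
  from the isolated last term in \<open>sum_powr_le\<close>, together with y <= R.\<close>

lemma newman_left_bound:
  assumes z: "norm z = R" "Re z < 0" and N: "N \<ge> 1" and R: "R > 0"
  shows "norm (moebius_partial N z * of_nat N powr z * ((1 + z\<^sup>2 / of_real (R\<^sup>2)) / z)) \<le> 2 / R\<^sup>2 + 2 / (R * N)"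
proof -
  define y where "y = - Re z"
  have y: "y > 0" "y \<le> R" using z abs_Re_le_cmod[of z] by (auto simp: y_def)
  have "norm (moebius_partial N z) \<le> (\<Sum>n<N. real (Suc n) powr (y - 1))"
  proof -
    have "- 1 - Re z = y - 1" by (simp add: y_def)
    then have "norm (moebius_term (1 + z) (Suc n)) \<le> real (Suc n) powr (y - 1)" for n
      using norm_moebius_term_le[of z "Suc n"] by (simp only:)
    then show ?thesis unfolding moebius_partial_def by (intro sum_norm_le)
  qed
  also have "\<dots> \<le> real N powr y / y + real N powr (y - 1)" by (rule sum_powr_le[OF y(1) N])
  finally have 1: "norm (moebius_partial N z) \<le> real N powr y / y + real N powr (y - 1)" .
  have "norm (moebius_partial N z * of_nat N powr z * ((1 + z\<^sup>2 / of_real (R\<^sup>2)) / z)) = 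
     norm (moebius_partial N z) * real N powr (- y) * (2 * y / R\<^sup>2)"
  proof -
    have "\<bar>2 * Re z / R\<^sup>2\<bar> = 2 * y / R\<^sup>2" "Re z = - y" using y by (simp_all add: y_def)
    then show ?thesis unfolding newman_kernel_eq[OF z(1) R]
      by (simp only: norm_mult norm_of_nat_powr[OF N] norm_of_real)
  qed
  also have "\<dots> \<le> (real N powr y / y + real N powr (y - 1)) * real N powr (- y) * (2 * y / R\<^sup>2)"
    using y by (intro mult_right_mono 1) auto
  also have "\<dots> = 2 / R\<^sup>2 + 2 * y / (R\<^sup>2 * N)"
    using y N by (simp add: powr_minus powr_diff field_simps)
  also have "2 * y / (R\<^sup>2 * N) \<le> 2 * R / (R\<^sup>2 * N)" using y N R by (intro divide_right_mono) auto
  also have "2 * R / (R\<^sup>2 * N) = 2 / (R * N)" using R by (simp add: power2_eq_square)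
  finally show ?thesis by simp
qed

text \<open>The zeros in a closed box to the left of the line Re z = 0 form a compact set, so their
  largest real part is attained; it is negative because there are no zeros on the line. Its modulus
  serves as \<delta>, or 1 if the box has no zeros.\<close>

lemma zeta_entire_nonzero_strip:
  "\<exists>\<delta>>0. \<forall>z. Re z > - \<delta> \<longrightarrow> \<bar>Im z\<bar> \<le> T \<longrightarrow> zeta_entire (1 + z) \<noteq> 0"
proof -
  define V where "V = {z. zeta_entire (1 + z) = 0} \<inter> cbox (Complex (-1) (- T)) (Complex 0 T)"
  have cont: "continuous_on UNIV (\<lambda>z. zeta_entire (1 + z))"
    by (intro continuous_on_compose2[OF holomorphic_on_imp_continuous_on[OF holomorphic_zeta_entire[of UNIV]]] continuous_intros) auto
  have "closed {z. zeta_entire (1 + z) = 0}" 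
    using closed_Collect_eq[OF cont continuous_on_const[of UNIV 0]] by simp
  then have comp: "compact V" unfolding V_def by (intro closed_Int_compact compact_cbox)
  have V: "z \<in> V" if "zeta_entire (1 + z) = 0" "Re z \<ge> -1" "\<bar>Im z\<bar> \<le> T" for z
    using that zeta_entire_nonzero[of "1 + z"] by (force simp: V_def in_cbox_complex_iff)
  show ?thesis
  proof (cases "V = {}")
    case True
    then show ?thesis using V by (intro exI[of _ 1]) fastforce
  next
    case False
    obtain m where m: "m \<in> V" "\<And>z. z \<in> V \<Longrightarrow> Re z \<le> Re m"
      using continuous_attains_sup[OF comp False continuous_on_Re[OF continuous_on_id]] by blast
    have "Re m < 0" using m(1) zeta_entire_nonzero[of "1 + m"] by (force simp: V_def)
    moreover have "Re m \<ge> -1" using m(1) by (auto simp: V_def in_cbox_complex_iff)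
    ultimately show ?thesis using V m(2) by (intro exI[of _ "- Re m"]) fastforce
  qed
qed


section \<open>Contour integrals for Newman's method\<close>

lemma contour_integral_inverse_part_circlepath:
  assumes "R > 0" "a < b"
  shows "((\<lambda>z. c / z) has_contour_integral (c * \<i> * of_real (b - a))) (part_circlepath 0 R a b)"
proof -
  have "((\<lambda>t. c * \<i>) has_integral (b - a) *\<^sub>R (c * \<i>)) {a..b}"
    using has_integral_const_real[of "c * \<i>" a b] assms by simp
  moreover have "c / (0 + R * cis t) * R * \<i> * cis t = c * \<i>" for t using assms by simp
  ultimately have "((\<lambda>t. c / (0 + R * cis t) * R * \<i> * cis t) has_integral (c * \<i> * of_real (b - a))) {a..b}"
    by (simp only: scaleR_conv_of_real mult.commute)
  then show ?thesis using has_contour_integral_part_circlepath_iff[OF assms(2)] by blast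
qed

text \<open>Cauchy's integral formula, with the circle cut at the imaginary axis because the two
  halves are estimated differently. The difference quotient \<open>h\<close> integrates to 0 over
  the closed path, and the remaining \<open>e 0 / z\<close> is integrated over each arc by its
  angle.\<close>

lemma contour_integral_two_arcs:
  assumes R: "R > 0" and e: "e holomorphic_on UNIV"
  shows "contour_integral (part_circlepath 0 R (- pi/2) (pi/2)) (\<lambda>z. e z / z) +
     contour_integral (part_circlepath 0 R (pi/2) (3*pi/2)) (\<lambda>z. e z / z) = 2 * pi * \<i> * e 0"
    "\<And>a b. (\<lambda>z. e z / z) contour_integrable_on (part_circlepath 0 R a b)"
proof -
  define h where "h = (\<lambda>z. if z = 0 then deriv e 0 else (e z - e 0) / (z - 0))"
  have h: "h holomorphic_on UNIV" unfolding h_def by (rule pole_lemma[OF e]) simp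
  let ?r = "part_circlepath 0 R (- pi/2) (pi/2)" and ?l = "part_circlepath 0 R (pi/2) (3*pi/2)"
  have ih: "h contour_integrable_on part_circlepath 0 R a b" for a b
    by (intro contour_integrable_holomorphic_simple[OF h]) auto
  have arc: "contour_integral (part_circlepath 0 R a b) (\<lambda>z. e z / z) = contour_integral (part_circlepath 0 R a b) h + e 0 * \<i> * of_real (b - a)" 
    if "a < b" for a b
  proof (rule contour_integral_unique)
    have "((\<lambda>z. h z + e 0 / z) has_contour_integral (contour_integral (part_circlepath 0 R a b) h + e 0 * \<i> * of_real (b - a))) (part_circlepath 0 R a b)"
      by (intro has_contour_integral_add has_contour_integral_integral ih contour_integral_inverse_part_circlepath R that)
    moreover have "h z + e 0 / z = e z / z" if "z \<in> path_image (part_circlepath 0 R a b)" for z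
      using path_image_part_circlepath_subset'[of R 0 a b] that R by (auto simp: h_def diff_divide_distrib)
    ultimately show "((\<lambda>z. e z / z) has_contour_integral (contour_integral (part_circlepath 0 R a b) h + e 0 * \<i> * of_real (b - a))) (part_circlepath 0 R a b)"
      by (rule has_contour_integral_eq)
  qed
  have fin: "pathfinish ?r = pathstart ?l" by simp
  have cl: "pathfinish ?l = pathstart ?r"
  proof -
    have "3 * pi / 2 = pi / 2 + pi" by simp
    then have "cis (3 * pi / 2) = cis (- pi / 2)" by (simp only: complex_eq_iff cis.sel cos_periodic_pi sin_periodic_pi) simp
    then show ?thesis unfolding cis_conv_exp by (simp only: pathfinish_part_circlepath pathstart_part_circlepath)
  qed
  have "(h has_contour_integral 0) (?r +++ ?l)"
    by (rule Cauchy_theorem_convex_simple[OF h convex_UNIV]) (use cl in \<open>auto intro!: valid_path_join\<close>)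
  then have "contour_integral ?r h + contour_integral ?l h = 0"
  proof -
    have "contour_integral (?r +++ ?l) h = contour_integral ?r h + contour_integral ?l h"
      by (rule contour_integral_join[OF ih ih]) auto
    then show ?thesis using contour_integral_unique[OF \<open>(h has_contour_integral 0) (?r +++ ?l)\<close>] by (simp only:)
  qed
  moreover have "- pi/2 < pi/2" "pi/2 < 3*pi/2" by auto
  ultimately show "contour_integral ?r (\<lambda>z. e z / z) + contour_integral ?l (\<lambda>z. e z / z) = 2 * pi * \<i> * e 0"
    using arc[of "-pi/2" "pi/2"] arc[of "pi/2" "3*pi/2"] by (simp add: algebra_simps)
  have "continuous_on (path_image (part_circlepath 0 R a b)) (\<lambda>z. e z / z)" for a b
    using path_image_part_circlepath_subset'[of R 0 a b] R
    by (intro continuous_intros holomorphic_on_imp_continuous_on[OF holomorphic_on_subset[OF e]]) auto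
  then show "(\<lambda>z. e z / z) contour_integrable_on (part_circlepath 0 R a b)" for a b
    by (rule contour_integrable_continuous_part_circlepath)
qed

text \<open>The segment starts on the imaginary axis, where the integrand is only bounded by M.
  Integrating the exponential decay to the left gives M/L, which tends to 0 for L = ln N.\<close>

lemma contour_integral_horizontal_bound:
  assumes "\<delta> > 0" "L > 0" "M \<ge> 0" and a: "Re a = 0" "b = a - of_real \<delta>"
    and f: "f contour_integrable_on linepath a b"
    and le: "\<And>z. z \<in> closed_segment a b \<Longrightarrow> norm (f z) \<le> M * exp (Re z * L)"
  shows "norm (contour_integral (linepath a b) f) \<le> M / L"
proof -
  have d: "b - a = - of_real \<delta>" using a by simp
  have "((\<lambda>t. f (linepath a b t) * (b - a)) has_integral contour_integral (linepath a b) f) {0..1}"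
    using has_contour_integral_integral[OF f] by (simp only: has_contour_integral_linepath)
  then have i: "(\<lambda>t. f (linepath a b t) * (b - a)) integrable_on {0..1}" 
    and eq: "contour_integral (linepath a b) f = integral {0..1} (\<lambda>t. f (linepath a b t) * (b - a))"
    by (auto simp: has_integral_iff)
  have "((\<lambda>t. M * \<delta> * exp (- \<delta> * L * t)) has_integral (- (M / L) * exp (- \<delta> * L * 1) - - (M / L) * exp (- \<delta> * L * 0))) {0..1}"
  proof (rule fundamental_theorem_of_calculus)
    fix t :: real
    show "((\<lambda>t. - (M / L) * exp (- \<delta> * L * t)) has_vector_derivative M * \<delta> * exp (- \<delta> * L * t)) (at t within {0..1})"
      unfolding has_real_derivative_iff_has_vector_derivative[symmetric] using assms(2) by (auto intro!: derivative_eq_intros)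
  qed simp
  then have j: "(\<lambda>t. M * \<delta> * exp (- \<delta> * L * t)) integrable_on {0..1}" 
    "integral {0..1} (\<lambda>t. M * \<delta> * exp (- \<delta> * L * t)) = (M / L) * (1 - exp (- \<delta> * L))"
    by (auto simp: has_integral_iff algebra_simps)
  have "norm (contour_integral (linepath a b) f) \<le> integral {0..1} (\<lambda>t. M * \<delta> * exp (- \<delta> * L * t))"
    unfolding eq
  proof (rule integral_norm_bound_integral[OF i j(1)])
    fix t :: real assume t: "t \<in> {0..1}"
    have "linepath a b t = a + of_real t * (b - a)" by (simp add: linepath_def scaleR_conv_of_real algebra_simps)
    then have "Re (linepath a b t) = - \<delta> * t" using a unfolding d by simp
    moreover have "linepath a b t \<in> closed_segment a b" using t by (intro linepath_in_path)
    ultimately have "norm (f (linepath a b t)) \<le> M * exp (- \<delta> * L * t)" using le by (fastforce simp: mult_ac)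
    then have "norm (f (linepath a b t)) * \<delta> \<le> (M * exp (- \<delta> * L * t)) * \<delta>" using assms(1) by (intro mult_right_mono) auto
    then show "norm (f (linepath a b t) * (b - a)) \<le> M * \<delta> * exp (- \<delta> * L * t)"
      unfolding d using assms(1) by (simp add: norm_mult mult_ac)
  qed
  also have "\<dots> \<le> (M / L) * 1" unfolding j(2) using assms by (intro mult_left_mono) auto
  finally show ?thesis by simp
qed


text \<open>Newman's contour: the partial sum is integrated over the whole circle of radius R, the limit
  function over the right half of it, closed up by a rectangle to the left of the line. The kernel
  vanishes at both ends of the half circle, and there is no pole at 0 because 1/zeta vanishes at 1.\<close>
lemma newman_estimate:
  assumes R: "R \<ge> 1"
  shows "\<exists>M \<delta>. M \<ge> 0 \<and> \<delta> > 0 \<and> (\<forall>N\<ge>2. norm (moebius_partial N 0) \<le> 2 / R + 1 / N + M / ln N + M * real N powr (- \<delta>))"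
proof -
  obtain \<delta>0 where d0: "\<delta>0 > 0" "\<And>z. Re z > - \<delta>0 \<Longrightarrow> \<bar>Im z\<bar> \<le> R + 1 \<Longrightarrow> zeta_entire (1 + z) \<noteq> 0"
    using zeta_entire_nonzero_strip[of "R + 1"] by blast
  \<comment> \<open>Half the zero-free width, so that the closed rectangle \<open>K\<close> lies
    inside the open convex region \<open>U\<close> on which \<open>g\<close> is holomorphic.\<close>
  define \<delta> where "\<delta> = \<delta>0 / 2"
  have \<delta>: "\<delta> > 0" "\<delta> < \<delta>0" using d0 by (auto simp: \<delta>_def)
  define U where "U = {z. Re z > - \<delta>0} \<inter> ({z. Im z < R + 1} \<inter> {z. Im z > - (R + 1)})"
  have convU: "convex U" unfolding U_def
    by (intro convex_Int convex_halfspace_Re_gt convex_halfspace_Im_gt convex_halfspace_Im_lt)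
  have UI: "z \<in> U" if "Re z > - \<delta>0" "\<bar>Im z\<bar> < R + 1" for z using that by (auto simp: U_def)
  define p where "p = (\<lambda>z. 1 + z\<^sup>2 / complex_of_real (R\<^sup>2))"
  define g where "g = (\<lambda>z. p z / zeta_entire (1 + z))"
  have holZ: "(\<lambda>z. zeta_entire (1 + z)) holomorphic_on A" for A
    by (intro holomorphic_on_compose_gen[OF _ holomorphic_zeta_entire[of UNIV], unfolded o_def] holomorphic_intros) auto
  have holg: "g holomorphic_on U" unfolding g_def p_def
    by (intro holomorphic_intros holZ) (use d0 R in \<open>auto simp: U_def\<close>)
  define K where "K = cbox (Complex (- \<delta>) (- R)) (Complex 0 R)"
  have KU: "K \<subseteq> U" using \<delta> by (auto simp: K_def U_def in_cbox_complex_iff)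
  have "compact (g ` K)" unfolding K_def
    by (rule compact_continuous_image[OF holomorphic_on_imp_continuous_on[OF holomorphic_on_subset[OF holg KU[unfolded K_def]]] compact_cbox])
  then obtain M where M0: "\<And>z. z \<in> K \<Longrightarrow> norm (g z) \<le> M" using compact_imp_bounded bounded_iff by (metis image_eqI)
  have "0 \<in> K" using \<delta> R by (auto simp: K_def in_cbox_complex_iff)
  then have M: "M \<ge> 0" using M0 norm_ge_zero order_trans by blast
  define a b where "a = complex_of_real R * \<i>" and "b = - (complex_of_real R * \<i>)"
  let ?r = "part_circlepath 0 R (- pi/2) (pi/2)" and ?l = "part_circlepath 0 R (pi/2) (3*pi/2)"
  let ?A = "linepath a (a - of_real \<delta>)" and ?B = "linepath (a - of_real \<delta>) (b - of_real \<delta>)" and ?C = "linepath (b - of_real \<delta>) b"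
  have ends: "pathfinish ?r = a" "pathstart ?r = b"
  proof -
    have "cis (pi / 2) = \<i>" "cis (- pi / 2) = - \<i>" by (simp_all add: complex_eq_iff)
    then have "exp (\<i> * of_real (pi / 2)) = \<i>" "exp (\<i> * of_real (- pi / 2)) = - \<i>" by (simp_all only: cis_conv_exp)
    then show "pathfinish ?r = a" "pathstart ?r = b" 
      by (simp_all only: pathfinish_part_circlepath pathstart_part_circlepath a_def b_def add_0 mult_minus_right)
  qed
  have arc_r: "norm z = R \<and> Re z \<ge> 0" if "z \<in> path_image ?r" for z
  proof -
    have "z \<in> (\<lambda>t. 0 + R * cis t) ` {- pi/2..pi/2}"
      using that unfolding path_image_part_circlepath' by (simp add: closed_segment_eq_real_ivl)
    then obtain t where "z = 0 + R * cis t" "t \<in> {- pi/2..pi/2}" by (rule imageE)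
    then have t: "z = R * cis t" "- pi/2 \<le> t" "t \<le> pi/2" by simp_all
    then have "cos t \<ge> 0" by (intro cos_ge_zero) auto
    then show ?thesis using t R by (simp add: norm_mult)
  qed
  have arc_l: "norm z = R \<and> Re z \<le> 0" if "z \<in> path_image ?l" for z
  proof -
    have "z \<in> (\<lambda>t. 0 + R * cis t) ` {pi/2..3*pi/2}"
      using that unfolding path_image_part_circlepath' by (simp add: closed_segment_eq_real_ivl)
    then obtain t where "z = 0 + R * cis t" "t \<in> {pi/2..3*pi/2}" by (rule imageE)
    then have t: "z = R * cis t" "pi/2 \<le> t" "t \<le> 3*pi/2" by simp_all
    then have "cos (t - pi) \<ge> 0" by (intro cos_ge_zero) auto
    then have "cos t \<le> 0" by (simp add: cos_diff)
    then show ?thesis using t R by (simp add: norm_mult mult_nonneg_nonpos)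
  qed
  have corners: "z = a \<or> z = b" if "norm z = R" "Re z = 0" for z
  proof -
    have "\<bar>Im z\<bar> = R" using that by (simp add: cmod_def)
    then show ?thesis using that(2) by (auto simp: a_def b_def complex_eq_iff abs_if split: if_splits)
  qed
  have KI: "z \<in> K" if "- \<delta> \<le> Re z" "Re z \<le> 0" "\<bar>Im z\<bar> \<le> R" for z using that by (auto simp: K_def in_cbox_complex_iff)
  have inK: "a \<in> K" "b \<in> K" "a - of_real \<delta> \<in> K" "b - of_real \<delta> \<in> K" using R \<delta> by (auto intro!: KI simp: a_def b_def)
  have segK: "closed_segment x y \<subseteq> K" if "x \<in> K" "y \<in> K" for x y
    using that unfolding K_def by (intro closed_segment_subset convex_box)
  have main: "norm (moebius_partial N 0) \<le> 2 / R + 1 / N + (M + 2 * R * M) / ln N + (M + 2 * R * M) * real N powr (- \<delta>)" if N: "N \<ge> 2" for N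
  proof -
    define L where "L = ln (real N)"
    have L: "L > 0" using N by (simp add: L_def)
    define w where "w = (\<lambda>z::complex. of_nat N powr z)"
    have holw: "w holomorphic_on A" for A unfolding w_def using N by (intro holomorphic_intros) auto
    have nw: "norm (w z) = exp (Re z * L)" for z using norm_of_nat_powr[of N z] N by (simp add: w_def L_def powr_def)
    define q where "q = (\<lambda>z. w z * g z)"
    define e where "e = (\<lambda>z. moebius_partial N z * w z * p z)"
    have hole: "e holomorphic_on UNIV" unfolding e_def p_def moebius_partial_def moebius_term_shift
      by (intro holomorphic_intros holw) auto
    have holq: "q holomorphic_on U" unfolding q_def by (intro holomorphic_intros holw holg)
    have subr: "path_image ?r \<subseteq> U"
    proof
      fix z assume "z \<in> path_image ?r"
      then show "z \<in> U" using arc_r[of z] abs_Im_le_cmod[of z] d0(1) by (intro UI) auto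
    qed
    have intq: "q contour_integrable_on \<gamma>" if "valid_path \<gamma>" "path_image \<gamma> \<subseteq> U" for \<gamma>
    proof -
      have "open U" unfolding U_def by (intro open_Int open_halfspace_Re_gt open_halfspace_Im_gt open_halfspace_Im_lt)
      then show ?thesis using contour_integrable_holomorphic_simple[OF holq _ that] by blast
    qed
    have iA: "q contour_integrable_on linepath x y" if "x \<in> K" "y \<in> K" for x y
      using segK[OF that] KU by (intro intq) auto
    have ir: "q contour_integrable_on ?r" by (intro intq subr) auto
    have vp': "valid_path (?B +++ ?C)" by (rule valid_path_join) auto
    have vp'': "valid_path (?A +++ ?B +++ ?C)" by (rule valid_path_join[OF _ vp']) auto
    have vp: "valid_path (?r +++ ?A +++ ?B +++ ?C)"
      by (rule valid_path_join[OF _ vp'']) (simp, simp only: ends pathstart_join pathstart_linepath)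
    have "(q has_contour_integral 0) (?r +++ ?A +++ ?B +++ ?C)"
    proof (rule Cauchy_theorem_convex_simple[OF holq convU])
      show "path_image (?r +++ ?A +++ ?B +++ ?C) \<subseteq> U"
        by (intro subset_path_image_join subr) (use segK inK KU in auto)
      show "valid_path (?r +++ ?A +++ ?B +++ ?C)" by (rule vp)
    qed (simp only: pathfinish_join pathstart_join ends pathfinish_linepath)
    moreover have "(q has_contour_integral (contour_integral ?r q + (contour_integral ?A q + (contour_integral ?B q + contour_integral ?C q)))) (?r +++ ?A +++ ?B +++ ?C)"
      by (intro has_contour_integral_join has_contour_integral_integral ir iA inK vp' vp'') auto
    ultimately have q0: "contour_integral ?r q = - (contour_integral ?A q + (contour_integral ?B q + contour_integral ?C q))"
      using has_contour_integral_unique by (metis add_eq_0_iff2)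
    have "2 * pi * \<i> * e 0 = contour_integral ?r (\<lambda>z. e z / z) + contour_integral ?l (\<lambda>z. e z / z)"
      by (rule contour_integral_two_arcs(1)[symmetric]) (use R hole in auto)
    moreover have "e 0 = moebius_partial N 0" using N by (simp add: e_def p_def w_def)
    moreover have ie: "(\<lambda>z. e z / z) contour_integrable_on (part_circlepath 0 R a b)" for a b
      by (rule contour_integral_two_arcs(2)) (use R hole in auto)
    ultimately have eq: "2 * pi * \<i> * moebius_partial N 0 = contour_integral ?r (\<lambda>z. e z / z - q z) + contour_integral ?l (\<lambda>z. e z / z)
       - (contour_integral ?A q + (contour_integral ?B q + contour_integral ?C q))"
      using contour_integral_diff[OF ie ir] q0 by simp
    have b1: "norm (contour_integral ?r (\<lambda>z. e z / z - q z)) \<le> 2 / R\<^sup>2 * R * (pi/2 - (- pi/2))"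
    \<comment> \<open>The end points a and b lie on the imaginary axis, where the strict estimates
      do not apply; a finite exceptional set does not affect the bound.\<close>
    proof (rule contour_integral_bound_part_circlepath_strong[where k = "{a, b}"])
      fix z assume z: "z \<in> path_image ?r - {a, b}"
      then have zR: "norm z = R" "Re z > 0" using arc_r[of z] corners[of z] by force+
      have "e z / z - q z = (moebius_partial N z - z / zeta_entire (1 + z)) * of_nat N powr z * ((1 + z\<^sup>2 / of_real (R\<^sup>2)) / z)"
      proof -
        have z0: "z \<noteq> 0" using zR by auto
        have "e z / z - (z / zeta_entire (1 + z)) * w z * (p z / z) = (moebius_partial N z - z / zeta_entire (1 + z)) * w z * (p z / z)"
        proof -
          have "e z / z = moebius_partial N z * w z * (p z / z)" by (simp add: e_def)
          then show ?thesis by (simp only: left_diff_distrib)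
        qed
        moreover have "(z / zeta_entire (1 + z)) * w z * (p z / z) = q z" using z0 by (simp add: q_def g_def)
        ultimately show ?thesis by (simp only: w_def p_def)
      qed
      then show "norm (e z / z - q z) \<le> 2 / R\<^sup>2" using newman_right_bound[OF zR, of N] N R by simp
    next
      show "(\<lambda>z. e z / z - q z) contour_integrable_on ?r" by (rule contour_integrable_diff[OF ie ir])
    qed (use R in auto)
    have b2: "norm (contour_integral ?l (\<lambda>z. e z / z)) \<le> (2 / R\<^sup>2 + 2 / (R * N)) * R * (3*pi/2 - pi/2)"
    proof (rule contour_integral_bound_part_circlepath_strong[where k = "{a, b}"])
      fix z assume z: "z \<in> path_image ?l - {a, b}"
      then have zR: "norm z = R" "Re z < 0" using arc_l[of z] corners[of z] by force+
      show "norm (e z / z) \<le> 2 / R\<^sup>2 + 2 / (R * N)" using newman_left_bound[OF zR, of N] N R by (simp add: e_def w_def p_def)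
    qed (use R in \<open>auto intro!: ie\<close>)
    have nq: "norm (q z) \<le> M * exp (Re z * L)" if "z \<in> K" for z
      using mult_left_mono[OF M0[OF that], of "exp (Re z * L)"] by (simp add: q_def norm_mult nw mult.commute)
    have b3: "norm (contour_integral ?A q) \<le> M / L"
      by (rule contour_integral_horizontal_bound[OF \<delta>(1) L M _ refl iA[OF inK(1,3)]]) (use segK[OF inK(1,3)] nq in \<open>auto simp: a_def\<close>)
    have b4: "norm (contour_integral ?C q) \<le> M / L"
    proof -
      have "norm (contour_integral (linepath b (b - of_real \<delta>)) q) \<le> M / L"
        by (rule contour_integral_horizontal_bound[OF \<delta>(1) L M _ refl iA[OF inK(2,4)]]) (use segK[OF inK(2,4)] nq in \<open>auto simp: b_def\<close>)
      moreover have "contour_integral ?C q = - contour_integral (linepath b (b - of_real \<delta>)) q"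
        using contour_integral_reversepath[of "linepath b (b - of_real \<delta>)" q] by simp
      ultimately show ?thesis by simp
    qed
    have b5: "norm (contour_integral ?B q) \<le> (M * real N powr (- \<delta>)) * norm ((b - of_real \<delta>) - (a - of_real \<delta>))"
    proof (rule contour_integral_bound_linepath[OF iA[OF inK(3,4)]])
      fix z assume z: "z \<in> closed_segment (a - of_real \<delta>) (b - of_real \<delta>)"
      then obtain u where "z = (1 - u) *\<^sub>R (a - of_real \<delta>) + u *\<^sub>R (b - of_real \<delta>)" unfolding closed_segment_def by blast
      then have "Re z = (1 - u) * Re (a - of_real \<delta>) + u * Re (b - of_real \<delta>)" by simp
      also have "\<dots> = - \<delta>" by (simp add: a_def b_def algebra_simps)
      finally have "Re z = - \<delta>" .
      then show "norm (q z) \<le> M * real N powr (- \<delta>)" using nq[of z] segK[OF inK(3,4)] z N by (auto simp: powr_def L_def)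
    qed (use M in auto)
    have "norm ((b - of_real \<delta>) - (a - of_real \<delta>)) = 2 * R"
    proof -
      have "(b - of_real \<delta>) - (a - of_real \<delta>) = - (2 * R) * \<i>" by (simp add: a_def b_def)
      then show ?thesis using R by (simp add: norm_mult)
    qed
    note b5' = b5[unfolded this]
    \<comment> \<open>Both half circles have length pi R. The right one contributes 2 pi/R, the left
      one 2 pi/R + 2 pi/N, together 2 pi (2/R + 1/N); the rest comes from the sides of the
      rectangle.\<close>
    have "norm (2 * pi * \<i> * moebius_partial N 0) \<le> 2 / R\<^sup>2 * R * (pi/2 - (- pi/2)) + (2 / R\<^sup>2 + 2 / (R * N)) * R * (3*pi/2 - pi/2) + (M / L + (M * real N powr (- \<delta>) * (2 * R) + M / L))"
      unfolding eq by (intro norm_triangle_mono norm_triangle_le_diff add_mono b1 b2 order_trans[OF norm_triangle_ineq4] order_trans[OF norm_triangle_ineq] b3 b4 b5')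
    also have "\<dots> = 2 * pi * (2 / R + 1 / N) + 2 * M / L + 2 * R * M * real N powr (- \<delta>)"
      using R N by (simp add: field_simps power2_eq_square)
    finally have "2 * pi * norm (moebius_partial N 0) \<le> 2 * pi * (2 / R + 1 / N) + 2 * M / L + 2 * R * M * real N powr (- \<delta>)"
      by (simp add: norm_mult)
    moreover have "2 * M / L \<le> 2 * pi * ((M + 2 * R * M) / L)" 
    proof -
      have "2 * M \<le> 2 * pi * (M + 2 * R * M)" using M R pi_gt3 by (intro mult_mono) auto
      then show ?thesis using L by (simp add: divide_right_mono)
    qed
    moreover have "2 * R * M * real N powr (- \<delta>) \<le> 2 * pi * ((M + 2 * R * M) * real N powr (- \<delta>))"
    proof -
      have "1 * (2 * R * M) \<le> 2 * pi * (M + 2 * R * M)" using M R pi_gt3 by (intro mult_mono) auto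
      then show ?thesis by (simp only: mult.assoc[symmetric] mult_1_left) (rule mult_right_mono, auto)
    qed
    ultimately have "2 * pi * norm (moebius_partial N 0) \<le> 2 * pi * (2 / R + 1 / N + (M + 2 * R * M) / L + (M + 2 * R * M) * real N powr (- \<delta>))"
      by (simp only: distrib_left)
    then show ?thesis unfolding L_def by (subst (asm) mult_le_cancel_left_pos) auto
  qed
  show ?thesis
    by (rule exI[of _ "M + 2 * R * M"], rule exI[of _ \<delta>]) (use main M R \<delta> in auto)
qed

theorem moebius_over_n_sums: "(\<lambda>n. moebius_mu (Suc n) / real (Suc n)) sums 0"
proof -
  have lim: "(\<lambda>N. moebius_partial N 0) \<longlonglongrightarrow> 0"
  proof (rule tendstoI)
    fix \<epsilon> :: real assume \<epsilon>: "\<epsilon> > 0"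
    \<comment> \<open>Makes 2/R at most \<epsilon>/2. The remaining terms depend on R through M and
      \<delta>, but tend to 0 as N grows with R fixed.\<close>
    define R where "R = max 1 (4 / \<epsilon>)"
    have R: "R \<ge> 1" by (simp add: R_def)
    have "2 / R \<le> \<epsilon> / 2" using \<epsilon> R by (simp add: R_def field_simps max_def split: if_splits)
    obtain M \<delta> where M: "M \<ge> 0" "\<delta> > 0" "\<And>N. N \<ge> 2 \<Longrightarrow> norm (moebius_partial N 0) \<le> 2 / R + 1 / real N + M / ln (real N) + M * real N powr (- \<delta>)"
      using newman_estimate[OF R] by blast
    have "(\<lambda>N. 1 / real N + M / ln (real N) + M * real N powr (- \<delta>)) \<longlonglongrightarrow> 0" using M(2) by real_asymp
    then have "\<forall>\<^sub>F N in sequentially. 1 / real N + M / ln (real N) + M * real N powr (- \<delta>) < \<epsilon> / 2"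
      using \<epsilon> by (intro order_tendstoD(2)) auto
    then show "\<forall>\<^sub>F N in sequentially. dist (moebius_partial N 0) 0 < \<epsilon>"
      using eventually_ge_at_top[of 2]
    proof eventually_elim
      case (elim N)
      then show ?case using M(3)[OF elim(2)] \<open>2 / R \<le> \<epsilon> / 2\<close> unfolding dist_norm diff_zero by linarith
    qed
  qed
  have "moebius_partial N 0 = of_real (\<Sum>n<N. moebius_mu (Suc n) / real (Suc n))" for N
  proof -
    have "moebius_term 1 (Suc n) = of_real (moebius_mu (Suc n) / real (Suc n))" for n
      by (simp add: moebius_term_def zeta_term_def)
    then show ?thesis by (simp add: moebius_partial_def)
  qed
  with lim have "(\<lambda>N. \<Sum>n<N. moebius_mu (Suc n) / real (Suc n)) \<longlonglongrightarrow> 0"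
    by (simp only: tendsto_of_real_iff[of _ 0, where ?'a = complex, simplified])
  then show ?thesis unfolding sums_def .
qed

section \<open>Bounds for the reciprocal of zeta\<close>

text \<open>On the disc f has a logarithm; normalized to \<open>h\<close> with h(0) = 0, it
  satisfies Re h < M by the upper bound on f. The map h / (2 M - h) takes this half plane into the
  unit disc, so Schwarz's lemma applies, and solving for h bounds |h| and thus Re h from
  below.\<close>

lemma borel_caratheodory_lower_bound:
  assumes r: "r > 0" and hol: "f holomorphic_on ball c r" and nz: "\<And>z. z \<in> ball c r \<Longrightarrow> f z \<noteq> 0"
    and le: "\<And>z. z \<in> ball c r \<Longrightarrow> norm (f z) < exp M * norm (f c)"
    and M: "M > 0" and q: "0 \<le> q" "q < 1" and z: "norm (z - c) \<le> q * r"
  shows "norm (f c) * exp (- (2 * M * q / (1 - q))) \<le> norm (f z)"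
proof -
  obtain g where g: "g holomorphic_on ball c r" "\<And>x. x \<in> ball c r \<Longrightarrow> exp (g x) = f x"
    using holomorphic_logarithm_exists[OF convex_ball open_ball hol nz, of c] r by auto
  define h where "h = (\<lambda>u. g (c + of_real r * u) - g c)"
  define \<phi> where "\<phi> = (\<lambda>u. h u / (2 * of_real M - h u))"
  have inb: "c + of_real r * u \<in> ball c r" if "norm u < 1" for u
    using that r by (simp add: dist_norm norm_mult)
  have holh: "h holomorphic_on ball 0 1" unfolding h_def
    by (intro holomorphic_intros holomorphic_on_compose_gen[OF _ g(1), unfolded o_def]) (use inb in auto)
  have fh: "f (c + of_real r * u) = f c * exp (h u)" if "norm u < 1" for u
    using g(2)[OF inb[OF that]] g(2)[of c] nz[of c] r by (simp add: h_def exp_diff)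
  have Re: "Re (h u) < M" if "norm u < 1" for u
  proof -
    have "norm (f c) * exp (Re (h u)) < norm (f c) * exp M"
      using le[OF inb[OF that]] unfolding fh[OF that] by (simp add: norm_mult mult.commute)
    then show ?thesis using nz[of c] r by (simp add: mult_less_cancel_left_pos)
  qed
  have den: "2 * of_real M - h u \<noteq> 0" if "norm u < 1" for u
    using Re[OF that] M by (auto simp: complex_eq_iff)
  have holp: "\<phi> holomorphic_on ball 0 1" unfolding \<phi>_def
    by (intro holomorphic_intros holh) (use den in auto)
  have p1: "norm (\<phi> u) < 1" if u: "norm u < 1" for u
  proof -
    have "(norm (h u))\<^sup>2 < (norm (2 * of_real M - h u))\<^sup>2"
      using Re[OF u] M unfolding cmod_power2
      by (simp add: power2_eq_square algebra_simps)
    then have "norm (h u) < norm (2 * of_real M - h u)" by (rule power_less_imp_less_base) simp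
    then show ?thesis using den[OF u] by (simp add: \<phi>_def norm_divide)
  qed
  define u where "u = (z - c) / of_real r"
  have uq: "norm u \<le> q" using z r by (simp add: u_def norm_divide field_simps)
  then have u1: "norm u < 1" using q by simp
  have "norm (\<phi> u) \<le> norm u"
    by (rule Schwarz_Lemma(1)[OF holp _ p1 u1]) (simp_all add: \<phi>_def h_def)
  then have "norm (\<phi> u) \<le> q" using uq by simp
  moreover have "h u = \<phi> u * (2 * of_real M - h u)" using den[OF u1] by (simp add: \<phi>_def)
  ultimately have "norm (h u) \<le> q * norm (2 * of_real M - h u)"
    by (metis norm_mult mult_right_mono norm_ge_zero)
  also have "\<dots> \<le> q * (2 * M + norm (h u))"
    using M q norm_triangle_ineq4[of "2 * complex_of_real M" "h u"] by (intro mult_left_mono) (auto simp: norm_mult)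
  finally have "norm (h u) * (1 - q) \<le> 2 * M * q" by (simp add: algebra_simps)
  then have hb: "norm (h u) \<le> 2 * M * q / (1 - q)" using q by (simp add: field_simps)
  have "- (2 * M * q / (1 - q)) \<le> Re (h u)" using hb abs_Re_le_cmod[of "h u"] by linarith
  then have "norm (f c) * exp (- (2 * M * q / (1 - q))) \<le> norm (f c) * exp (Re (h u))" by (intro mult_left_mono) auto
  also have "\<dots> = norm (f z)"
    using fh[OF u1] r by (simp add: u_def norm_mult)
  finally show ?thesis .
qed

text \<open>The quotient is 0 at 1, whereas the value there of the chosen continuation, hence of
  1/zeta, is arbitrary.\<close>
definition inv_zeta :: "complex \<Rightarrow> complex" where
  "inv_zeta w = (w - 1) / zeta_entire w"

lemma inv_zeta_eq: "w \<noteq> 1 \<Longrightarrow> inv_zeta w = 1 / riemann_zeta w"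
  by (simp add: inv_zeta_def zeta_entire_eq)

lemma inv_zeta_sums: "Re w > 1 \<Longrightarrow> (\<lambda>n. moebius_term w (Suc n)) sums inv_zeta w"
  using moebius_sums[of w] inv_zeta_eq[of w] by force

lemma summable_norm_moebius_term:
  assumes "Re w > 1"
  shows "summable (\<lambda>n. norm (moebius_term w (Suc n)))"
proof (rule summable_comparison_test')
  show "summable (\<lambda>n. real (Suc n) powr (- Re w))"
    using assms by (subst summable_Suc_iff[of "\<lambda>n. real n powr (- Re w)"]) (simp add: summable_real_powr_iff)
  show "norm (norm (moebius_term w (Suc n))) \<le> real (Suc n) powr (- Re w)" if "n \<ge> 0" for n
    using norm_moebius_term_le[of "w - 1" "Suc n"] by simp
qed

lemma norm_inv_zeta_le:
  "\<exists>B>0. \<forall>w. Re w \<ge> 2 \<longrightarrow> norm (inv_zeta w) \<le> B"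
proof -
  have sm: "summable (\<lambda>n. real (Suc n) powr (- 2))"
    by (subst summable_Suc_iff[of "\<lambda>n. real n powr (- 2)"]) (simp add: summable_real_powr_iff)
  define B where "B = (\<Sum>n. real (Suc n) powr (- 2)) + 1"
  have B: "B > 0" unfolding B_def by (intro add_nonneg_pos suminf_nonneg sm) auto
  have "norm (inv_zeta w) \<le> B" if w: "Re w \<ge> 2" for w
  proof -
    have "inv_zeta w = (\<Sum>n. moebius_term w (Suc n))" using inv_zeta_sums[of w] w by (intro sums_unique) auto
    also have "norm \<dots> \<le> (\<Sum>n. real (Suc n) powr (- 2))"
    proof (rule norm_suminf_le[OF _ sm])
      fix n
      have "norm (moebius_term w (Suc n)) \<le> real (Suc n) powr (- Re w)"
        using norm_moebius_term_le[of "w - 1" "Suc n"] by simp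
      also have "\<dots> \<le> real (Suc n) powr (- 2)" using w by (intro powr_mono) auto
      finally show "norm (moebius_term w (Suc n)) \<le> real (Suc n) powr (- 2)" .
    qed
    finally show ?thesis by (simp add: B_def)
  qed
  then show ?thesis using B by blast
qed

lemma riemann_hypothesis_zeta_entire_nonzero:
  assumes "riemann_hypothesis" "Re w > 1/2"
  shows "zeta_entire w \<noteq> 0"
proof (cases "Re w \<ge> 1")
  case False
  then have "w \<noteq> 1" by auto
  then show ?thesis using assms False unfolding zeta_entire_nonzero_iff riemann_hypothesis_def by force
qed (rule zeta_entire_nonzero)

text \<open>Far from the real axis the upper bound for zeta is linear in the height, so M in
  \<open>borel_caratheodory_lower_bound\<close> is a logarithm and the lower bound for zeta becomes
  a negative power of the height. The exponent m depends on \<eta> alone.\<close>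

lemma inv_zeta_polynomial_bound:
  assumes RH: "riemann_hypothesis" and \<eta>: "0 < \<eta>" "\<eta> < 1/2"
  shows "\<exists>C m. C > 0 \<and> (\<forall>w. Re w \<ge> 1/2 + \<eta> \<longrightarrow> norm (inv_zeta w) \<le> C * (\<bar>Im w\<bar> + 4) ^ (m::nat))"
proof -
  obtain B where B: "B > 0" "\<And>w. Re w \<ge> 2 \<Longrightarrow> norm (inv_zeta w) \<le> B" using norm_inv_zeta_le by blast
  obtain C0 where C0: "C0 > 0" "\<And>s. Re s \<ge> 1/4 \<Longrightarrow> \<bar>Im s\<bar> \<ge> 1 \<Longrightarrow> norm (riemann_zeta s) \<le> C0 * norm s"
    using riemann_zeta_growth by blast
  \<comment> \<open>Low heights are left to compactness: there the discs about 2 + i Im w could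
    reach the pole at 1. For |Im w| >= 3 and radius below 3/2 they stay at heights of modulus at
    least 1.\<close>
  define K where "K = cbox (Complex (1/2 + \<eta>) (-3)) (Complex 2 3)"
  have "inv_zeta holomorphic_on K" unfolding inv_zeta_def
    by (intro holomorphic_intros holomorphic_zeta_entire)
       (use riemann_hypothesis_zeta_entire_nonzero[OF RH] \<eta> in \<open>auto simp: K_def in_cbox_complex_iff\<close>)
  then have "compact (inv_zeta ` K)" unfolding K_def
    by (intro compact_continuous_image holomorphic_on_imp_continuous_on compact_cbox)
  then obtain D where D: "\<And>w. w \<in> K \<Longrightarrow> norm (inv_zeta w) \<le> D" using compact_imp_bounded bounded_iff by (metis image_eqI)
  \<comment> \<open>The disc of radius r about a centre with real part 2 stays in Re > 1/2 +
    \<eta>/2, where the hypothesis excludes zeros. The inner radius q r = 3/2 - \<eta> just reaches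
    Re w = 1/2 + \<eta>.\<close>
  define r where "r = 3/2 - \<eta>/2"
  define q where "q = (3/2 - \<eta>) / r"
  have r: "r > 0" "r < 3/2" using \<eta> by (auto simp: r_def)
  have q: "0 \<le> q" "q < 1" "q * r = 3/2 - \<eta>" using \<eta> r by (auto simp: q_def r_def field_simps)
  define C1 where "C1 = max 1 (C0 * B)"
  define m where "m = nat \<lceil>2 * q / (1 - q)\<rceil>"
  have m: "2 * q / (1 - q) \<le> real m" unfolding m_def by linarith
  have C1: "C1 \<ge> 1" "C1 \<ge> C0 * B" by (auto simp: C1_def)
  have far: "norm (inv_zeta w) \<le> B * (C1 * (\<bar>Im w\<bar> + 4)) ^ m" if w: "Re w \<ge> 1/2 + \<eta>" "Re w \<le> 2" "\<bar>Im w\<bar> \<ge> 3" for w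
  proof -
    define c where "c = Complex 2 (Im w)"
    define X where "X = C1 * (\<bar>Im w\<bar> + 4)"
    have X: "X > 1" using C1(1) mult_mono[of 1 C1 4 "\<bar>Im w\<bar> + 4"] by (simp add: X_def)
    have ball: "Re z > 1/2 \<and> \<bar>Im z\<bar> \<ge> 1 \<and> norm z < \<bar>Im w\<bar> + 4" if "z \<in> ball c r" for z
    proof -
      have "norm (z - c) < r" using that by (simp add: dist_norm norm_minus_commute)
      moreover have "norm c \<le> 2 + \<bar>Im w\<bar>" using cmod_le[of c] by (simp add: c_def)
      ultimately show ?thesis
        using abs_Re_le_cmod[of "z - c"] abs_Im_le_cmod[of "z - c"] norm_triangle_sub[of z c] w r \<eta> by (auto simp: c_def r_def)
    qed
    have ne1: "z \<noteq> 1" if "z \<in> ball c r" for z using ball[OF that] by auto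
    have zc: "norm (inv_zeta c) \<le> B" by (rule B(2)) (simp add: c_def)
    have cb: "c \<in> ball c r" using r by simp
    have nz: "riemann_zeta z \<noteq> 0" if "z \<in> ball c r" for z
      using riemann_hypothesis_zeta_entire_nonzero[OF RH, of z] ball[OF that] ne1[OF that] unfolding zeta_entire_nonzero_iff by blast
    \<comment> \<open>A lower bound for zeta at the centre; it converts the absolute growth bound on
      the disc into the bound relative to the centre that Borel-Caratheodory asks for.\<close>
    have zc': "1 \<le> B * norm (riemann_zeta c)"
      using zc nz[OF cb] inv_zeta_eq[OF ne1[OF cb]] by (simp add: norm_divide field_simps)
    have "norm (riemann_zeta c) * exp (- (2 * ln X * q / (1 - q))) \<le> norm (riemann_zeta w)"
    proof (rule borel_caratheodory_lower_bound[OF r(1) _ nz])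
      show "riemann_zeta holomorphic_on ball c r"
        by (rule holomorphic_on_subset[OF holomorphic_riemann_zeta]) (use ne1 in auto)
      show "ln X > 0" using X by simp
      have "norm (w - c) = 2 - Re w" using w by (simp add: c_def cmod_def)
      then show "norm (w - c) \<le> q * r" using w q by simp
      fix z assume z: "z \<in> ball c r"
      have "norm (riemann_zeta z) \<le> C0 * norm z" using ball[OF z] by (intro C0) auto
      also have "\<dots> < C0 * (\<bar>Im w\<bar> + 4)" using ball[OF z] C0(1) by simp
      also have "\<dots> \<le> C0 * (\<bar>Im w\<bar> + 4) * (B * norm (riemann_zeta c))" using mult_left_mono[OF zc', of "C0 * (\<bar>Im w\<bar> + 4)"] C0(1) by simp
      also have "\<dots> = (C0 * B) * ((\<bar>Im w\<bar> + 4) * norm (riemann_zeta c))" by simp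
      also have "\<dots> \<le> C1 * ((\<bar>Im w\<bar> + 4) * norm (riemann_zeta c))" by (intro mult_right_mono C1) auto
      also have "\<dots> = exp (ln X) * norm (riemann_zeta c)" using X by (simp add: X_def)
      finally show "norm (riemann_zeta z) < exp (ln X) * norm (riemann_zeta c)" .
    qed (use q in auto)
    moreover have "exp (- (2 * ln X * q / (1 - q))) \<ge> inverse (X ^ m)"
    proof -
      have "2 * ln X * q / (1 - q) = ln X * (2 * q / (1 - q))" by simp
      also have "\<dots> \<le> ln X * real m" using X by (intro mult_left_mono m) auto
      finally have "exp (- (ln X * real m)) \<le> exp (- (2 * ln X * q / (1 - q)))" by simp
      moreover have "exp (ln X * real m) = X ^ m" using X by (simp add: exp_of_nat2_mult)
      ultimately show ?thesis by (simp add: exp_minus)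
    qed
    ultimately have "norm (riemann_zeta c) * inverse (X ^ m) \<le> norm (riemann_zeta w)"
      using order_trans[OF mult_left_mono[of "inverse (X ^ m)" _ "norm (riemann_zeta c)"]] by simp
    then have "norm (riemann_zeta c) \<le> norm (riemann_zeta w) * X ^ m" using X by (simp add: field_simps)
    from mult_left_mono[OF this, of B] have "1 \<le> B * (norm (riemann_zeta w) * X ^ m)" using zc' B(1) by linarith
    moreover have "w \<noteq> 1" using w by auto
    moreover from this have "riemann_zeta w \<noteq> 0" using riemann_hypothesis_zeta_entire_nonzero[OF RH, of w] w \<eta> by (simp add: zeta_entire_nonzero_iff)
    ultimately show ?thesis unfolding X_def[symmetric] by (simp add: inv_zeta_eq norm_divide field_simps)
  qed
  have "norm (inv_zeta w) \<le> (\<bar>D\<bar> + B + B * C1 ^ m) * (\<bar>Im w\<bar> + 4) ^ m" if w: "Re w \<ge> 1/2 + \<eta>" for w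
  proof -
    have one: "(\<bar>Im w\<bar> + 4) ^ m \<ge> 1" by (rule one_le_power) simp
    have BC: "B * C1 ^ m \<ge> 0" using B(1) C1(1) by simp
    have "\<bar>D\<bar> + B + B * C1 ^ m \<ge> 0" using B(1) BC by linarith
    from mult_left_mono[OF one this] have "\<bar>D\<bar> + B + B * C1 ^ m \<le> (\<bar>D\<bar> + B + B * C1 ^ m) * (\<bar>Im w\<bar> + 4) ^ m"
      by (simp only: mult_1_right)
    note lift = order_trans[OF _ this]
    consider "Re w \<ge> 2" | "Re w \<le> 2" "\<bar>Im w\<bar> \<le> 3" | "Re w \<le> 2" "\<bar>Im w\<bar> \<ge> 3" by linarith
    then show ?thesis
    proof cases
      case 1
      show ?thesis by (rule lift) (use B(2)[OF 1] BC in linarith)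
    next
      case 2
      then have "w \<in> K" using w by (auto simp: K_def in_cbox_complex_iff)
      show ?thesis by (rule lift) (use D[OF \<open>w \<in> K\<close>] B(1) BC in linarith)
    next
      case 3
      have "norm (inv_zeta w) \<le> (B * C1 ^ m) * (\<bar>Im w\<bar> + 4) ^ m" using far[OF w 3] by (simp add: power_mult_distrib mult.assoc)
      also have "\<dots> \<le> (\<bar>D\<bar> + B + B * C1 ^ m) * (\<bar>Im w\<bar> + 4) ^ m" using B(1) by (intro mult_right_mono) auto
      finally show ?thesis .
    qed
  qed
  moreover have "\<bar>D\<bar> + B + B * C1 ^ m > 0" using B(1) C1(1) by (intro add_pos_nonneg add_nonneg_pos) auto
  ultimately show ?thesis by blast
qed

section \<open>From the Riemann hypothesis to the bound\<close>

lemma moebius_term_of_real: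
  "moebius_term (of_real r) (Suc n) = of_real (moebius_mu (Suc n) / real (Suc n) powr r)"
  using powr_of_real[of "real (Suc n)" r] by (simp add: moebius_term_def zeta_term_def)

text \<open>For r > 1 this is absolute convergence. At r = 1 it is Newman's theorem, and the value 0
  given to \<open>inv_zeta\<close> at 1 is the right one.\<close>

lemma inv_zeta_sums_of_real:
  assumes "r \<ge> 1"
  shows "(\<lambda>n. moebius_term (of_real r) (Suc n)) sums inv_zeta (of_real r)"
proof (cases "r = 1")
  case True
  have "(\<lambda>n. complex_of_real (moebius_mu (Suc n) / real (Suc n))) sums of_real 0"
    by (rule sums_of_real[OF moebius_over_n_sums])
  then show ?thesis unfolding moebius_term_of_real using True by (simp add: inv_zeta_def)
qed (use assms in \<open>simp add: inv_zeta_sums\<close>)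

lemma summable_inverse_Suc_square: "summable (\<lambda>n. 1 / (real (Suc n))\<^sup>2)"
  using inverse_power_summable[of 2, where ?'a = real] summable_Suc_iff[of "\<lambda>n. inverse (real n ^ 2)"] by (simp add: inverse_eq_divide)

text \<open>Each exponential is replaced by its Taylor polynomial of degree N. The j-th Taylor terms
  sum over n to 1/zeta at k + 2 j, and one factor 1/n^2 kept from the remainder makes the error
  absolutely summable. Conditional convergence is thus confined to j = 0 at k = 1.\<close>

lemma P_taylor:
  assumes k: "k \<ge> 1" and x: "x \<ge> 0"
  shows "(\<lambda>n. moebius_mu (Suc n) / real (Suc n) powr k * exp (- x / (real (Suc n))\<^sup>2)) sums P k x"
    "norm (of_real (P k x) - (\<Sum>j\<le>N. of_real ((- x) ^ j / fact j) * inv_zeta (of_real (k + 2 * real j))))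
       \<le> exp x * x ^ Suc N / fact N * (\<Sum>n. 1 / (real (Suc n))\<^sup>2)"
proof -
  define c where "c = (\<lambda>n. moebius_mu (Suc n) / real (Suc n) powr k)"
  define y where "y = (\<lambda>n. x / (real (Suc n))\<^sup>2)"
  define T where "T = (\<lambda>n. \<Sum>j\<le>N. (- y n) ^ j / fact j)"
  define A where "A = (\<Sum>j\<le>N. complex_of_real ((- x) ^ j / fact j) * inv_zeta (of_real (k + 2 * real j)))"
  define D where "D = exp x * x ^ Suc N / fact N"
  note smB = summable_inverse_Suc_square
  have D: "D \<ge> 0" using x by (simp add: D_def)
  have y: "0 \<le> y n" "y n \<le> x" "y n ^ Suc N \<le> x ^ Suc N * (1 / (real (Suc n))\<^sup>2)" for n
  proof -
    have m: "(real (Suc n))\<^sup>2 \<ge> 1" by (rule one_le_power) simp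
    show "0 \<le> y n" using x by (simp add: y_def)
    show "y n \<le> x" unfolding y_def using divide_left_mono[of 1 "(real (Suc n))\<^sup>2" x] x m by simp
    have "(1 / (real (Suc n))\<^sup>2) ^ Suc N \<le> (1 / (real (Suc n))\<^sup>2) ^ 1" using m by (intro power_decreasing) auto
    then have "x ^ Suc N * (1 / (real (Suc n))\<^sup>2) ^ Suc N \<le> x ^ Suc N * (1 / (real (Suc n))\<^sup>2)"
      using x by (intro mult_left_mono) auto
    then show "y n ^ Suc N \<le> x ^ Suc N * (1 / (real (Suc n))\<^sup>2)" unfolding power_mult_distrib[symmetric] by (simp add: y_def)
  qed
  have c: "\<bar>c n\<bar> \<le> 1" for n
  proof -
    have "real (Suc n) powr k \<ge> 1" using k by (intro ge_one_powr_ge_zero) auto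
    then show ?thesis using abs_moebius_mu_le[of "Suc n"] unfolding c_def abs_divide
      by (subst divide_le_eq) auto
  qed
  have rem: "norm (complex_of_real (c n * (exp (- y n) - T n))) \<le> D * (1 / (real (Suc n))\<^sup>2)" for n
  proof -
    have "\<bar>exp (- y n) - T n\<bar> \<le> exp (norm (- y n)) * (norm (- y n) ^ Suc N) / fact N"
      using Taylor_exp_field[of "- y n" N] by (simp add: T_def)
    also have "\<dots> \<le> exp x * (x ^ Suc N * (1 / (real (Suc n))\<^sup>2)) / fact N"
      using y[of n] by (intro divide_right_mono mult_mono) auto
    also have "\<dots> = D * (1 / (real (Suc n))\<^sup>2)" by (simp add: D_def)
    finally have "\<bar>exp (- y n) - T n\<bar> \<le> D * (1 / (real (Suc n))\<^sup>2)" .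
    from mult_mono[OF c[of n] this] show ?thesis unfolding norm_of_real abs_mult by simp
  qed
  have smr: "summable (\<lambda>n. D * (1 / (real (Suc n))\<^sup>2))" by (intro summable_mult smB)
  define V where "V = (\<Sum>n. complex_of_real (c n * (exp (- y n) - T n)))"
  have S2: "(\<lambda>n. complex_of_real (c n * (exp (- y n) - T n))) sums V"
    unfolding V_def by (intro summable_sums summable_comparison_test'[OF smr rem])
  have Vb: "norm V \<le> D * (\<Sum>n. 1 / (real (Suc n))\<^sup>2)"
    unfolding V_def suminf_mult[OF smB, symmetric] by (rule norm_suminf_le[OF rem smr])
  have S1: "(\<lambda>n. \<Sum>j\<le>N. complex_of_real ((- x) ^ j / fact j) * moebius_term (of_real (k + 2 * real j)) (Suc n)) sums A"
    unfolding A_def by (intro sums_sum sums_mult inv_zeta_sums_of_real) (use k in auto)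
  have T_eq: "(\<Sum>j\<le>N. complex_of_real ((- x) ^ j / fact j) * moebius_term (of_real (k + 2 * real j)) (Suc n)) = of_real (c n * T n)" for n
  proof -
    have "complex_of_real ((- x) ^ j / fact j) * moebius_term (of_real (k + 2 * real j)) (Suc n) = of_real (c n * ((- y n) ^ j / fact j))" for j
    proof -
      have "real (Suc n) powr (k + 2 * real j) = real (Suc n) powr k * ((real (Suc n))\<^sup>2) ^ j"
      proof -
        have "real (Suc n) powr (2 * real j) = real (Suc n) ^ (2 * j)"
          using powr_realpow[of "real (Suc n)" "2 * j"] by (simp del: of_nat_Suc)
        then show ?thesis by (simp only: powr_add power_mult)
      qed
      moreover have "(- y n) ^ j = (- x) ^ j / ((real (Suc n))\<^sup>2) ^ j" unfolding y_def minus_divide_left power_divide ..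
      ultimately have "(- x) ^ j / fact j * (moebius_mu (Suc n) / real (Suc n) powr (k + 2 * real j)) = c n * ((- y n) ^ j / fact j)"
        by (simp only: c_def) (simp add: mult_ac)
      then show ?thesis unfolding moebius_term_of_real of_real_mult[symmetric] by (simp only:)
    qed
    then show ?thesis by (simp only: T_def sum_distrib_left of_real_sum)
  qed
  from sums_add[OF S1[unfolded T_eq] S2]
  have "(\<lambda>n. complex_of_real (c n * exp (- y n))) sums (A + V)" by (simp add: algebra_simps)
  then have "(\<lambda>n. complex_of_real (moebius_mu (Suc n) / real (Suc n) powr k * exp (- x / (real (Suc n))\<^sup>2))) sums (A + V)"
    unfolding c_def y_def minus_divide_left .
  then have re: "(\<lambda>n. moebius_mu (Suc n) / real (Suc n) powr k * exp (- x / (real (Suc n))\<^sup>2)) sums Re (A + V)"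
    and S: "(\<lambda>n. complex_of_real (moebius_mu (Suc n) / real (Suc n) powr k * exp (- x / (real (Suc n))\<^sup>2))) sums (A + V)"
    using sums_Re by fastforce+
  show Ps: "(\<lambda>n. moebius_mu (Suc n) / real (Suc n) powr k * exp (- x / (real (Suc n))\<^sup>2)) sums P k x"
    unfolding P_def using re by (rule sums_summable[THEN summable_sums])
  have "of_real (P k x) = A + V" using sums_of_real[OF Ps] S sums_unique2 by blast
  then show "norm (of_real (P k x) - (\<Sum>j\<le>N. of_real ((- x) ^ j / fact j) * inv_zeta (of_real (k + 2 * real j))))
       \<le> exp x * x ^ Suc N / fact N * (\<Sum>n. 1 / (real (Suc n))\<^sup>2)"
    using Vb unfolding A_def[symmetric] D_def[symmetric] by simp
qed

section \<open>Decay of the Gamma function on lines and in strips\<close>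

lemma norm_Gamma_le:
  assumes "Re s > 0"
  shows "norm (Gamma s) \<le> Gamma (Re s)"
proof -
  have i: "((\<lambda>t. complex_of_real t powr (s - 1) / of_real (exp t)) has_integral Gamma s) {0..}" by (rule Gamma_integral_complex[OF assms])
  have j: "((\<lambda>t. t powr (Re s - 1) / exp t) has_integral Gamma (Re s)) {0..}" by (rule Gamma_integral_real[OF assms])
  have "norm (integral {0..} (\<lambda>t. complex_of_real t powr (s - 1) / of_real (exp t))) \<le> integral {0..} (\<lambda>t. t powr (Re s - 1) / exp t)"
  proof (rule integral_norm_bound_integral)
    fix t :: real assume "t \<in> {0..}"
    then show "norm (complex_of_real t powr (s - 1) / of_real (exp t)) \<le> t powr (Re s - 1) / exp t"
      by (cases "t = 0") (auto simp: norm_divide norm_of_real_powr)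
  qed (use i j in auto)
  then show ?thesis using i j by (simp add: has_integral_iff)
qed

lemma norm_Gamma_mult_pochhammer:
  assumes "s \<notin> \<int>\<^sub>\<le>\<^sub>0"
  shows "norm (Gamma s) * (\<Prod>i<n. norm (s + of_nat i)) = norm (Gamma (s + of_nat n))"
proof -
  have "Gamma s * pochhammer s n = Gamma (s + of_nat n)"
    using pochhammer_Gamma[OF assms, of n] assms Gamma_eq_zero_iff[of s] by simp
  then have "norm (Gamma s) * norm (pochhammer s n) = norm (Gamma (s + of_nat n))" by (metis norm_mult)
  then show ?thesis by (simp add: pochhammer_prod prod_norm atLeast0LessThan)
qed

text \<open>A substitute for Stirling's formula: Gamma(s) times q linear factors is Gamma(s + q),
  which is bounded by its value on the real axis, and each factor is at least a multiple of 1 + |Im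
  s|. Decay of arbitrary polynomial order is enough against the polynomial bound for 1/zeta.\<close>

lemma norm_Gamma_vertical_bound:
  assumes a: "a > 0"
  shows "\<exists>C>0. \<forall>s. Re s = a \<longrightarrow> norm (Gamma s) * (1 + \<bar>Im s\<bar>) ^ q \<le> C"
proof -
  \<comment> \<open>Adding a <= |s + i| and a |Im s| <= a |s + i| gives a (1 + |Im s|) <= (1 + a) |s
    + i|, for every index i.\<close>
  define \<alpha> where "\<alpha> = (1 + a) / a"
  have \<alpha>: "\<alpha> > 0" using a by (simp add: \<alpha>_def)
  have G: "Gamma (a + real q) > 0" using a by (intro Gamma_real_pos) auto
  have "norm (Gamma s) * (1 + \<bar>Im s\<bar>) ^ q \<le> \<alpha> ^ q * Gamma (a + real q)" if s: "Re s = a" for s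
  proof -
    have ni: "s \<notin> \<int>\<^sub>\<le>\<^sub>0" using s a by (auto elim!: nonpos_Ints_cases)
    have "1 + \<bar>Im s\<bar> \<le> \<alpha> * norm (s + of_nat i)" for i
    proof -
      have "a \<le> norm (s + of_nat i)" "\<bar>Im s\<bar> \<le> norm (s + of_nat i)"
        using abs_Re_le_cmod[of "s + of_nat i"] abs_Im_le_cmod[of "s + of_nat i"] s a by auto
      then have "a + a * \<bar>Im s\<bar> \<le> norm (s + of_nat i) + a * norm (s + of_nat i)" using a by (intro add_mono mult_left_mono) auto
      then show ?thesis using a by (simp add: \<alpha>_def field_simps)
    qed
    then have "(\<Prod>i<q. 1 + \<bar>Im s\<bar>) \<le> (\<Prod>i<q. \<alpha> * norm (s + of_nat i))" by (intro prod_mono) auto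
    then have "norm (Gamma s) * (1 + \<bar>Im s\<bar>) ^ q \<le> norm (Gamma s) * (\<alpha> ^ q * (\<Prod>i<q. norm (s + of_nat i)))"
      by (intro mult_left_mono) (simp_all add: prod.distrib)
    also have "\<dots> = \<alpha> ^ q * norm (Gamma (s + of_nat q))" using norm_Gamma_mult_pochhammer[OF ni, of q] by (simp add: mult_ac)
    also have "\<dots> \<le> \<alpha> ^ q * Gamma (a + real q)"
      using norm_Gamma_le[of "s + of_nat q"] s a \<alpha> by (intro mult_left_mono) auto
    finally show ?thesis .
  qed
  moreover have "\<alpha> ^ q * Gamma (a + real q) > 0" using \<alpha> G by simp
  ultimately show ?thesis by blast
qed

text \<open>These abscissas run midway between the poles. Shifting by N + 1 leads to the line Re s =
  1/2, and the linear factors multiply to at least N!/2. The factor 1/N! is what makes the left side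
  of the contour disappear for fixed x.\<close>

lemma norm_Gamma_left_bound:
  "\<exists>C>0. \<forall>N s. Re s = - real N - 1/2 \<longrightarrow> norm (Gamma s) * (1 + \<bar>Im s\<bar>) ^ q \<le> C / fact N"
proof -
  obtain C where C: "C > 0" "\<And>s. Re s = 1/2 \<Longrightarrow> norm (Gamma s) * (1 + \<bar>Im s\<bar>) ^ q \<le> C"
    using norm_Gamma_vertical_bound[of "1/2" q] by auto
  have "norm (Gamma s) * (1 + \<bar>Im s\<bar>) ^ q \<le> 2 * C / fact N" if s: "Re s = - real N - 1/2" for N s
  proof -
    have ni: "s \<notin> \<int>\<^sub>\<le>\<^sub>0"
    proof
      assume "s \<in> \<int>\<^sub>\<le>\<^sub>0"
      then obtain n where "s = of_int n" by (elim nonpos_Ints_cases)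
      then have "of_int (2 * n + 2 * int N + 1) = (0::real)" using s by simp
      then show False by (metis of_int_eq_0_iff even_add even_mult_iff even_zero odd_one even_numeral)
    qed
    have pr: "fact N / 2 \<le> (\<Prod>i<Suc N. norm (s + of_nat i))"
    proof -
      have "fact N / 2 \<le> (\<Prod>i<Suc N. real i + 1/2)"
      proof (induction N)
        case (Suc N)
        have "fact (Suc N) / 2 = (fact N / 2) * real (Suc N)" by simp
        also have "\<dots> \<le> (\<Prod>i<Suc N. real i + 1/2) * (real (Suc N) + 1/2)" by (intro mult_mono Suc.IH prod_nonneg) auto
        finally show ?case by (simp only: prod.lessThan_Suc)
      qed simp
      \<comment> \<open>The order is reversed because |s + i| is at least N - i + 1/2: the factors
        shrink as i grows.\<close>
      also have "\<dots> = (\<Prod>i<Suc N. real (Suc N - Suc i) + 1/2)" by (rule prod.nat_diff_reindex[symmetric])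
      also have "\<dots> \<le> (\<Prod>i<Suc N. norm (s + of_nat i))"
      proof (rule prod_mono, safe)
        fix i assume "i < Suc N"
        then have "real (Suc N - Suc i) + 1/2 = - Re (s + of_nat i)" using s by (simp add: of_nat_diff)
        then show "real (Suc N - Suc i) + 1/2 \<le> norm (s + of_nat i)" using abs_Re_le_cmod[of "s + of_nat i"] by linarith
      qed auto
      finally show ?thesis .
    qed
    have "norm (Gamma s) * (1 + \<bar>Im s\<bar>) ^ q * (fact N / 2) \<le> norm (Gamma s) * (1 + \<bar>Im s\<bar>) ^ q * (\<Prod>i<Suc N. norm (s + of_nat i))"
      by (intro mult_left_mono pr) auto
    also have "\<dots> = norm (Gamma (s + of_nat (Suc N))) * (1 + \<bar>Im (s + of_nat (Suc N))\<bar>) ^ q"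
      using norm_Gamma_mult_pochhammer[OF ni, of "Suc N"] by (simp add: mult_ac)
    also have "\<dots> \<le> C" by (rule C(2)) (use s in simp)
    finally show ?thesis by (simp add: field_simps)
  qed
  then show ?thesis using C(1) by (intro exI[of _ "2 * C"]) auto
qed

text \<open>Controls the horizontal sides of the rectangle. The shift by n moves the whole strip to
  real parts at least 1, where Gamma is bounded by its values on a compact real interval.\<close>

lemma norm_Gamma_horizontal_bound:
  assumes lo: "lo + real n \<ge> 1"
  shows "\<exists>C>0. \<forall>s. lo \<le> Re s \<longrightarrow> Re s \<le> hi \<longrightarrow> \<bar>Im s\<bar> \<ge> 1 \<longrightarrow> norm (Gamma s) * \<bar>Im s\<bar> ^ n \<le> C"
proof -
  have "continuous_on {lo + real n..hi + real n} (Gamma :: real \<Rightarrow> real)"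
    by (intro continuous_on_Gamma continuous_on_id) (use lo in \<open>auto elim!: nonpos_Ints_cases\<close>)
  then have "compact (Gamma ` {lo + real n..hi + real n})" by (intro compact_continuous_image) auto
  then obtain D where D: "\<And>y. y \<in> {lo + real n..hi + real n} \<Longrightarrow> \<bar>Gamma y\<bar> \<le> D"
    using compact_imp_bounded bounded_iff by (metis image_eqI real_norm_def)
  have "norm (Gamma s) * \<bar>Im s\<bar> ^ n \<le> \<bar>D\<bar> + 1" if s: "lo \<le> Re s" "Re s \<le> hi" "\<bar>Im s\<bar> \<ge> 1" for s
  proof -
    have ni: "s \<notin> \<int>\<^sub>\<le>\<^sub>0" using s by (auto elim!: nonpos_Ints_cases)
    have "(\<Prod>i<n. \<bar>Im s\<bar>) \<le> (\<Prod>i<n. norm (s + of_nat i))"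
      by (intro prod_mono) (use abs_Im_le_cmod[of "s + of_nat _"] in auto)
    then have "norm (Gamma s) * \<bar>Im s\<bar> ^ n \<le> norm (Gamma s) * (\<Prod>i<n. norm (s + of_nat i))" by (intro mult_left_mono) auto
    also have "\<dots> = norm (Gamma (s + of_nat n))" by (rule norm_Gamma_mult_pochhammer[OF ni])
    also have "\<dots> \<le> Gamma (Re s + real n)" using norm_Gamma_le[of "s + of_nat n"] s lo by simp
    also have "\<dots> \<le> D" using D[of "Re s + real n"] s by simp
    finally show ?thesis by simp
  qed
  then show ?thesis by (intro exI[of _ "\<bar>D\<bar> + 1"]) auto
qed

text \<open>The integral of 1/(1 + t^2) is at most pi whatever T is, so the height can go to
  infinity with the vertical sides under control.\<close>

lemma contour_integral_vertical_bound:
  assumes f: "f contour_integrable_on linepath (Complex \<sigma> (- T)) (Complex \<sigma> T)" and T: "T > 0"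
    and le: "\<And>t. norm (f (Complex \<sigma> t)) \<le> C / (1 + t\<^sup>2)" and C: "C \<ge> 0"
  shows "norm (contour_integral (linepath (Complex \<sigma> (- T)) (Complex \<sigma> T)) f) \<le> C * pi"
proof -
  let ?I = "contour_integral (linepath (Complex \<sigma> (- T)) (Complex \<sigma> T)) f"
  have eq: "?I = \<i> * integral {-T..T} (\<lambda>x. f (Complex \<sigma> x))"
    by (rule contour_integral_linepath_same_Re) (use T in auto)
  have J: "((\<lambda>t. C / (1 + t\<^sup>2)) has_integral (C * arctan T - C * arctan (- T))) {-T..T}"
  proof (rule fundamental_theorem_of_calculus)
    fix t :: real
    have "1 + t\<^sup>2 \<noteq> 0" by (metis add_nonneg_eq_0_iff zero_le_one zero_le_power2 zero_neq_one)
    then show "((\<lambda>t. C * arctan t) has_vector_derivative C / (1 + t\<^sup>2)) (at t within {-T..T})"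
      unfolding has_real_derivative_iff_has_vector_derivative[symmetric] by (auto intro!: derivative_eq_intros simp: field_simps)
  qed (use T in auto)
  have i: "(\<lambda>x. f (Complex \<sigma> x)) integrable_on {-T..T}"
  proof (rule ccontr)
    assume "\<not> (\<lambda>x. f (Complex \<sigma> x)) integrable_on {-T..T}"
    moreover have "(f has_contour_integral ?I) (linepath (Complex \<sigma> (- T)) (Complex \<sigma> T))" using f by (rule has_contour_integral_integral)
    ultimately show False
      using has_contour_integral_linepath_same_Re_iff[of "Complex \<sigma> (- T)" \<sigma> "Complex \<sigma> T" "-T" T f ?I] T by (auto simp: integrable_on_def)
  qed
  have "norm ?I \<le> integral {-T..T} (\<lambda>t. C / (1 + t\<^sup>2))"
    unfolding eq norm_mult norm_ii mult_1_left
    by (rule integral_norm_bound_integral[OF i]) (use J le in auto)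
  also have "\<dots> = C * (2 * arctan T)" using J by (simp add: has_integral_iff arctan_minus algebra_simps)
  also have "\<dots> \<le> C * pi" using arctan_ubound[of T] C by (intro mult_left_mono) auto
  finally show ?thesis .
qed

text \<open>The residue theorem on the rectangle between Re s = - N - 1/2 and Re s = a expresses 2
  pi i times the sum by the four sides. As the height grows the horizontal sides vanish, while each
  vertical side is at most pi times its constant; dividing by pi leaves the factor 2.\<close>

lemma riesz_contour_estimate:
  fixes k x \<epsilon> :: real and f :: "complex \<Rightarrow> complex"
  assumes RH: "riemann_hypothesis" and k: "k \<ge> 1" and \<epsilon>: "0 < \<epsilon>" "\<epsilon> < 1/4" and x: "x \<ge> 1"
  defines "a \<equiv> k / 2 - 1/4 - \<epsilon>"
  defines "f \<equiv> \<lambda>s. Gamma s * inv_zeta (of_real k - 2 * s) * exp (- s * of_real (ln x))"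
  assumes C2: "C2 \<ge> 0" "\<And>s. Re s \<le> a \<Longrightarrow> norm (inv_zeta (of_real k - 2 * s)) \<le> C2 * (1 + \<bar>Im s\<bar>) ^ m"
    and CR: "CR \<ge> 0" "\<And>s. Re s = a \<Longrightarrow> norm (Gamma s) * (1 + \<bar>Im s\<bar>) ^ (m + 2) \<le> CR"
    and CL: "CL \<ge> 0" "\<And>N s. Re s = - real N - 1/2 \<Longrightarrow> norm (Gamma s) * (1 + \<bar>Im s\<bar>) ^ (m + 2) \<le> CL / fact N"
  shows "2 * norm (\<Sum>j\<le>N. of_real ((- x) ^ j / fact j) * inv_zeta (of_real (k + 2 * real j)))
     \<le> C2 * CR * exp (- a * ln x) + C2 * (CL / fact N) * exp ((real N + 1/2) * ln x)"
proof -
  define lo where "lo = - real N - 1/2"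
  \<comment> \<open>The right boundary a + \<epsilon> = k/2 - 1/4 corresponds to Re (k - 2 s) = 1/2,
    so 1/zeta is holomorphic on \<open>S\<close>. The left boundary - N - 3/4 leaves room for the
    side at - N - 1/2 and excludes the pole at - N - 1.\<close>
  define S where "S = {s. Re s < a + \<epsilon>} \<inter> {s. Re s > - real N - 3/4}"
  define pts where "pts = (\<lambda>j. - complex_of_nat j) ` {..N}"
  define AN where "AN = (\<Sum>j\<le>N. complex_of_real ((- x) ^ j / fact j) * inv_zeta (of_real (k + 2 * real j)))"
  have a: "a > 0" using k \<epsilon> by (simp add: a_def)
  have lnx: "ln x \<ge> 0" using x by simp
  have openS: "open S" unfolding S_def by (intro open_Int open_halfspace_Re_lt open_halfspace_Re_gt)
  have connS: "connected S" unfolding S_def by (intro convex_connected convex_Int convex_halfspace_Re_lt convex_halfspace_Re_gt)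
  have holH: "(\<lambda>s. inv_zeta (of_real k - 2 * s) * exp (- s * of_real (ln x))) holomorphic_on S"
  proof -
    have "(\<lambda>s. zeta_entire (of_real k - 2 * s)) holomorphic_on S"
      by (intro holomorphic_on_compose_gen[OF _ holomorphic_zeta_entire[of UNIV], unfolded o_def] holomorphic_intros) auto
    moreover have "zeta_entire (of_real k - 2 * s) \<noteq> 0" if "s \<in> S" for s
      using that by (intro riemann_hypothesis_zeta_entire_nonzero[OF RH]) (auto simp: S_def a_def)
    ultimately show ?thesis unfolding inv_zeta_def by (intro holomorphic_intros) auto
  qed
  have ptsI: "s \<in> pts" if sS: "s \<in> S" and sZ: "s \<in> \<int>\<^sub>\<le>\<^sub>0" for s
  proof -
    obtain n where n: "s = - of_nat n" using sZ by (elim nonpos_Ints_cases')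
    then have "real n < real N + 3/4" using sS by (simp add: S_def)
    then have "n \<le> N" by linarith
    then show ?thesis using n by (auto simp: pts_def)
  qed
  have holf: "f holomorphic_on S - pts"
  proof -
    have G: "Gamma holomorphic_on S - pts" by (rule holomorphic_Gamma) (use ptsI in auto)
    have "(\<lambda>s. Gamma s * (inv_zeta (of_real k - 2 * s) * exp (- s * of_real (ln x)))) holomorphic_on S - pts"
      by (rule holomorphic_on_mult[OF G holomorphic_on_subset[OF holH]]) auto
    then show ?thesis by (simp add: f_def mult.assoc)
  qed
  have fin: "finite pts" by (simp add: pts_def)
  \<comment> \<open>Computed as the limit of f(s)(s + j), which also covers k = 1 and j = 0: there
    \<open>inv_zeta\<close> vanishes and the residue is 0.\<close>
  have res: "residue f (- of_nat j) = of_real ((- x) ^ j / fact j) * inv_zeta (of_real (k + 2 * real j))" if j: "j \<le> N" for j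
  proof (rule residue_simple')
    define p where "p = - complex_of_nat j"
    show "open (S - (pts - {- of_nat j}))" by (intro open_Diff openS finite_imp_closed) (use fin in auto)
    have pS: "p \<in> S" using j a \<epsilon> by (auto simp: S_def p_def)
    then show "- of_nat j \<in> S - (pts - {- of_nat j})" by (simp add: p_def)
    show "f holomorphic_on S - (pts - {- of_nat j}) - {- of_nat j}" by (rule holomorphic_on_subset[OF holf]) auto
    have "isCont (\<lambda>s. inv_zeta (of_real k - 2 * s) * exp (- s * of_real (ln x))) p"
      using holomorphic_on_imp_continuous_on[OF holH] pS openS by (simp add: continuous_on_eq_continuous_at)
    then have "((\<lambda>s. inv_zeta (of_real k - 2 * s) * exp (- s * of_real (ln x))) \<longlongrightarrow> inv_zeta (of_real k - 2 * p) * exp (- p * of_real (ln x))) (at p)"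
      by (simp add: isCont_def)
    moreover have "((\<lambda>z. Gamma z * (z + of_nat j)) \<longlongrightarrow> (-1) ^ j / fact j) (at p)"
      unfolding p_def by (rule Gamma_residues)
    ultimately have "((\<lambda>s. (Gamma s * (s + of_nat j)) * (inv_zeta (of_real k - 2 * s) * exp (- s * of_real (ln x)))) \<longlongrightarrow>
      (-1) ^ j / fact j * (inv_zeta (of_real k - 2 * p) * exp (- p * of_real (ln x)))) (at p)"
      by (rule tendsto_mult[rotated])
    moreover have "(\<lambda>s. (Gamma s * (s + of_nat j)) * (inv_zeta (of_real k - 2 * s) * exp (- s * of_real (ln x)))) = (\<lambda>s. f s * (s - p))"
      by (simp only: f_def p_def diff_minus_eq_add mult_ac)
    ultimately
    have "((\<lambda>s. f s * (s - p)) \<longlongrightarrow> (-1) ^ j / fact j * (inv_zeta (of_real k - 2 * p) * exp (- p * of_real (ln x)))) (at p)"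
      by (simp only:)
    also have "(-1) ^ j / fact j * (inv_zeta (of_real k - 2 * p) * exp (- p * of_real (ln x))) = of_real ((- x) ^ j / fact j) * inv_zeta (of_real (k + 2 * real j))"
    proof -
      have "exp (- p * of_real (ln x)) = complex_of_real (x ^ j)"
      proof -
        have "- p * of_real (ln x) = complex_of_real (real j * ln x)" by (simp add: p_def)
        also have "exp (complex_of_real (real j * ln x)) = of_real (exp (real j * ln x))" by (rule exp_of_real)
        also have "exp (real j * ln x) = x ^ j" using x by (simp add: exp_of_nat_mult)
        finally show ?thesis .
      qed
      moreover have "of_real k - 2 * p = of_real (k + 2 * real j)" by (simp add: p_def)
      moreover have "(- x) ^ j = (-1) ^ j * x ^ j" by (rule power_minus)
      ultimately show ?thesis by (simp only:) simp
    qed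
    finally show "((\<lambda>w. f w * (w - - of_nat j)) \<longlongrightarrow> of_real ((- x) ^ j / fact j) * inv_zeta (of_real (k + 2 * real j))) (at (- of_nat j))"
      by (simp only: p_def)
  qed
  \<comment> \<open>The shift N + m + 2 takes the left edge to real part m + 3/2. Beyond the m
    powers consumed by the bound for 1/zeta it leaves at least one power of the height to
    spare.\<close>
  obtain CH where CH: "CH > 0" "\<And>s. lo \<le> Re s \<Longrightarrow> Re s \<le> a \<Longrightarrow> \<bar>Im s\<bar> \<ge> 1 \<Longrightarrow> norm (Gamma s) * \<bar>Im s\<bar> ^ (N + m + 2) \<le> CH"
    using norm_Gamma_horizontal_bound[of lo "N + m + 2" a] by (auto simp: lo_def)
  have nf: "norm (f s) = norm (Gamma s) * norm (inv_zeta (of_real k - 2 * s)) * exp (- Re s * ln x)" for s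
    by (simp add: f_def norm_mult)
  have vert: "norm (f (Complex \<sigma> t)) \<le> C2 * C * exp (- \<sigma> * ln x) / (1 + t\<^sup>2)"
    if \<sigma>: "\<sigma> \<le> a" and C: "norm (Gamma (Complex \<sigma> t)) * (1 + \<bar>t\<bar>) ^ (m + 2) \<le> C" for \<sigma> t C
  proof -
    have t: "0 < 1 + t\<^sup>2" "1 + t\<^sup>2 \<le> (1 + \<bar>t\<bar>)\<^sup>2" by (auto simp: power2_eq_square algebra_simps add_pos_nonneg)
    have "norm (f (Complex \<sigma> t)) * (1 + t\<^sup>2) \<le> (norm (Gamma (Complex \<sigma> t)) * (C2 * (1 + \<bar>t\<bar>) ^ m) * exp (- \<sigma> * ln x)) * (1 + \<bar>t\<bar>)\<^sup>2"
      unfolding nf using C2(2)[of "Complex \<sigma> t"] \<sigma> C2(1) t by (intro mult_mono mult_left_mono mult_right_mono) auto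
    also have "\<dots> = C2 * exp (- \<sigma> * ln x) * (norm (Gamma (Complex \<sigma> t)) * (1 + \<bar>t\<bar>) ^ (m + 2))"
      by (simp only: power_add) (simp only: mult_ac)
    also have "\<dots> \<le> C2 * exp (- \<sigma> * ln x) * C" using C2(1) by (intro mult_left_mono C) auto
    finally show ?thesis using t(1) by (simp only: pos_le_divide_eq) (simp only: mult_ac)
  qed
  define RB where "RB = C2 * CR * exp (- a * ln x)"
  define LB where "LB = C2 * (CL / fact N) * exp (- lo * ln x)"
  have RB: "RB \<ge> 0" and LB: "LB \<ge> 0" using C2 CR CL by (auto simp: RB_def LB_def)
  have CL': "norm (Gamma (Complex lo t)) * (1 + \<bar>t\<bar>) ^ (m + 2) \<le> CL / fact N" for t
    using CL(2)[of "Complex lo t" N] by (simp add: lo_def)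
  have CR': "norm (Gamma (Complex a t)) * (1 + \<bar>t\<bar>) ^ (m + 2) \<le> CR" for t
    using CR(2)[of "Complex a t"] by simp
  have loa: "lo < a" using a by (simp add: lo_def)
  \<comment> \<open>Depends on N and x but not on the height T, which is the only variable in the
    coming limit.\<close>
  define HB where "HB = CH * C2 * 2 ^ m * exp (- lo * ln x)"
  have hor: "norm (f s) \<le> HB / T" if s: "lo \<le> Re s" "Re s \<le> a" "\<bar>Im s\<bar> = T" and T: "T \<ge> 1" for s T
  proof -
    have "norm (f s) \<le> norm (Gamma s) * (C2 * (2 * T) ^ m) * exp (- lo * ln x)"
    proof -
      have "norm (inv_zeta (of_real k - 2 * s)) \<le> C2 * (1 + T) ^ m" using C2(2)[OF s(2)] s(3) by simp
      also have "\<dots> \<le> C2 * (2 * T) ^ m" using T C2(1) by (intro mult_left_mono power_mono) auto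
      finally show ?thesis unfolding nf using s(1) lnx C2(1) T by (intro mult_mono mult_left_mono) (auto intro: mult_right_mono)
    qed
    moreover have "norm (Gamma s) * T ^ m \<le> CH / T"
    proof -
      have "norm (Gamma s) * T ^ m * T \<le> norm (Gamma s) * T ^ (N + m + 2)"
        unfolding mult.assoc power_Suc2[symmetric] using T by (intro mult_left_mono power_increasing) auto
      also have "\<dots> \<le> CH" using CH(2)[of s] s T by simp
      finally show ?thesis using T by (simp add: pos_le_divide_eq)
    qed
    then have "C2 * 2 ^ m * exp (- lo * ln x) * (norm (Gamma s) * T ^ m) \<le> C2 * 2 ^ m * exp (- lo * ln x) * (CH / T)"
      using C2(1) by (intro mult_left_mono) auto
    ultimately show ?thesis by (simp add: HB_def power_mult_distrib mult_ac)
  qed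
  have est: "2 * norm AN * pi \<le> (RB + LB) * pi + 2 * (HB / T * (a - lo))" if T: "T \<ge> 1" for T
  proof -
    define z1 z2 z3 z4 where "z1 = Complex lo (- T)" and "z2 = Complex a (- T)" and "z3 = Complex a T" and "z4 = Complex lo T"
    have rp: "rectpath z1 z3 = linepath z1 z2 +++ linepath z2 z3 +++ linepath z3 z4 +++ linepath z4 z1"
      by (simp add: rectpath_def Let_def z1_def z2_def z3_def z4_def)
    have sub: "path_image (rectpath z1 z3) \<subseteq> S - pts"
    proof -
      have cb: "cbox z1 z3 \<subseteq> S" using \<epsilon> by (auto simp: S_def z1_def z3_def in_cbox_complex_iff lo_def)
      have "pts \<subseteq> box z1 z3" using T a by (auto simp: pts_def z1_def z3_def in_box_complex_iff lo_def)
      moreover have "path_image (rectpath z1 z3) = cbox z1 z3 - box z1 z3"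
        by (rule path_image_rectpath_cbox_minus_box) (use T loa in \<open>auto simp: z1_def z3_def\<close>)
      ultimately show ?thesis using cb by auto
    qed
    have "contour_integral (rectpath z1 z3) f = 2 * pi * \<i> * (\<Sum>p\<in>pts. winding_number (rectpath z1 z3) p * residue f p)"
    proof (rule Residue_theorem[OF openS connS fin holf _ _ sub])
      show "\<forall>z. z \<notin> S \<longrightarrow> winding_number (rectpath z1 z3) z = 0"
      proof (intro allI impI winding_number_rectpath_outside)
        fix z assume "z \<notin> S"
        moreover have "cbox z1 z3 \<subseteq> S" using \<epsilon> by (auto simp: S_def z1_def z3_def in_cbox_complex_iff lo_def)
        ultimately show "z \<notin> cbox z1 z3" by blast
      qed (use T loa in \<open>auto simp: z1_def z3_def\<close>)
    qed auto
    also have "(\<Sum>p\<in>pts. winding_number (rectpath z1 z3) p * residue f p) = (\<Sum>j\<le>N. winding_number (rectpath z1 z3) (- of_nat j) * residue f (- of_nat j))"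
      unfolding pts_def by (subst sum.reindex) (auto simp: inj_on_def)
    also have "\<dots> = AN" unfolding AN_def
    proof (rule sum.cong[OF refl])
      fix j assume j: "j \<in> {..N}"
      have "winding_number (rectpath z1 z3) (- of_nat j) = 1"
        by (rule winding_number_rectpath) (use j T a in \<open>auto simp: z1_def z3_def in_box_complex_iff lo_def\<close>)
      then show "winding_number (rectpath z1 z3) (- of_nat j) * residue f (- of_nat j) = of_real ((- x) ^ j / fact j) * inv_zeta (of_real (k + 2 * real j))"
        using res j by simp
    qed
    finally have total: "contour_integral (rectpath z1 z3) f = 2 * pi * \<i> * AN" .
    have openD: "open (S - pts)" by (intro open_Diff openS finite_imp_closed fin)
    have ci: "f contour_integrable_on linepath u v" if "path_image (linepath u v) \<subseteq> path_image (rectpath z1 z3)" for u v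
      by (rule contour_integrable_holomorphic_simple[OF holf openD]) (use that sub in auto)
    have pim: "path_image (rectpath z1 z3) = path_image (linepath z1 z2) \<union> (path_image (linepath z2 z3) \<union> (path_image (linepath z3 z4) \<union> path_image (linepath z4 z1)))"
      unfolding rp by (simp add: path_image_join)
    have c1: "f contour_integrable_on linepath z1 z2" and c2: "f contour_integrable_on linepath z2 z3"
      and c3: "f contour_integrable_on linepath z3 z4" and c4: "f contour_integrable_on linepath z4 z1"
      by (rule ci, unfold pim, blast)+
    have vp1: "valid_path (linepath z3 z4 +++ linepath z4 z1)" by (rule valid_path_join) auto
    have vp2: "valid_path (linepath z2 z3 +++ linepath z3 z4 +++ linepath z4 z1)" by (rule valid_path_join[OF _ vp1]) auto
    have "(f has_contour_integral (contour_integral (linepath z1 z2) f + (contour_integral (linepath z2 z3) f + (contour_integral (linepath z3 z4) f + contour_integral (linepath z4 z1) f)))) (rectpath z1 z3)"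
      unfolding rp by (intro has_contour_integral_join has_contour_integral_integral c1 c2 c3 c4 vp1 vp2) auto
    then have split: "contour_integral (rectpath z1 z3) f = contour_integral (linepath z1 z2) f + (contour_integral (linepath z2 z3) f + (contour_integral (linepath z3 z4) f + contour_integral (linepath z4 z1) f))"
      by (rule contour_integral_unique)
    have HB0: "HB / T \<ge> 0" using T CH(1) C2(1) by (simp add: HB_def)
    have seg: "lo \<le> Re z \<and> Re z \<le> a \<and> \<bar>Im z\<bar> = T"
      if uv: "z \<in> closed_segment u v" "{Re u, Re v} \<subseteq> {lo..a}" "Im u = Im v" "\<bar>Im u\<bar> = T" for z u v
    proof -
      obtain w where w: "0 \<le> w" "w \<le> 1" "z = (1 - w) *\<^sub>R u + w *\<^sub>R v" using uv(1) unfolding closed_segment_def by blast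
      have "Im z = (1 - w) * Im u + w * Im v" using w(3) by simp
      then have "Im z = Im u" using uv(3) by (simp add: algebra_simps)
      have "Re z = (1 - w) *\<^sub>R Re u + w *\<^sub>R Re v" using w by simp
      then have "Re z \<in> {lo..a}" using uv(2) w convexD_alt[of "{lo..a}" "Re u" "Re v" w] by auto
      with \<open>Im z = Im u\<close> show ?thesis using uv(4) by simp
    qed
    have hor_seg: "norm (f z) \<le> HB / T"
      if "z \<in> closed_segment u v" "{Re u, Re v} \<subseteq> {lo..a}" "Im u = Im v" "\<bar>Im u\<bar> = T" for z u v
      using seg[OF that] by (intro hor T) auto
    have b1: "norm (contour_integral (linepath z1 z2) f) \<le> HB / T * (a - lo)"
    proof -
      have "norm (contour_integral (linepath z1 z2) f) \<le> HB / T * norm (z2 - z1)"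
        by (rule contour_integral_bound_linepath[OF c1 HB0]) (rule hor_seg, assumption, use T loa in \<open>auto simp: z1_def z2_def\<close>)
      also have "norm (z2 - z1) = a - lo" using loa by (simp add: z1_def z2_def cmod_def)
      finally show ?thesis .
    qed
    have b3: "norm (contour_integral (linepath z3 z4) f) \<le> HB / T * (a - lo)"
    proof -
      have "norm (contour_integral (linepath z3 z4) f) \<le> HB / T * norm (z4 - z3)"
        by (rule contour_integral_bound_linepath[OF c3 HB0]) (rule hor_seg, assumption, use T loa in \<open>auto simp: z3_def z4_def\<close>)
      also have "norm (z4 - z3) = a - lo" using loa by (simp add: z3_def z4_def cmod_def)
      finally show ?thesis .
    qed
    have T0: "T > 0" using T by simp
    have b2: "norm (contour_integral (linepath z2 z3) f) \<le> RB * pi"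
      unfolding z2_def z3_def
      by (rule contour_integral_vertical_bound[OF c2[unfolded z2_def z3_def] T0 _ RB]) (unfold RB_def, rule vert[OF order_refl CR'])
    have c4': "f contour_integrable_on linepath z1 z4"
      using c4 contour_integrable_reversepath[of "linepath z4 z1" f] by simp
    have b4: "norm (contour_integral (linepath z4 z1) f) \<le> LB * pi"
    proof -
      have "norm (contour_integral (linepath z1 z4) f) \<le> LB * pi"
        unfolding z1_def z4_def
        by (rule contour_integral_vertical_bound[OF c4'[unfolded z1_def z4_def] T0 _ LB]) (unfold LB_def, rule vert[OF less_imp_le[OF loa] CL'])
      moreover have "contour_integral (linepath z4 z1) f = - contour_integral (linepath z1 z4) f"
        using contour_integral_reversepath[of "linepath z1 z4" f] by simp
      ultimately show ?thesis by simp
    qed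
    have "2 * pi * norm AN = norm (2 * pi * \<i> * AN)" by (simp add: norm_mult)
    also have "\<dots> \<le> HB / T * (a - lo) + (RB * pi + (HB / T * (a - lo) + LB * pi))"
      unfolding total[symmetric] split by (intro norm_triangle_mono b1 b2 b3 b4)
    finally show ?thesis by (simp add: algebra_simps)
  qed
  have "2 * norm AN * pi \<le> (RB + LB) * pi"
  proof (rule tendsto_lowerbound)
    have "((\<lambda>T. (RB + LB) * pi + 2 * (HB / T * (a - lo))) \<longlongrightarrow> (RB + LB) * pi + 2 * (0 * (a - lo))) at_top"
      by (intro tendsto_add tendsto_mult tendsto_const real_tendsto_divide_at_top[OF tendsto_const filterlim_ident])
    then show "((\<lambda>T. (RB + LB) * pi + 2 * (HB / T * (a - lo))) \<longlongrightarrow> (RB + LB) * pi) at_top" by simp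
    show "\<forall>\<^sub>F T in at_top. 2 * norm AN * pi \<le> (RB + LB) * pi + 2 * (HB / T * (a - lo))"
      using eventually_ge_at_top[of 1] by eventually_elim (rule est)
  qed simp
  then have "2 * norm AN \<le> RB + LB" by simp
  moreover have "- lo = real N + 1/2" by (simp add: lo_def)
  ultimately show ?thesis unfolding AN_def RB_def LB_def by (simp only:)
qed

text \<open>With x fixed and N going to infinity, the partial sums tend to P(x) by
  \<open>P_taylor\<close>, and the contribution of the left side, of order x^N/N!, vanishes. Only
  the line Re s = a remains, and it gives x^(-a).\<close>

theorem riemann_hypothesis_imp_P_bound:
  fixes k \<epsilon> :: real
  assumes RH: "riemann_hypothesis" and k: "k \<ge> 1" and \<epsilon>: "0 < \<epsilon>" "\<epsilon> < 1/4"
  shows "\<exists>C. \<forall>x\<ge>1. \<bar>P k x\<bar> \<le> C * x powr (- k / 2 + 1/4 + \<epsilon>)"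
proof -
  define a where "a = k / 2 - 1/4 - \<epsilon>"
  have a: "a > 0" using k \<epsilon> by (simp add: a_def)
  \<comment> \<open>The margin is 2 \<epsilon> because Re s <= a means Re (k - 2 s) >= 1/2 + 2
    \<epsilon>. With \<epsilon> < 1/4 it stays below 1/2, and a is positive already for k =
    1.\<close>
  obtain C1 m where C1: "C1 > 0" "\<And>w. Re w \<ge> 1/2 + 2 * \<epsilon> \<Longrightarrow> norm (inv_zeta w) \<le> C1 * (\<bar>Im w\<bar> + 4) ^ m"
    using inv_zeta_polynomial_bound[OF RH, of "2 * \<epsilon>"] \<epsilon> by auto
  define C2 where "C2 = C1 * 4 ^ m"
  have C2: "C2 \<ge> 0" "\<And>s. Re s \<le> a \<Longrightarrow> norm (inv_zeta (of_real k - 2 * s)) \<le> C2 * (1 + \<bar>Im s\<bar>) ^ m"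
  proof -
    show "C2 \<ge> 0" using C1(1) by (simp add: C2_def)
    fix s assume "Re s \<le> a"
    then have "norm (inv_zeta (of_real k - 2 * s)) \<le> C1 * (\<bar>Im (of_real k - 2 * s)\<bar> + 4) ^ m" by (intro C1(2)) (simp add: a_def)
    also have "\<dots> \<le> C1 * (4 * (1 + \<bar>Im s\<bar>)) ^ m" using C1(1) by (intro mult_left_mono power_mono) auto
    finally show "norm (inv_zeta (of_real k - 2 * s)) \<le> C2 * (1 + \<bar>Im s\<bar>) ^ m" by (simp only: C2_def power_mult_distrib mult.assoc)
  qed
  obtain CR where CR: "CR > 0" "\<And>s. Re s = a \<Longrightarrow> norm (Gamma s) * (1 + \<bar>Im s\<bar>) ^ (m + 2) \<le> CR"
    using norm_Gamma_vertical_bound[OF a, of "m + 2"] by blast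
  obtain CL where CL: "CL > 0" "\<And>N s. Re s = - real N - 1/2 \<Longrightarrow> norm (Gamma s) * (1 + \<bar>Im s\<bar>) ^ (m + 2) \<le> CL / fact N"
    using norm_Gamma_left_bound[of "m + 2"] by blast
  have "\<bar>P k x\<bar> \<le> C2 * CR * x powr (- k / 2 + 1/4 + \<epsilon>)" if x: "x \<ge> 1" for x
  proof -
    define A where "A = (\<lambda>N. \<Sum>j\<le>N. complex_of_real ((- x) ^ j / fact j) * inv_zeta (of_real (k + 2 * real j)))"
    define B where "B = (\<Sum>n. 1 / (real (Suc n))\<^sup>2)"
    have pf: "(\<lambda>N. x ^ N / fact N) \<longlonglongrightarrow> 0"
      using summable_LIMSEQ_zero[OF summable_exp[of x]] by (simp add: divide_inverse mult.commute)
    have "(\<lambda>N. of_real (P k x) - A N) \<longlonglongrightarrow> 0"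
    proof (rule Lim_null_comparison)
      show "\<forall>\<^sub>F N in sequentially. norm (of_real (P k x) - A N) \<le> exp x * x * B * (x ^ N / fact N)"
        using P_taylor(2)[OF k, of x] x by (intro always_eventually) (simp add: A_def B_def mult_ac)
      show "(\<lambda>N. exp x * x * B * (x ^ N / fact N)) \<longlonglongrightarrow> 0" by (rule tendsto_mult_right_zero[OF pf])
    qed
    then have "(\<lambda>N. of_real (P k x) - (of_real (P k x) - A N)) \<longlonglongrightarrow> of_real (P k x) - 0" by (intro tendsto_intros)
    then have limA: "A \<longlonglongrightarrow> of_real (P k x)" by simp
    have est: "2 * norm (A N) \<le> C2 * CR * exp (- a * ln x) + C2 * CL * exp (ln x / 2) * (x ^ N / fact N)" for N
    proof -
      have "exp ((real N + 1/2) * ln x) = x ^ N * exp (ln x / 2)"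
        using x by (simp add: distrib_right exp_add exp_of_nat_mult)
      then show ?thesis
        using riesz_contour_estimate[OF RH k \<epsilon> x C2[unfolded a_def] less_imp_le[OF CR(1)] CR(2)[unfolded a_def] less_imp_le[OF CL(1)] CL(2), of N]
        by (simp add: A_def a_def mult_ac)
    qed
    have "2 * norm (complex_of_real (P k x)) \<le> C2 * CR * exp (- a * ln x) + C2 * CL * exp (ln x / 2) * 0"
      by (rule LIMSEQ_le[where X = "\<lambda>N. 2 * norm (A N)" and Y = "\<lambda>N. C2 * CR * exp (- a * ln x) + C2 * CL * exp (ln x / 2) * (x ^ N / fact N)"])
         (intro tendsto_intros limA pf, intro tendsto_intros limA pf, use est in auto)
    then have "2 * \<bar>P k x\<bar> \<le> C2 * CR * exp (- a * ln x)" by simp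
    moreover have "0 \<le> C2 * CR * exp (- a * ln x)" using C2(1) CR(1) by simp
    moreover have "exp (- a * ln x) = x powr (- k / 2 + 1/4 + \<epsilon>)"
    proof -
      have "- a = - k / 2 + 1/4 + \<epsilon>" by (simp add: a_def)
      then show ?thesis using x by (simp only: powr_def) simp
    qed
    ultimately show ?thesis by (simp only:)
  qed
  then show ?thesis by blast
qed

section \<open>From the bound to the Riemann hypothesis\<close>

lemma integral_derivative_greaterThan_0:
  fixes g F :: "real \<Rightarrow> complex"
  assumes int: "g absolutely_integrable_on {0<..}"
    and der: "\<And>x. x > 0 \<Longrightarrow> (F has_vector_derivative g x) (at x)"
    and lim0: "(\<lambda>N. F (1 / real (Suc N))) \<longlonglongrightarrow> 0" and lim1: "(\<lambda>N. F (real (Suc N))) \<longlonglongrightarrow> 0"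
  shows "integral {0<..} g = 0"
proof -
  have I: "integrable lebesgue (\<lambda>x. indicator {0<..} x *\<^sub>R g x)" using int unfolding set_integrable_def .
  let ?A = "\<lambda>N. {1 / real (Suc N)..real (Suc N)}"
  have "(\<lambda>N. \<integral>x. indicator (?A N) x *\<^sub>R (indicator {0<..} x *\<^sub>R g x) \<partial>lebesgue) \<longlonglongrightarrow> (\<integral>x. indicator {0<..} x *\<^sub>R g x \<partial>lebesgue)"
  proof (intro integral_dominated_convergence[where w = "\<lambda>x. norm (indicator {0<..} x *\<^sub>R g x)"] AE_I2)
    fix x :: real
    show "(\<lambda>N. indicator (?A N) x *\<^sub>R (indicator {0<..} x *\<^sub>R g x)) \<longlonglongrightarrow> indicator {0<..} x *\<^sub>R g x"
    proof (cases "x > 0")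
      case True
      have "eventually (\<lambda>N. real (Suc N) \<ge> x) sequentially" by real_asymp
      moreover have "eventually (\<lambda>N. 1 / real (Suc N) < x) sequentially"
        by (rule order_tendstoD(2)[OF LIMSEQ_Suc[OF lim_1_over_n] True])
      ultimately have "eventually (\<lambda>N. indicator (?A N) x *\<^sub>R (indicator {0<..} x *\<^sub>R g x) = indicator {0<..} x *\<^sub>R g x) sequentially"
        by eventually_elim (simp add: indicator_def)
      then show ?thesis by (rule tendsto_eventually)
    qed simp
  next
    show "integrable lebesgue (\<lambda>x. norm (indicator {0<..} x *\<^sub>R g x))" by (rule integrable_norm[OF I])
    show "(\<lambda>x. indicator {0<..} x *\<^sub>R g x) \<in> borel_measurable lebesgue" by (rule borel_measurable_integrable[OF I])
    show "(\<lambda>x. indicator (?A N) x *\<^sub>R (indicator {0<..} x *\<^sub>R g x)) \<in> borel_measurable lebesgue" for N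
      by (rule borel_measurable_scaleR[OF borel_measurable_indicator borel_measurable_integrable[OF I]]) auto
  qed (auto simp: indicator_def)
  moreover have "(\<integral>x. indicator (?A N) x *\<^sub>R (indicator {0<..} x *\<^sub>R g x) \<partial>lebesgue) = F (real (Suc N)) - F (1 / real (Suc N))" for N
  proof -
    have pos: "x > 0" if "x \<in> ?A N" for x
    proof -
      have "0 < 1 / real (Suc N)" by simp
      then show ?thesis using that by (meson atLeastAtMost_iff less_le_trans)
    qed
    have "(\<integral>x. indicator (?A N) x *\<^sub>R (indicator {0<..} x *\<^sub>R g x) \<partial>lebesgue) = (LINT x:?A N|lebesgue. g x)"
      unfolding set_lebesgue_integral_def using pos by (intro Bochner_Integration.integral_cong) (auto simp: indicator_def)
    also have "\<dots> = integral (?A N) g"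
      by (intro set_lebesgue_integral_eq_integral(2) set_integrable_subset[OF int]) (use pos in auto)
    also have "\<dots> = F (real (Suc N)) - F (1 / real (Suc N))"
    proof (rule integral_unique, rule fundamental_theorem_of_calculus)
      have "1 / real (Suc N) \<le> 1" "1 \<le> real (Suc N)" by (auto simp: divide_le_eq)
      then show "1 / real (Suc N) \<le> real (Suc N)" by (rule order_trans)
      show "(F has_vector_derivative g x) (at x within ?A N)" if "x \<in> ?A N" for x
        using der[OF pos[OF that]] by (rule has_vector_derivative_at_within)
    qed
    finally show ?thesis .
  qed
  moreover have "(\<integral>x. indicator {0<..} x *\<^sub>R g x \<partial>lebesgue) = integral {0<..} g"
    using set_lebesgue_integral_eq_integral(2)[OF int] unfolding set_lebesgue_integral_def .
  ultimately have "(\<lambda>N. F (real (Suc N)) - F (1 / real (Suc N))) \<longlonglongrightarrow> integral {0<..} g" by (simp only:)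
  moreover have "(\<lambda>N. F (real (Suc N)) - F (1 / real (Suc N))) \<longlonglongrightarrow> 0 - 0" by (intro tendsto_diff lim0 lim1)
  ultimately show ?thesis using LIMSEQ_unique by fastforce
qed

lemma norm_exp_minus_1_le: "x \<ge> 0 \<Longrightarrow> \<bar>exp (- x) - 1\<bar> \<le> x" "x \<ge> 0 \<Longrightarrow> \<bar>exp (- x) - 1\<bar> \<le> (1::real)"
  using exp_ge_add_one_self[of "- x"] by (auto simp: abs_if)

lemma absolutely_integrable_exp_minus_1:
  assumes s: "-1 < Re s" "Re s < 0"
  shows "(\<lambda>x. complex_of_real (exp (- x) - 1) * of_real x powr (s - 1)) absolutely_integrable_on {0<..}"
proof -
  let ?K = "\<lambda>x. complex_of_real (exp (- x) - 1)"
  have "(\<lambda>x. ?K (1 / x) * of_real x powr (- s - 1)) absolutely_integrable_on {1..}"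
  proof (rule absolutely_integrable_Mellin_at_top[where C = 1 and b = 1])
    show "continuous_on {1..} (\<lambda>x. ?K (1 / x))" by (intro continuous_intros) auto
    show "norm (?K (1 / x)) \<le> 1 * x powr - 1" if "x \<ge> 1" for x
      using norm_exp_minus_1_le(1)[of "1 / x"] that unfolding norm_of_real by (simp add: powr_minus inverse_eq_divide)
  qed (use s in auto)
  from Mellin_inversion_of_variable(1)[OF this]
  have "(\<lambda>x. ?K x * of_real x powr (s - 1)) absolutely_integrable_on {0<..1}" .
  moreover have "(\<lambda>x. ?K x * of_real x powr (s - 1)) absolutely_integrable_on {1..}"
  proof (rule absolutely_integrable_Mellin_at_top[where C = 1 and b = 0])
    show "continuous_on {1..} ?K" by (intro continuous_intros)
    show "norm (?K x) \<le> 1 * x powr - 0" if "x \<ge> 1" for x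
      using norm_exp_minus_1_le(2)[of x] that unfolding norm_of_real by simp
  qed (use s in auto)
  ultimately have "(\<lambda>x. ?K x * of_real x powr (s - 1)) absolutely_integrable_on ({0<..1} \<union> {1..})"
    by (rule absolutely_integrable_Un)
  moreover have "{0<..1} \<union> {1..} = {0::real<..}" by auto
  ultimately show ?thesis by (simp only:)
qed

lemma not_nonpos_Int_strip:
  fixes s :: complex
  assumes "-1 < Re s" "Re s < 0"
  shows "s \<notin> \<int>\<^sub>\<le>\<^sub>0"
proof
  assume "s \<in> \<int>\<^sub>\<le>\<^sub>0"
  then obtain n where "s = of_int n" by (elim nonpos_Ints_cases)
  then have "real_of_int (-1) < real_of_int n" "real_of_int n < real_of_int 0" using assms by simp_all
  then have "-1 < n" "n < 0" by (simp_all only: of_int_less_iff)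
  then show False by simp
qed

text \<open>Integration by parts: \<open>F\<close> has derivative s g1 - g2, where g2 is the
  integrand of Gamma(s + 1), and \<open>F\<close> tends to 0 at both ends because -1 < Re s < 0. The
  functional equation of Gamma then removes the factor s.\<close>

lemma Mellin_exp_minus_1:
  assumes s: "-1 < Re s" "Re s < 0"
  shows "integral {0<..} (\<lambda>x. complex_of_real (exp (- x) - 1) * of_real x powr (s - 1)) = Gamma s"
proof -
  let ?K = "\<lambda>x. complex_of_real (exp (- x) - 1)"
  define g1 where "g1 = (\<lambda>x. ?K x * of_real x powr (s - 1))"
  define g2 where "g2 = (\<lambda>t. complex_of_real t powr ((s + 1) - 1) / of_real (exp t))"
  have a1: "g1 absolutely_integrable_on {0<..}" unfolding g1_def by (rule absolutely_integrable_exp_minus_1[OF s])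
  have a2: "g2 absolutely_integrable_on {0<..}" unfolding g2_def by (rule absolutely_integrable_Gamma_integral') (use s in simp)
  have v2: "integral {0<..} g2 = Gamma (s + 1)"
    using Gamma_integral_complex'[of "s + 1"] s unfolding g2_def by (simp add: has_integral_iff)
  define F where "F = (\<lambda>x. ?K x * of_real x powr s)"
  have nF1: "norm (F x) \<le> x powr (1 + Re s)" if "x > 0" for x
    using mult_right_mono[OF norm_exp_minus_1_le(1)[of x], of "x powr Re s"] that
    unfolding F_def norm_mult norm_of_real norm_of_real_powr[OF that] by (simp add: powr_add)
  have nF2: "norm (F x) \<le> x powr Re s" if "x > 0" for x
    using mult_right_mono[OF norm_exp_minus_1_le(2)[of x], of "x powr Re s"] that
    unfolding F_def norm_mult norm_of_real norm_of_real_powr[OF that] by simp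
  have a: "(\<lambda>x. s * g1 x - g2 x) absolutely_integrable_on {0<..}" by (intro set_integral_diff(1) set_integrable_mult_right a1 a2)
  have "integral {0<..} (\<lambda>x. s * g1 x - g2 x) = 0"
  proof (rule integral_derivative_greaterThan_0[OF a])
    fix x :: real assume x: "x > 0"
    have "((\<lambda>z. (exp (- z) - 1) * z powr s) has_field_derivative (s * g1 x - g2 x)) (at (of_real x))"
      unfolding g1_def g2_def using x
      by (auto intro!: derivative_eq_intros simp: complex_nonpos_Reals_iff exp_minus exp_of_real[symmetric] field_simps)
    then have "((\<lambda>x. (exp (- complex_of_real x) - 1) * of_real x powr s) has_vector_derivative (s * g1 x - g2 x)) (at x)"
      by (rule has_vector_derivative_real_field)
    then show "(F has_vector_derivative (s * g1 x - g2 x)) (at x)" by (simp add: F_def exp_of_real[symmetric])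
  next
    show "(\<lambda>N. F (1 / real (Suc N))) \<longlonglongrightarrow> 0"
    proof (rule Lim_null_comparison)
      show "\<forall>\<^sub>F N in sequentially. norm (F (1 / real (Suc N))) \<le> (1 / real (Suc N)) powr (1 + Re s)"
        by (intro always_eventually allI nF1) simp
      show "(\<lambda>N. (1 / real (Suc N)) powr (1 + Re s)) \<longlonglongrightarrow> 0" using s by real_asymp
    qed
    show "(\<lambda>N. F (real (Suc N))) \<longlonglongrightarrow> 0"
    proof (rule Lim_null_comparison)
      show "\<forall>\<^sub>F N in sequentially. norm (F (real (Suc N))) \<le> real (Suc N) powr Re s"
        by (intro always_eventually allI nF2) simp
      show "(\<lambda>N. real (Suc N) powr Re s) \<longlonglongrightarrow> 0" using s by real_asymp
    qed
  qed
  moreover have "integral {0<..} (\<lambda>x. s * g1 x - g2 x) = integral {0<..} (\<lambda>x. s * g1 x) - integral {0<..} g2"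
    by (intro integral_diff set_lebesgue_integral_eq_integral(1) set_integrable_mult_right a1 a2)
  ultimately have "s * integral {0<..} g1 = Gamma (s + 1)" by (simp add: v2)
  moreover have "Gamma (s + 1) = s * Gamma s"
    by (rule Gamma_plus1[OF not_nonpos_Int_strip[OF s]])
  moreover have "s \<noteq> 0" using s by auto
  ultimately show ?thesis unfolding g1_def by simp
qed

text \<open>Subtracting the value at 0 brings in the factor 1/n^2, so the differences converge
  absolutely even for k = 1, and they are O(x) at 0.\<close>

lemma P_sub_P_0:
  assumes k: "k \<ge> 1" and x: "x \<ge> 0"
  shows "(\<lambda>n. moebius_mu (Suc n) / real (Suc n) powr k * (exp (- (1 / (real (Suc n))\<^sup>2 * x)) - 1)) sums (P k x - P k 0)"
    "\<bar>moebius_mu (Suc n) / real (Suc n) powr k * (exp (- (1 / (real (Suc n))\<^sup>2 * x)) - 1)\<bar> \<le> x * (1 / (real (Suc n))\<^sup>2)"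
    "\<bar>P k x - P k 0\<bar> \<le> x * (\<Sum>n. 1 / (real (Suc n))\<^sup>2)"
proof -
  let ?t = "\<lambda>n. moebius_mu (Suc n) / real (Suc n) powr k * (exp (- (1 / (real (Suc n))\<^sup>2 * x)) - 1)"
  from sums_diff[OF P_taylor(1)[OF k x] P_taylor(1)[OF k order_refl]]
  show S: "?t sums (P k x - P k 0)" by (simp add: right_diff_distrib)
  show le: "\<bar>?t n\<bar> \<le> x * (1 / (real (Suc n))\<^sup>2)" for n
  proof -
    have "real (Suc n) powr k \<ge> 1" using k by (intro ge_one_powr_ge_zero) auto
    then have "\<bar>moebius_mu (Suc n) / real (Suc n) powr k\<bar> \<le> 1" using abs_moebius_mu_le[of "Suc n"] unfolding abs_divide
      by (subst divide_le_eq) auto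
    moreover have "\<bar>exp (- (1 / (real (Suc n))\<^sup>2 * x)) - 1\<bar> \<le> 1 / (real (Suc n))\<^sup>2 * x" using x by (intro norm_exp_minus_1_le(1)) simp
    ultimately have "\<bar>moebius_mu (Suc n) / real (Suc n) powr k\<bar> * \<bar>exp (- (1 / (real (Suc n))\<^sup>2 * x)) - 1\<bar> \<le> 1 * (1 / (real (Suc n))\<^sup>2 * x)"
      by (intro mult_mono) auto
    then show ?thesis by (simp add: abs_mult mult.commute)
  qed
  note smB = summable_inverse_Suc_square
  have "norm (\<Sum>n. ?t n) \<le> (\<Sum>n. x * (1 / (real (Suc n))\<^sup>2))"
    by (rule norm_suminf_le[OF _ summable_mult[OF smB]]) (use le in simp)
  then show "\<bar>P k x - P k 0\<bar> \<le> x * (\<Sum>n. 1 / (real (Suc n))\<^sup>2)"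
    unfolding suminf_mult[OF smB] sums_unique[OF S] by simp
qed

text \<open>The Weierstrass test is applied to the differences from P(0), since for k = 1 the series
  of P itself converges only conditionally. It works on bounded intervals, and continuity is
  local.\<close>

lemma continuous_on_P:
  assumes k: "k \<ge> 1"
  shows "continuous_on {0..} (P k)"
proof -
  have cX: "continuous_on {0..X} (P k)" for X
  proof -
    let ?t = "\<lambda>n x. moebius_mu (Suc n) / real (Suc n) powr k * (exp (- (1 / (real (Suc n))\<^sup>2 * x)) - 1)"
    have "uniform_limit {0..X} (\<lambda>N x. \<Sum>n<N. ?t n x) (\<lambda>x. \<Sum>n. ?t n x) sequentially"
    proof (rule Weierstrass_m_test[OF _ summable_mult[OF summable_inverse_Suc_square, of X]])
      fix n x assume x: "x \<in> {0..X}"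
      then have "\<bar>?t n x\<bar> \<le> x * (1 / (real (Suc n))\<^sup>2)" by (intro P_sub_P_0(2)[OF k]) auto
      also have "\<dots> \<le> X * (1 / (real (Suc n))\<^sup>2)" using x by (intro mult_right_mono) auto
      finally show "norm (?t n x) \<le> X * (1 / (real (Suc n))\<^sup>2)" by simp
    qed
    then have "continuous_on {0..X} (\<lambda>x. \<Sum>n. ?t n x)"
      by (rule uniform_limit_theorem[rotated]) (auto intro!: always_eventually continuous_intros)
    then have "continuous_on {0..X} (\<lambda>x. P k 0 + (\<Sum>n. ?t n x))" by (intro continuous_intros)
    moreover have "P k 0 + (\<Sum>n. ?t n x) = P k x" if "x \<in> {0..X}" for x
      using sums_unique[OF P_sub_P_0(1)[OF k, of x]] that by simp
    ultimately show ?thesis by (rule continuous_on_eq)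
  qed
  show ?thesis unfolding continuous_on_eq_continuous_within
  proof
    fix x :: real assume "x \<in> {0..}"
    moreover have "at x within {0..} = at x within {0..x + 1}"
      by (rule at_within_nhd[of _ "{..<x + 1}"]) auto
    ultimately show "continuous (at x within {0..}) (P k)"
      using cX[of "x + 1"] unfolding continuous_on_eq_continuous_within by simp
  qed
qed

text \<open>\<open>Mellin_series\<close> with a_n = 1/n^2 turns the coefficient mu(n)/n^k into mu(n)
  n^(2 s - k). Since Re s < 0 and k >= 1, the argument k - 2 s has real part above 1.\<close>

lemma Mellin_P_sub_P_0:
  assumes k: "k \<ge> 1" and s: "-1 < Re s" "Re s < 0"
  shows "(\<lambda>x. complex_of_real (P k x - P k 0) * of_real x powr (s - 1)) absolutely_integrable_on {0<..}"
    "integral {0<..} (\<lambda>x. complex_of_real (P k x - P k 0) * of_real x powr (s - 1)) = inv_zeta (of_real k - 2 * s) * Gamma s"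
proof -
  define K where "K = (\<lambda>x::real. complex_of_real (exp (- x) - 1))"
  define a where "a = (\<lambda>n. 1 / (real (Suc n))\<^sup>2)"
  define c where "c = (\<lambda>n. complex_of_real (moebius_mu (Suc n) / real (Suc n) powr k))"
  have a: "a n > 0" for n by (simp add: a_def)
  have int: "(\<lambda>x. K x * of_real x powr (s - 1)) absolutely_integrable_on {0<..}" unfolding K_def by (rule absolutely_integrable_exp_minus_1[OF s])
  have val: "integral {0<..} (\<lambda>x. K x * of_real x powr (s - 1)) = Gamma s" unfolding K_def by (rule Mellin_exp_minus_1[OF s])
  have Rew: "Re (of_real k - 2 * s) > 1" using k s by simp
  have lna: "ln (a n) = - 2 * ln (real (Suc n))" for n by (simp add: a_def ln_div ln_realpow)
  have ca: "c n * of_real (a n) powr (- s) = moebius_term (of_real k - 2 * s) (Suc n)" for n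
  proof -
    define L where "L = complex_of_real (ln (real (Suc n)))"
    have 1: "complex_of_real (real (Suc n) powr k) = exp (of_real k * L)"
      using powr_of_real[of "real (Suc n)" k, symmetric] of_real_powr_eq_exp[of "real (Suc n)" "of_real k"] by (simp add: L_def)
    have 2: "of_real (a n) powr (- s) = exp (2 * s * L)" unfolding of_real_powr_eq_exp[OF a] lna L_def by (simp add: mult_ac)
    have 3: "complex_of_nat (Suc n) powr (of_real k - 2 * s) = exp ((of_real k - 2 * s) * L)"
      using of_real_powr_eq_exp[of "real (Suc n)" "of_real k - 2 * s"] by (simp add: L_def)
    have 4: "exp ((of_real k - 2 * s) * L) = exp (of_real k * L) / exp (2 * s * L)" by (simp add: left_diff_distrib exp_diff)
    show ?thesis unfolding moebius_term_def zeta_term_def c_def of_real_divide 1 2 3 4 by simp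
  qed
  have sum: "summable (\<lambda>n. norm (c n) * a n powr (- Re s))"
  proof -
    have "norm (c n) * a n powr (- Re s) = norm (c n * of_real (a n) powr (- s))" for n
      by (simp add: norm_mult norm_of_real_powr[OF a])
    then show ?thesis unfolding ca using summable_norm_moebius_term[OF Rew] by simp
  qed
  have pw: "summable (\<lambda>n. norm (c n * K (a n * x)))" if "x > 0" for x
  proof (rule summable_comparison_test')
    show "summable (\<lambda>n. x * (1 / (real (Suc n))\<^sup>2))" by (intro summable_mult summable_inverse_Suc_square)
    show "norm (norm (c n * K (a n * x))) \<le> x * (1 / (real (Suc n))\<^sup>2)" if "n \<ge> 0" for n
      using P_sub_P_0(2)[OF k, of x n] \<open>x > 0\<close> unfolding c_def K_def a_def of_real_mult[symmetric] norm_of_real real_norm_def by simp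
  qed
  have suminf: "(\<Sum>n. c n * K (a n * x)) = of_real (P k x - P k 0)" if "x > 0" for x
    using sums_unique[OF sums_of_real[OF P_sub_P_0(1)[OF k, of x], where ?'a = complex]] that
    unfolding c_def K_def a_def of_real_mult[symmetric] by simp
  note M = Mellin_series[OF a int sum pw]
  show "(\<lambda>x. complex_of_real (P k x - P k 0) * of_real x powr (s - 1)) absolutely_integrable_on {0<..}"
    by (rule set_integrable_cong[THEN iffD1, OF refl refl _ M(1)]) (simp only: suminf greaterThan_iff)
  have eq: "integral {0<..} (\<lambda>x. (\<Sum>n. c n * K (a n * x)) * of_real x powr (s - 1)) = 
     integral {0<..} (\<lambda>x. complex_of_real (P k x - P k 0) * of_real x powr (s - 1))"
    by (rule integral_cong) (simp only: suminf greaterThan_iff)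
  from sums_unique2[OF M(2)[unfolded ca val eq] sums_mult2[OF inv_zeta_sums[OF Rew]]]
  show "integral {0<..} (\<lambda>x. complex_of_real (P k x - P k 0) * of_real x powr (s - 1)) = inv_zeta (of_real k - 2 * s) * Gamma s" .
qed

text \<open>The Mellin integral is split at 1. The lower part \<open>G (- s)\<close> is holomorphic
  for Re s > -1 and the upper part \<open>F\<close> for Re s < b by the assumed bound; the constant
  P(0) contributes only p0/s. The resulting identity extends to -1 < Re s < b, where a zero of zeta
  would contradict Gamma(s + 1) being nonzero.\<close>

lemma P_bound_imp_zeta_nonzero:
  fixes k b :: real
  assumes k: "k \<ge> 1" and b: "b > 0" and bd: "\<And>x. x \<ge> 1 \<Longrightarrow> \<bar>P k x\<bar> \<le> C * x powr (- b)"
    and s0: "-1 < Re s0" "Re s0 < b" and w1: "of_real k - 2 * s0 \<noteq> 1"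
  shows "riemann_zeta (of_real k - 2 * s0) \<noteq> 0"
proof -
  define p0 where "p0 = complex_of_real (P k 0)"
  define F where "F = (\<lambda>s. integral {1..} (\<lambda>x. complex_of_real (P k x) * of_real x powr (s - 1)))"
  define h where "h = (\<lambda>x. complex_of_real (P k (1 / x) - P k 0))"
  define G where "G = (\<lambda>s. integral {1..} (\<lambda>x. h x * of_real x powr (s - 1)))"
  define B where "B = (\<Sum>n. 1 / (real (Suc n))\<^sup>2)"
  have contP: "continuous_on {1..} (\<lambda>x. complex_of_real (P k x))"
    by (intro continuous_intros continuous_on_subset[OF continuous_on_P[OF k]]) auto
  have bdP: "norm (complex_of_real (P k x)) \<le> C * x powr (- b)" if "x \<ge> 1" for x using bd[OF that] by simp
  have conth: "continuous_on {1..} h" unfolding h_def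
    by (intro continuous_intros continuous_on_compose2[OF continuous_on_P[OF k]]) auto
  have bdh: "norm (h x) \<le> B * x powr (- 1)" if "x \<ge> 1" for x
    using P_sub_P_0(3)[OF k, of "1 / x"] that unfolding h_def norm_of_real B_def by (simp add: powr_minus divide_inverse mult.commute)
  have holF: "F holomorphic_on {s. Re s < b}" unfolding F_def by (rule holomorphic_Mellin_at_top[OF contP bdP])
  have holG: "G holomorphic_on {s. Re s < 1}" unfolding G_def by (rule holomorphic_Mellin_at_top[OF conth bdh])
  have id: "G (- s) + F s + p0 / s = inv_zeta (of_real k - 2 * s) * Gamma s" if s: "-1 < Re s" "Re s < 0" for s
  proof -
    let ?f = "\<lambda>x. complex_of_real (P k x - P k 0) * of_real x powr (s - 1)"
    have ah: "(\<lambda>x. h x * of_real x powr (- s - 1)) absolutely_integrable_on {1..}"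
      by (rule absolutely_integrable_Mellin_at_top[OF conth bdh]) (use s in auto)
    note inv = Mellin_inversion_of_variable[OF ah[unfolded h_def]]
    have aP: "(\<lambda>x. complex_of_real (P k x) * of_real x powr (s - 1)) absolutely_integrable_on {1..}"
      by (rule absolutely_integrable_Mellin_at_top[OF contP bdP]) (use s b in auto)
    have a1: "(\<lambda>x. p0 * of_real x powr (s - 1)) absolutely_integrable_on {1..}"
      by (intro set_integrable_mult_right integral_powr_at_top(1) s)
    note io = set_lebesgue_integral_eq_integral(1)
    have f_eq: "?f = (\<lambda>x. complex_of_real (P k x) * of_real x powr (s - 1) - p0 * of_real x powr (s - 1))"
      by (simp add: p0_def fun_eq_iff left_diff_distrib)
    have af: "?f absolutely_integrable_on {1..}" unfolding f_eq by (rule set_integral_diff(1)[OF aP a1])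
    have "integral {1..} ?f = F s - integral {1..} (\<lambda>x. p0 * of_real x powr (s - 1))"
      unfolding f_eq F_def by (rule integral_diff[OF io[OF aP] io[OF a1]])
    also have "integral {1..} (\<lambda>x. p0 * of_real x powr (s - 1)) = p0 * (- 1 / s)"
      by (simp only: integral_mult_right integral_powr_at_top(2)[OF s(2)])
    finally have hi: "integral {1..} ?f = F s + p0 / s" by simp
    have lo: "integral {0<..1} ?f = G (- s)" using inv(2) unfolding G_def h_def .
    have "integral ({0<..1} \<union> {1..}) ?f = integral {0<..1} ?f + integral {1..} ?f"
      by (rule integral_Un[OF io[OF inv(1)] io[OF af]]) (rule negligible_subset[of "{1}"], auto)
    moreover have "{0<..1} \<union> {1..} = {0::real<..}" by auto
    ultimately have "integral {0<..} ?f = G (- s) + (F s + p0 / s)" by (simp only: lo hi)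
    then show ?thesis using Mellin_P_sub_P_0(2)[OF k s] by (simp only: add.assoc)
  qed
  define D where "D = {s. Re s > -1} \<inter> {s. Re s < b}"
  \<comment> \<open>The identity is multiplied by s and by \<open>zeta_entire\<close>. This clears
    the poles at s = 0 and also those that 1/zeta might have, so both sides are holomorphic before
    anything is known about zeros.\<close>
  define L where "L = (\<lambda>s. zeta_entire (of_real k - 2 * s) * (s * G (- s) + s * F s + p0))"
  define R where "R = (\<lambda>s::complex. (of_real k - 2 * s - 1) * Gamma (s + 1))"
  have "L s0 = R s0"
  proof (rule analytic_continuation_open[where s = "{s. Re s > -1} \<inter> {s. Re s < 0}" and s' = D and f = L and g = R])
    show "open ({s. Re s > -1} \<inter> {s. Re s < 0})" "open D" unfolding D_def
      by (intro open_Int open_halfspace_Re_gt open_halfspace_Re_lt)+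
    have "of_real (- 1/2) \<in> {s. Re s > -1} \<inter> {s. Re s < 0}" by simp
    then show "{s. Re s > -1} \<inter> {s. Re s < 0} \<noteq> {}" by blast
    show "connected D" unfolding D_def by (intro convex_connected convex_Int convex_halfspace_Re_gt convex_halfspace_Re_lt)
    show "L holomorphic_on D"
    proof -
      have 1: "(\<lambda>s. zeta_entire (of_real k - 2 * s)) holomorphic_on D"
        by (intro holomorphic_on_compose_gen[OF _ holomorphic_zeta_entire[of UNIV], unfolded o_def] holomorphic_intros) auto
      have 2: "(\<lambda>s. G (- s)) holomorphic_on D"
        by (intro holomorphic_on_compose_gen[OF _ holG, unfolded o_def] holomorphic_intros) (auto simp: D_def)
      have 3: "F holomorphic_on D" by (rule holomorphic_on_subset[OF holF]) (auto simp: D_def)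
      show ?thesis unfolding L_def by (intro holomorphic_on_mult holomorphic_on_add 1 2 3 holomorphic_on_const holomorphic_on_ident)
    qed
    have "s + 1 \<notin> \<int>\<^sub>\<le>\<^sub>0" if "s \<in> D" for s using that by (auto simp: D_def elim!: nonpos_Ints_cases dest: arg_cong[where f = Re])
    then show "R holomorphic_on D" unfolding R_def by (intro holomorphic_intros) auto
    show "{s. Re s > -1} \<inter> {s. Re s < 0} \<subseteq> D" using b by (auto simp: D_def)
    show "s0 \<in> D" using s0 by (simp add: D_def)
    fix s assume "s \<in> {s. Re s > -1} \<inter> {s. Re s < 0}"
    then have s: "-1 < Re s" "Re s < 0" by auto
    have sn: "s \<noteq> 0" using s by auto
    have "s * G (- s) + s * F s + p0 = s * (G (- s) + F s + p0 / s)" using sn by (simp add: distrib_left)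
    also have "\<dots> = inv_zeta (of_real k - 2 * s) * (s * Gamma s)" unfolding id[OF s] by simp
    also have "s * Gamma s = Gamma (s + 1)" by (rule Gamma_plus1[OF not_nonpos_Int_strip[OF s], symmetric])
    finally have "L s = (zeta_entire (of_real k - 2 * s) * inv_zeta (of_real k - 2 * s)) * Gamma (s + 1)" by (simp add: L_def)
    also have "zeta_entire (of_real k - 2 * s) * inv_zeta (of_real k - 2 * s) = of_real k - 2 * s - 1"
    proof -
      have "zeta_entire (of_real k - 2 * s) \<noteq> 0" by (rule zeta_entire_nonzero) (use k s in simp)
      then show ?thesis by (simp add: inv_zeta_def)
    qed
    finally show "L s = R s" by (simp add: R_def)
  qed
  moreover have "R s0 \<noteq> 0"
  proof -
    have "Gamma (s0 + 1) \<noteq> 0" unfolding Gamma_eq_zero_iff using s0 by (auto elim!: nonpos_Ints_cases dest: arg_cong[where f = Re])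
    then show ?thesis using w1 by (simp add: R_def)
  qed
  ultimately have "zeta_entire (of_real k - 2 * s0) \<noteq> 0" by (auto simp: L_def)
  then show ?thesis using w1 by (simp add: zeta_entire_nonzero_iff)
qed

theorem P_bound_imp_riemann_hypothesis:
  fixes k :: real
  assumes k: "k \<ge> 1" and bd: "\<And>\<epsilon>. \<epsilon> > 0 \<Longrightarrow> P k \<in> O[at_top](\<lambda>x. x powr (- k / 2 + 1/4 + \<epsilon>))"
  shows "riemann_hypothesis"
proof -
  have right: "riemann_zeta \<rho> \<noteq> 0" if \<rho>: "1/2 < Re \<rho>" "Re \<rho> < 1" for \<rho>
  proof -
    \<comment> \<open>Then Re \<rho> / 2 = 1/4 + 2 \<epsilon>, so s0 = (k - \<rho>)/2 has real part
      k/2 - 1/4 - 2 \<epsilon>, strictly below b.\<close>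
    define \<epsilon> where "\<epsilon> = (Re \<rho> - 1/2) / 4"
    have \<epsilon>: "\<epsilon> > 0" "\<epsilon> < 1/8" using \<rho> by (auto simp: \<epsilon>_def)
    define b where "b = k / 2 - 1/4 - \<epsilon>"
    have b: "b > 0" using k \<epsilon> by (simp add: b_def)
    have e: "- k / 2 + 1/4 + \<epsilon> = - b" by (simp add: b_def)
    obtain c where "eventually (\<lambda>x. norm (P k x) \<le> c * norm (x powr (- b))) at_top"
      using bd[OF \<epsilon>(1)] unfolding e by (elim landau_o.bigE)
    then obtain X where X: "\<And>x. x \<ge> X \<Longrightarrow> \<bar>P k x\<bar> \<le> c * x powr (- b)"
      unfolding eventually_at_top_linorder by auto
    define Y where "Y = max X 1"
    \<comment> \<open>The O-bound holds only for large x. Continuity on the compact interval up to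
      \<open>Y\<close> extends it, with a larger constant, to all x >= 1.\<close>
    have "continuous_on {1..Y} (\<lambda>x. P k x * x powr b)"
      by (intro continuous_intros continuous_on_subset[OF continuous_on_P[OF k]]) auto
    then have "compact ((\<lambda>x. P k x * x powr b) ` {1..Y})" by (intro compact_continuous_image) auto
    then have "bounded ((\<lambda>x. P k x * x powr b) ` {1..Y})" by (rule compact_imp_bounded)
    then obtain D where "\<forall>x\<in>{1..Y}. \<bar>P k x * x powr b\<bar> \<le> D"
      unfolding bounded_iff by auto
    then have D: "\<bar>P k x * x powr b\<bar> \<le> D" if "x \<in> {1..Y}" for x using that by blast
    have le: "\<bar>P k x\<bar> \<le> max c D * x powr (- b)" if x: "x \<ge> 1" for x
    proof (cases "x \<le> Y")
      case True
      then have "\<bar>P k x\<bar> * x powr b \<le> D" using D[of x] x by (simp add: abs_mult)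
      then have "\<bar>P k x\<bar> \<le> D * x powr (- b)" using x by (simp add: powr_minus field_simps)
      also have "\<dots> \<le> max c D * x powr (- b)" by (intro mult_right_mono) auto
      finally show ?thesis .
    next
      case False
      then have "\<bar>P k x\<bar> \<le> c * x powr (- b)" by (intro X) (simp add: Y_def)
      also have "\<dots> \<le> max c D * x powr (- b)" by (intro mult_right_mono) auto
      finally show ?thesis .
    qed
    define s0 where "s0 = of_real (k / 2) - \<rho> / 2"
    have w: "of_real k - 2 * s0 = \<rho>" by (simp add: s0_def algebra_simps)
    have "riemann_zeta (of_real k - 2 * s0) \<noteq> 0"
    proof (rule P_bound_imp_zeta_nonzero[OF k b le])
      show "-1 < Re s0" "Re s0 < b" using \<rho> k by (auto simp: s0_def b_def \<epsilon>_def field_simps)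
      show "of_real k - 2 * s0 \<noteq> 1" unfolding w using \<rho> by auto
    qed
    then show ?thesis unfolding w .
  qed
  show ?thesis unfolding riemann_hypothesis_def
  proof (intro allI impI)
    fix s assume s: "riemann_zeta s = 0 \<and> 0 < Re s \<and> Re s < 1"
    then have "riemann_zeta (1 - s) = 0" using riemann_zeta_zero_reflect by blast
    then show "Re s = 1/2" using right[of s] right[of "1 - s"] s by fastforce
  qed
qed

theorem theorem1p2:
  fixes k :: real
  assumes "k \<ge> 1"
  shows "riemann_hypothesis \<longleftrightarrow>
    (\<forall>\<epsilon>>0. P k \<in> O[at_top](\<lambda>x. x powr (- k / 2 + 1 / 4 + \<epsilon>)))"
proof
  assume RH: riemann_hypothesis
  show "\<forall>\<epsilon>>0. P k \<in> O[at_top](\<lambda>x. x powr (- k / 2 + 1 / 4 + \<epsilon>))"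
  proof (intro allI impI)
    fix \<epsilon> :: real assume \<epsilon>: "\<epsilon> > 0"
    \<comment> \<open>The contour argument requires an exponent below 1/4. A smaller \<delta> gives
      the stronger bound, which implies the one for \<epsilon> when x >= 1.\<close>
    define \<delta> where "\<delta> = min \<epsilon> (1/8)"
    have \<delta>: "0 < \<delta>" "\<delta> < 1/4" "\<delta> \<le> \<epsilon>" using \<epsilon> by (auto simp: \<delta>_def)
    obtain C where C: "\<forall>x\<ge>1. \<bar>P k x\<bar> \<le> C * x powr (- k / 2 + 1/4 + \<delta>)"
      using riemann_hypothesis_imp_P_bound[OF RH assms \<delta>(1,2)] by blast
    show "P k \<in> O[at_top](\<lambda>x. x powr (- k / 2 + 1 / 4 + \<epsilon>))"
    proof (rule bigoI[where c = "\<bar>C\<bar>"])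
      show "\<forall>\<^sub>F x in at_top. norm (P k x) \<le> \<bar>C\<bar> * norm (x powr (- k / 2 + 1 / 4 + \<epsilon>))"
        using eventually_ge_at_top[of 1]
      proof eventually_elim
        case (elim x)
        have "\<bar>P k x\<bar> \<le> C * x powr (- k / 2 + 1/4 + \<delta>)" using C elim by blast
        also have "\<dots> \<le> \<bar>C\<bar> * x powr (- k / 2 + 1/4 + \<epsilon>)"
          using elim \<delta>(3) by (intro mult_mono powr_mono) auto
        finally show ?case by simp
      qed
    qed
  qed
next
  assume "\<forall>\<epsilon>>0. P k \<in> O[at_top](\<lambda>x. x powr (- k / 2 + 1 / 4 + \<epsilon>))"
  then show riemann_hypothesis using P_bound_imp_riemann_hypothesis[OF assms] by blast
qed

end
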